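(* To any abelian arrangement $\mathcal{A}$ one may assign a matroid scheme $\mathscr{M}(\mathcal{A})$ such that there is an isomorphism of posets $P(\mathcal{A})\cong F(\mathscr{M}(\mathcal{A}))$ identifying the layers of $\mathcal{A}$ with the flats of $\mathscr{M}(\mathcal{A})$. Moreover, for $H_0\in\mathcal{A}$ and $X\in P(\mathcal{A})$ (regarded as elements of the underlying simplicial poset via this identification, $H_0$ being an atom) one has isomorphisms of matroid schemes $\mathscr{M}(\mathcal{A}\setminus\{H_0\})\cong\mathscr{M}(\mathcal{A})-H_0$, $\mathscr{M}(\mathcal{A}^{H_0})\cong\mathscr{M}(\mathcal{A})_{/H_0}$, and $\mathscr{M}(\mathcal{A}_X)\cong\mathscr{M}(\mathcal{A})_X$.
   Context: Fix a finite-dimensional connected abelian Lie group $\mathbb{G}$ and a finite-rank free abelian group $\Gamma$. For $(\alpha,t)\in\Gamma\times\mathbb{G}$ let $H_{\alpha,t}=\{\varphi\in\mathrm{Hom}(\Gamma,\mathbb{G}):\varphi(\alpha)=t\}$. An abelian arrangement is a collection $\mathcal{A}=\{H_{\alpha,t}:(\alpha,t)\in\mathfrak{X}\}$ for a finite set $\mathfrak{X}\subseteq\Gamma\times\mathbb{G}$ chosen so that each $H_{\alpha,t}$ is connected. A layer is a connected component of an intersection $\bigcap_{H\in\mathcal{B}}H$, $\mathcal{B}\subseteq\mathcal{A}$ (the empty intersection giving $\mathrm{Hom}(\Gamma,\mathbb{G})$); $P(\mathcal{A})$ is the poset of layers ordered by reverse inclusion, whose atoms are identified with the elements of $\mathcal{A}$.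 The deletion of $H_0\in\mathcal{A}$ is $\mathcal{A}\setminus\{H_0\}$; the restriction $\mathcal{A}^{H_0}$ is the collection of nonempty connected components of $H_0\cap H$, $H\in\mathcal{A}\setminus\{H_0\}$, viewed as an abelian arrangement in $H_0\cong\mathrm{Hom}(\Gamma_\alpha,\mathbb{G})$ where $H_0=H_{\alpha,t}$ and $\Gamma=\mathbb{Z}\alpha\oplus\Gamma_\alpha$. For a layer $X$, let $\mathfrak{X}_X=\{\alpha\in\Gamma:(\alpha,t)\in\mathfrak{X},\ H_{\alpha,t}\supseteq X\text{ for some }t\}$; the localization $\mathcal{A}_X$ is the arrangement of linear subspaces $H_{\alpha,0}\subseteq\mathrm{Hom}(\Gamma,\mathbb{R}^{\dim\mathbb{G}})$, $\alpha\in\mathfrak{X}_X$ (an abelian arrangement with Lie group $\mathbb{R}^{\dim\mathbb{G}}$). Matroid schemes: a finite simplicial poset $S$ has a unique minimum, is ranked, and each $S_{\le x}$ is isomorphic to the Boolean lattice on the atoms below $x$; $|x|$ is the rank, $\bigvee T$/$\bigwedge T$ the sets of minimal upper/maximal lower bounds, $x\vee y$, $x\wedge y$ accordingly. A matroid scheme $(S,\rho)$, $\rho:S\to\mathbb{Z}_{\ge0}$, satisfies (M1) $0\le\rho(x)\le|x|$; (M2) $x\le y\Rightarrow\rho(x)\le\rho(y)$; (M3) $u\in x\vee y\Rightarrow\rho(x)+\rho(y)\ge\rho(u)+\rho(x\wedge y)$; (M4) $\ell\in x\wedge y$, $\rho(x)=\rho(\ell)\Rightarrow x\vee y\neq\emptyset$;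 (M5) $\rho(x)<\rho(y)\Rightarrow$ some atom $a\le y$, $a\not\le x$, $x\vee a\ne\emptyset$. Isomorphism: poset isomorphism preserving $\rho$. Closure $\mathrm{cl}(x)$: the unique maximal element of $\{y\ge x:\rho(y)=\rho(x)\}$; flats: $\mathrm{cl}(x)=x$; $F(\mathscr{M})$ the poset of flats. Deletion of an atom $a$: $\mathscr{M}-a=(S_{\not\ge a},\rho|)$. Contraction by $x$: $\mathscr{M}_{/x}=(S_{\ge x},\rho-\rho(x))$. Localization at $x$: $\mathscr{M}_x=(S_{\le x},\rho|_{S_{\le x}})$. *)

theory Defs
  imports "HOL-Analysis.Analysis"
begin

section \<open>Finitely generated free abelian groups\<close>

primrec nmult :: "nat \<Rightarrow> 'a::ab_group_add \<Rightarrow> 'a" where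
  "nmult 0 x = 0"
| "nmult (Suc n) x = x + nmult n x"

definition zmult :: "int \<Rightarrow> 'a::ab_group_add \<Rightarrow> 'a" where
  "zmult k x = nmult (nat k) x - nmult (nat (- k)) x"

lemma nmult_plus: "nmult (m + n) x = nmult m x + nmult n x"
  by (induction m) (auto simp: algebra_simps)

lemma nmult_add_right: "nmult n (x + y) = nmult n x + nmult n y"
  by (induction n) (auto simp: algebra_simps)

lemma nmult_nmult: "nmult m (nmult n x) = nmult (m * n) x"
  by (induction m) (auto simp: nmult_plus)

lemma nmult_zero_right: "nmult n (0::'a::ab_group_add) = 0"
  by (induction n) auto

lemma nmult_diff_right: "nmult n (x - y) = nmult n x - nmult n y"
proof -
  have "nmult n (x - y) + nmult n y = nmult n x"
    by (simp flip: nmult_add_right)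
  then show ?thesis
    by (metis add_diff_cancel_right')
qed

lemma zmult_diff: "zmult (int m - int n) x = nmult m x - nmult n x"
proof (cases "n \<le> m")
  case True
  then obtain d where "m = n + d" using le_Suc_ex by blast
  then show ?thesis by (simp add: zmult_def nmult_plus)
next
  case False
  then obtain d where "n = m + d" using le_Suc_ex[of m n] by auto
  then show ?thesis by (simp add: zmult_def nmult_plus)
qed

interpretation zmod: module "zmult :: int \<Rightarrow> 'a::ab_group_add \<Rightarrow> 'a"
proof
  fix a b :: int and x y :: 'a
  obtain m n p q where a: "a = int m - int n" and b: "b = int p - int q"
    by (metis int_diff_cases)
  show "zmult a (x + y) = zmult a x + zmult a y"
    by (simp add: a zmult_diff nmult_add_right)
  have "a + b = int (m + p) - int (n + q)"
    by (simp add: a b)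
  then show "zmult (a + b) x = zmult a x + zmult b x"
    by (simp only: a b zmult_diff nmult_plus) (simp add: algebra_simps)
  have "a * b = int (m * p + n * q) - int (m * q + n * p)"
    by (simp add: a b algebra_simps)
  then show "zmult a (zmult b x) = zmult (a * b) x"
    by (simp only: a b zmult_diff nmult_plus nmult_diff_right nmult_nmult)
      (simp add: algebra_simps)
  show "zmult 1 x = x"
    by (simp add: zmult_def)
qed

text \<open>The groups in question are subgroups of a type, so that a direct summand of one is
  again one.\<close>

definition free_abelian_finite_rank :: "'a::ab_group_add set \<Rightarrow> bool" where
  "free_abelian_finite_rank \<Gamma> \<longleftrightarrow>
     (\<exists>b. finite b \<and> zmod.independent b \<and> zmod.span b = \<Gamma>)"

definition direct_summands :: "'a::ab_group_add set \<Rightarrow> 'a set \<Rightarrow> 'a set \<Rightarrow> bool" where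
  "direct_summands \<Gamma> A B \<longleftrightarrow> zmod.subspace A \<and> zmod.subspace B \<and> A \<inter> B = {0} \<and>
     \<Gamma> = {x + y | x y. x \<in> A \<and> y \<in> B}"


section \<open>Abelian Lie groups\<close>

text \<open>Only meant for open \<open>S\<close>.\<close>

primrec Ck_on :: "nat \<Rightarrow> 'a::euclidean_space set \<Rightarrow> ('a \<Rightarrow> 'b::euclidean_space) \<Rightarrow> bool" where
  "Ck_on 0 S f \<longleftrightarrow> continuous_on S f"
| "Ck_on (Suc k) S f \<longleftrightarrow> (\<forall>x\<in>S. f differentiable (at x)) \<and>
     (\<forall>v. Ck_on k S (\<lambda>x. frechet_derivative f (at x) v))"

definition smooth_on :: "'a::euclidean_space set \<Rightarrow> ('a \<Rightarrow> 'b::euclidean_space) \<Rightarrow> bool" where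
  "smooth_on S f \<longleftrightarrow> (\<forall>k. Ck_on k S f)"

definition chart :: "'g::topological_space set \<times> ('g \<Rightarrow> 'e::euclidean_space) \<Rightarrow> bool" where
  "chart = (\<lambda>(U, \<phi>). open U \<and> open (\<phi> ` U) \<and> homeomorphism U (\<phi> ` U) \<phi> (inv_into U \<phi>))"

definition smooth_atlas :: "('g::topological_space set \<times> ('g \<Rightarrow> 'e::euclidean_space)) set \<Rightarrow> bool" where
  "smooth_atlas \<U> \<longleftrightarrow> (\<forall>c\<in>\<U>. chart c) \<and> (\<Union>(U, \<phi>)\<in>\<U>. U) = UNIV \<and>
     (\<forall>(U, \<phi>)\<in>\<U>. \<forall>(V, \<psi>)\<in>\<U>. smooth_on (\<phi> ` (U \<inter> V)) (\<psi> \<circ> inv_into U \<phi>))"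

text \<open>A Lie group structure on a topological abelian group, modelled on \<open>'e\<close>, whose dimension
  is the dimension of the group.\<close>

definition abelian_lie_group ::
  "('g::{topological_ab_group_add, t2_space, second_countable_topology} set
     \<times> ('g \<Rightarrow> 'e::euclidean_space)) set \<Rightarrow> bool" where
  "abelian_lie_group \<U> \<longleftrightarrow> smooth_atlas \<U> \<and>
     (\<forall>(U, \<phi>)\<in>\<U>. \<forall>(V, \<psi>)\<in>\<U>. \<forall>(W, \<xi>)\<in>\<U>.
        smooth_on {(\<phi> g, \<psi> h) | g h. g \<in> U \<and> h \<in> V \<and> g + h \<in> W}
          (\<lambda>(x, y). \<xi> (inv_into U \<phi> x + inv_into V \<psi> y))) \<and>
     (\<forall>(U, \<phi>)\<in>\<U>. \<forall>(V, \<psi>)\<in>\<U>.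
        smooth_on {\<phi> g | g. g \<in> U \<and> - g \<in> V} (\<lambda>x. \<psi> (- inv_into U \<phi> x)))"


section \<open>Posets\<close>

record 's poset =
  elts :: "'s set"
  le :: "'s \<Rightarrow> 's \<Rightarrow> bool"

definition is_poset :: "('s, 'z) poset_scheme \<Rightarrow> bool" where
  "is_poset P \<longleftrightarrow> partial_order_on (elts P) {(x, y). x \<in> elts P \<and> y \<in> elts P \<and> le P x y}"

definition poset_iso :: "('s, 'y) poset_scheme \<Rightarrow> ('t, 'z) poset_scheme \<Rightarrow> ('s \<Rightarrow> 't) \<Rightarrow> bool" where
  "poset_iso P Q f \<longleftrightarrow> bij_betw f (elts P) (elts Q) \<and>
     (\<forall>x\<in>elts P. \<forall>y\<in>elts P. le P x y \<longleftrightarrow> le Q (f x) (f y))"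

definition least_elt :: "('s, 'z) poset_scheme \<Rightarrow> 's \<Rightarrow> bool" where
  "least_elt P z \<longleftrightarrow> z \<in> elts P \<and> (\<forall>x\<in>elts P. le P z x)"

definition covers :: "('s, 'z) poset_scheme \<Rightarrow> 's \<Rightarrow> 's \<Rightarrow> bool" where
  "covers P x y \<longleftrightarrow> x \<in> elts P \<and> y \<in> elts P \<and> le P x y \<and> x \<noteq> y \<and>
     (\<forall>z\<in>elts P. le P x z \<and> le P z y \<longrightarrow> z = x \<or> z = y)"

definition atom :: "('s, 'z) poset_scheme \<Rightarrow> 's \<Rightarrow> bool" where
  "atom P a \<longleftrightarrow> (\<exists>z. least_elt P z \<and> covers P z a)"

definition lower :: "('s, 'z) poset_scheme \<Rightarrow> 's \<Rightarrow> ('s, 'z) poset_scheme" where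
  "lower P x = P\<lparr>elts := {y \<in> elts P. le P y x}\<rparr>"

text \<open>The length of a longest chain below \<open>x\<close>; this is the rank of \<open>x\<close> if \<open>P\<close> is ranked.\<close>

definition rank_of :: "('s, 'z) poset_scheme \<Rightarrow> 's \<Rightarrow> nat" where
  "rank_of P x =
     Max (card ` {C. C \<subseteq> elts (lower P x) \<and> Complete_Partial_Order.chain (le P) C}) - 1"

definition ranked :: "('s, 'z) poset_scheme \<Rightarrow> bool" where
  "ranked P \<longleftrightarrow> (\<forall>x y. covers P x y \<longrightarrow> rank_of P y = rank_of P x + 1)"

definition joins :: "('s, 'z) poset_scheme \<Rightarrow> 's set \<Rightarrow> 's set" where
  "joins P T = {u \<in> elts P. (\<forall>t\<in>T. le P t u) \<and>
     (\<forall>v\<in>elts P. (\<forall>t\<in>T. le P t v) \<and> le P v u \<longrightarrow> v = u)}"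

definition meets :: "('s, 'z) poset_scheme \<Rightarrow> 's set \<Rightarrow> 's set" where
  "meets P T = {l \<in> elts P. (\<forall>t\<in>T. le P l t) \<and>
     (\<forall>v\<in>elts P. (\<forall>t\<in>T. le P v t) \<and> le P l v \<longrightarrow> v = l)}"

definition boolean_lattice :: "'a set \<Rightarrow> 'a set poset" where
  "boolean_lattice A = \<lparr>elts = Pow A, le = (\<subseteq>)\<rparr>"

definition finite_simplicial_poset :: "('s, 'z) poset_scheme \<Rightarrow> bool" where
  "finite_simplicial_poset S \<longleftrightarrow> is_poset S \<and> finite (elts S) \<and> (\<exists>!z. least_elt S z) \<and> ranked S \<and>
     (\<forall>x\<in>elts S. \<exists>f. poset_iso (lower S x) (boolean_lattice {a. atom S a \<and> le S a x}) f)"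


section \<open>Matroid schemes\<close>

record 's mscheme = "'s poset" +
  rho :: "'s \<Rightarrow> nat"

text \<open>In the third axiom \<open>meets M {x, y}\<close> is a singleton: all lower bounds of \<open>x\<close> and \<open>y\<close> lie in
  the Boolean lattice below \<open>u\<close>.\<close>

definition matroid_scheme :: "'s mscheme \<Rightarrow> bool" where
  "matroid_scheme M \<longleftrightarrow> finite_simplicial_poset M \<and>
     (\<forall>x\<in>elts M. rho M x \<le> rank_of M x) \<and>
     (\<forall>x\<in>elts M. \<forall>y\<in>elts M. le M x y \<longrightarrow> rho M x \<le> rho M y) \<and>
     (\<forall>x\<in>elts M. \<forall>y\<in>elts M. \<forall>u\<in>joins M {x, y}. \<forall>l\<in>meets M {x, y}.
        rho M x + rho M y \<ge> rho M u + rho M l) \<and>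
     (\<forall>x\<in>elts M. \<forall>y\<in>elts M. \<forall>l\<in>meets M {x, y}.
        rho M x = rho M l \<longrightarrow> joins M {x, y} \<noteq> {}) \<and>
     (\<forall>x\<in>elts M. \<forall>y\<in>elts M. rho M x < rho M y \<longrightarrow>
        (\<exists>a. atom M a \<and> le M a y \<and> \<not> le M a x \<and> joins M {x, a} \<noteq> {}))"

definition mscheme_isomorphic :: "'s mscheme \<Rightarrow> 't mscheme \<Rightarrow> bool"  (infix \<open>\<cong>\<^sub>M\<close> 50) where
  "M \<cong>\<^sub>M N \<longleftrightarrow> (\<exists>f. poset_iso M N f \<and> (\<forall>x\<in>elts M. rho N (f x) = rho M x))"

definition cl :: "'s mscheme \<Rightarrow> 's \<Rightarrow> 's" where
  "cl M x = (THE y. y \<in> elts M \<and> le M x y \<and> rho M y = rho M x \<and>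
     (\<forall>z\<in>elts M. le M x z \<and> rho M z = rho M x \<and> le M y z \<longrightarrow> z = y))"

definition flats :: "'s mscheme \<Rightarrow> 's poset" where
  "flats M = \<lparr>elts = {x \<in> elts M. cl M x = x}, le = le M\<rparr>"

definition mdeletion :: "'s mscheme \<Rightarrow> 's \<Rightarrow> 's mscheme" where
  "mdeletion M a = M\<lparr>elts := {x \<in> elts M. \<not> le M a x}\<rparr>"

definition mcontraction :: "'s mscheme \<Rightarrow> 's \<Rightarrow> 's mscheme" where
  "mcontraction M x = M\<lparr>elts := {y \<in> elts M. le M x y}, rho := (\<lambda>y. rho M y - rho M x)\<rparr>"

definition mlocalization :: "'s mscheme \<Rightarrow> 's \<Rightarrow> 's mscheme" where
  "mlocalization M x = lower M x"


section \<open>Abelian arrangements\<close>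

text \<open>Homomorphisms are \<^const>\<open>undefined\<close> outside \<open>\<Gamma>\<close>, so that they are determined by their
  restriction to \<open>\<Gamma>\<close>. The topology is the subspace topology of the product topology on
  functions.\<close>

definition Hom :: "'a::ab_group_add set \<Rightarrow> ('a \<Rightarrow> 'g::ab_group_add) set" where
  "Hom \<Gamma> = {\<phi> \<in> extensional \<Gamma>. \<forall>x\<in>\<Gamma>. \<forall>y\<in>\<Gamma>. \<phi> (x + y) = \<phi> x + \<phi> y}"

definition hyp :: "'a::ab_group_add set \<Rightarrow> 'a \<times> 'g::ab_group_add \<Rightarrow> ('a \<Rightarrow> 'g) set" where
  "hyp \<Gamma> = (\<lambda>(\<alpha>, t). {\<phi> \<in> Hom \<Gamma>. \<phi> \<alpha> = t})"

text \<open>Collections of subsets are indexed families: distinct members \<open>H\<close>, \<open>H'\<close> of an arrangement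
  may meet \<open>H\<^sub>0\<close> in the same subset, and the restriction to \<open>H\<^sub>0\<close> has to keep both copies, as in
  the contraction of a matroid (three concurrent lines in the plane). An arrangement that is a
  set \<open>\<A>\<close> of subsets is the case of index set \<open>\<A>\<close> and \<open>mem\<close> the identity.\<close>

record ('i, 'p) arrangement =
  space :: "'p set"
  idx :: "'i set"
  mem :: "'i \<Rightarrow> 'p set"

text \<open>The library regards the empty set as connected, hence the nonemptiness condition.\<close>

definition abelian_arrangement ::
  "'a::ab_group_add set \<Rightarrow> ('i \<Rightarrow> 'a \<times> 'g::topological_ab_group_add)
     \<Rightarrow> ('i, 'a \<Rightarrow> 'g) arrangement \<Rightarrow> bool" where
  "abelian_arrangement \<Gamma> \<X> \<A> \<longleftrightarrow>
     free_abelian_finite_rank \<Gamma> \<and> space \<A> = Hom \<Gamma> \<and> finite (idx \<A>) \<and>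
     (\<forall>i\<in>idx \<A>. fst (\<X> i) \<in> \<Gamma> \<and> mem \<A> i = hyp \<Gamma> (\<X> i) \<and>
        connected (mem \<A> i) \<and> mem \<A> i \<noteq> {})"

definition intersection :: "('i, 'p) arrangement \<Rightarrow> 'i set \<Rightarrow> 'p set" where
  "intersection \<A> B = space \<A> \<inter> (\<Inter>i\<in>B. mem \<A> i)"

definition layers :: "('i, 'p::topological_space) arrangement \<Rightarrow> 'p set poset" where
  "layers \<A> = \<lparr>elts = (\<Union>B\<in>Pow (idx \<A>). components (intersection \<A> B)), le = (\<supseteq>)\<rparr>"

text \<open>The matroid scheme of an arrangement: its elements are the components of intersections
  together with the subcollection that is intersected.\<close>

definition arr_scheme ::
  "('i, 'p::topological_space) arrangement \<Rightarrow> ('i set \<times> 'p set) mscheme" where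
  "arr_scheme \<A> = \<lparr>
     elts = {(B, X). B \<subseteq> idx \<A> \<and> X \<in> components (intersection \<A> B)},
     le = (\<lambda>(B, X) (C, Y). B \<subseteq> C \<and> Y \<subseteq> X),
     rho = (\<lambda>(B, X). rank_of (layers \<A>) X)\<rparr>"

definition layer_flat :: "('i, 'p) arrangement \<Rightarrow> 'p set \<Rightarrow> 'i set \<times> 'p set" where
  "layer_flat \<A> X = ({i \<in> idx \<A>. X \<subseteq> mem \<A> i}, X)"

text \<open>If the members of \<open>\<A>\<close> are pairwise distinct and proper, this is the flat of the layer
  \<open>mem \<A> i\<close>. In general it is still the atom belonging to the index \<open>i\<close>.\<close>

definition arr_atom :: "('i, 'p) arrangement \<Rightarrow> 'i \<Rightarrow> 'i set \<times> 'p set" where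
  "arr_atom \<A> i = ({i}, mem \<A> i)"

definition arr_deletion :: "('i, 'p) arrangement \<Rightarrow> 'i \<Rightarrow> ('i, 'p) arrangement" where
  "arr_deletion \<A> i = \<A>\<lparr>idx := idx \<A> - {i}\<rparr>"

text \<open>The restriction to \<open>H\<^sub>0 = mem \<A> i\<^sub>0\<close>. Here \<open>\<Gamma>'\<close> is a complement of \<open>\<int>\<alpha>\<close> for some \<open>\<alpha>\<close> with
  \<open>H\<^sub>0 = hyp \<Gamma> (\<alpha>, t)\<close>, and \<open>H\<^sub>0\<close> is identified with \<open>Hom \<Gamma>'\<close> by restricting homomorphisms to
  \<open>\<Gamma>'\<close>. Since elements of \<^const>\<open>components\<close> are nonempty, an \<open>H\<close> disjoint from \<open>H\<^sub>0\<close> does not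
  contribute.\<close>

definition arr_restriction ::
  "'a set \<Rightarrow> ('i, 'a \<Rightarrow> 'g::topological_space) arrangement \<Rightarrow> 'i
     \<Rightarrow> ('i \<times> ('a \<Rightarrow> 'g) set, 'a \<Rightarrow> 'g) arrangement" where
  "arr_restriction \<Gamma>' \<A> i\<^sub>0 = \<lparr>
     space = (\<lambda>\<phi>. restrict \<phi> \<Gamma>') ` mem \<A> i\<^sub>0,
     idx = {(i, C). i \<in> idx \<A> - {i\<^sub>0} \<and> C \<in> components (mem \<A> i\<^sub>0 \<inter> mem \<A> i)},
     mem = (\<lambda>(i, C). (\<lambda>\<phi>. restrict \<phi> \<Gamma>') ` C)\<rparr>"

definition arr_localization ::
  "'a::ab_group_add set \<Rightarrow> ('i \<Rightarrow> 'a \<times> 'g) \<Rightarrow> ('i, 'a \<Rightarrow> 'g) arrangement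
     \<Rightarrow> ('a \<Rightarrow> 'g) set \<Rightarrow> ('i, 'a \<Rightarrow> 'e::euclidean_space) arrangement" where
  "arr_localization \<Gamma> \<X> \<A> X = \<lparr>
     space = Hom \<Gamma>,
     idx = {i \<in> idx \<A>. X \<subseteq> mem \<A> i},
     mem = (\<lambda>i. hyp \<Gamma> (fst (\<X> i), 0))\<rparr>"

end

theory Submission
  imports Defs
begin

text \<open>The intersection of a subarrangement is a coset of the homomorphisms that vanish on the span of
  its directions, and its components are the cosets of those that vanish on the saturation of
  that span; so up to a choice of component a layer is a flat of the matroid of directions.
  This needs only that the group is connected and divisible with finite torsion subgroups, which
  is proved without the classification of connected abelian Lie groups: in a chart \<open>k\<close>-fold
  multiplication is \<open>k x\<close> to first order, so a small ball lies in its own \<open>k\<close>-fold multiple, and a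
  growth argument bounds the torsion. All remaining claims depend only on the rank function and
  the topology of the arrangement.\<close>

section \<open>Pure subgroups of free abelian groups\<close>

text \<open>For homomorphism groups, each property of the target has its own job. Connectedness
  makes the homomorphisms prolonging a given one from a pure subgroup a connected set. Divisibility
  lets such a prolongation take any value at an element outside the subgroup, so a component meets
  every member that raises the rank. Finite torsion keeps a component constant on the saturation and
  leaves finitely many components. The obstacle is \<open>rho\<close>: it is the length of a longest
  chain of layers, and deletion, restriction and localization all alter the set of layers. The
  remedy is a formula for it by the index set alone, the rank of the directions, which sees neither
  offsets nor the target group. Deletion then keeps it, restriction subtracts the rank of the
  distinguished member, and localization keeps it although the group becomes a Euclidean space.
  Pairing a component with an index set makes lower intervals Boolean: for every subset of the
  indices exactly one component contains the given one.\<close>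

definition adjoin :: "'a::ab_group_add \<Rightarrow> 'a set \<Rightarrow> 'a set" where
  "adjoin e T = {y + zmult m e | y m. y \<in> T}"

lemma adjoinI: "y \<in> T \<Longrightarrow> y + zmult m e \<in> adjoin e T"
  by (auto simp: adjoin_def)

lemma adjoinI': "y \<in> T \<Longrightarrow> x = y + zmult m e \<Longrightarrow> x \<in> adjoin e T"
  by (auto simp: adjoin_def)

lemma adjoinE:
  assumes "x \<in> adjoin e T"
  obtains y m where "y \<in> T" "x = y + zmult m e"
  using assms by (auto simp: adjoin_def)

lemma adjoin_iff: "x \<in> adjoin e T \<longleftrightarrow> (\<exists>m. x - zmult m e \<in> T)"
  unfolding adjoin_def by auto (metis add_diff_cancel_right', metis diff_add_cancel)

lemma subspace_adjoin:
  assumes "zmod.subspace T"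
  shows "zmod.subspace (adjoin e T)"
proof (rule zmod.subspaceI)
  show "0 \<in> adjoin e T"
    using adjoinI[of 0 T 0 e] zmod.subspace_0[OF assms] by simp
next
  fix x y assume "x \<in> adjoin e T" "y \<in> adjoin e T"
  then obtain a m b n where "a \<in> T" "x = a + zmult m e" "b \<in> T" "y = b + zmult n e"
    by (metis adjoinE)
  then show "x + y \<in> adjoin e T"
    using adjoinI[OF zmod.subspace_add[OF assms, of a b], of "m + n" e]
    by (simp add: zmod.scale_left_distrib algebra_simps)
next
  fix c x assume "x \<in> adjoin e T"
  then obtain a m where "a \<in> T" "x = a + zmult m e"
    by (metis adjoinE)
  then show "zmult c x \<in> adjoin e T"
    using adjoinI[OF zmod.subspace_scale[OF assms, of a c], of "c * m" e]
    by (simp add: zmod.scale_right_distrib)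
qed

lemma adjoin_superset: "T \<subseteq> adjoin e T"
  using adjoinI[of _ T 0 e] by auto

lemma adjoin_self: "zmod.subspace T \<Longrightarrow> e \<in> adjoin e T"
  using adjoinI[of 0 T 1 e] zmod.subspace_0[of T] by simp

lemma adjoin_minimal: "zmod.subspace W \<Longrightarrow> T \<subseteq> W \<Longrightarrow> e \<in> W \<Longrightarrow> adjoin e T \<subseteq> W"
  by (auto elim!: adjoinE intro!: zmod.subspace_add zmod.subspace_scale)

lemma adjoin_span: "adjoin e (zmod.span B) = zmod.span (insert e B)"
  by (auto simp: adjoin_iff zmod.span_insert)

lemma adjoin_commute: "adjoin e (adjoin f T) = adjoin f (adjoin e T)"
proof -
  have "adjoin e (adjoin f T) \<subseteq> adjoin f (adjoin e T)" for e f :: 'a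
  proof
    fix x assume "x \<in> adjoin e (adjoin f T)"
    then obtain y m n where "y \<in> T" "x = y + zmult n f + zmult m e"
      by (auto elim!: adjoinE)
    then show "x \<in> adjoin f (adjoin e T)"
      by (intro adjoinI'[OF adjoinI[of y T m e], of _ n f]) (auto simp: algebra_simps)
  qed
  then show ?thesis by blast
qed

text \<open>A tower of split extensions by infinite cyclic groups: if \<open>free_ext S T\<close> then \<open>T\<close> is the
  direct sum of \<open>S\<close> and a free abelian group of finite rank, so that statements about such \<open>T\<close>
  can be proved by induction without choosing bases.\<close>

inductive free_ext :: "'a::ab_group_add set \<Rightarrow> 'a set \<Rightarrow> bool" for S where
  base: "zmod.subspace S \<Longrightarrow> free_ext S S"
| step: "free_ext S T \<Longrightarrow> (\<And>k. zmult k e \<in> T \<Longrightarrow> k = 0) \<Longrightarrow> free_ext S (adjoin e T)"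

lemma free_ext_subspace:
  assumes "free_ext S T"
  shows "zmod.subspace S" "zmod.subspace T" "S \<subseteq> T"
  using assms by (induction) (auto intro: subspace_adjoin dest: subsetD[OF adjoin_superset])

lemma free_ext_trans: "free_ext T W \<Longrightarrow> free_ext S T \<Longrightarrow> free_ext S W"
  by (induction rule: free_ext.induct) (auto intro: free_ext.intros)

text \<open>Purity of \<open>S\<close> in \<open>T\<close>. Descending the tower, the coefficient
  \<open>m\<close> of \<open>x\<close> along the last generator satisfies \<open>k * m = 0\<close>
  by independence, so \<open>x\<close> already lies one stage lower.\<close>

lemma free_ext_pure:
  assumes "free_ext S T" "x \<in> T" "zmult k x \<in> S" "k \<noteq> 0"
  shows "x \<in> S"
  using assms
proof (induction)
  case base
  then show ?case by simp
next
  case (step T e)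
  then obtain y m where y: "y \<in> T" "x = y + zmult m e"
    by (auto elim!: adjoinE)
  have "zmult k x \<in> T"
    using step.prems free_ext_subspace[OF step.hyps(1)] by blast
  then have "zmult k x - zmult k y \<in> T"
    using y free_ext_subspace(2)[OF step.hyps(1)]
    by (meson zmod.subspace_diff zmod.subspace_scale)
  then have "zmult (k * m) e \<in> T"
    by (simp add: y zmod.scale_right_distrib)
  then have "k * m = 0"
    by (rule step.hyps)
  then have "m = 0"
    using step.prems by simp
  then have "x = y" using y by simp
  then show ?case using step y by simp
qed

text \<open>Serves to move a generator from the top of a tower to its bottom. In a relation between
  \<open>f\<close> and \<open>e\<close> over \<open>T\<close>, first the coefficient of
  \<open>e\<close> vanishes, because \<open>e\<close> is independent of the whole tower, and then
  that of \<open>f\<close>.\<close>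

lemma free_ext_adjoin:
  assumes "free_ext S T" "\<And>k. zmult k e \<in> T \<Longrightarrow> k = 0"
  shows "free_ext (adjoin e S) (adjoin e T)"
  using assms
proof (induction)
  case base
  then show ?case by (simp add: free_ext.base subspace_adjoin)
next
  case (step T f)
  have T: "zmod.subspace T" using step.hyps free_ext_subspace by blast
  have e: "k = 0" if "zmult k e \<in> T" for k
    using step.prems that adjoin_superset by blast
  have "free_ext (adjoin e S) (adjoin f (adjoin e T))"
  proof (rule free_ext.step)
    show "free_ext (adjoin e S) (adjoin e T)"
      using step.IH e by blast
  next
    fix k assume "zmult k f \<in> adjoin e T"
    then obtain y m where y: "y \<in> T" "zmult k f = y + zmult m e"
      by (auto elim: adjoinE)
    then have "zmult m e = - y + zmult k f" by simp
    then have "zmult m e \<in> adjoin f T"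
      using y(1) T by (metis adjoinI zmod.subspace_neg)
    then have "m = 0" by (rule step.prems)
    then show "k = 0" using y step.hyps by simp
  qed
  then show ?case by (simp add: adjoin_commute)
qed

text \<open>The last case is the Euclidean algorithm in the plane spanned by \<open>h\<close> and \<open>e\<close>.\<close>

lemma free_ext_primitive:
  assumes "free_ext S T" "\<beta> \<in> T" "\<beta> \<notin> S"
  shows "\<exists>h d. \<beta> - zmult d h \<in> S \<and> (\<forall>k. zmult k h \<in> S \<longrightarrow> k = 0) \<and> free_ext (adjoin h S) T"
  using assms
proof (induction arbitrary: \<beta>)
  case base
  then show ?case by simp
next
  case (step T e)
  note sub = free_ext_subspace[OF step.hyps(1)]
  obtain b c where b: "b \<in> T" "\<beta> = b + zmult c e"
    using step.prems by (auto elim: adjoinE)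
  show ?case
  proof (cases "b \<in> S")
    case True
    show ?thesis
    proof (intro exI conjI allI impI)
      show "\<beta> - zmult c e \<in> S" using b True by simp
      show "k = 0" if "zmult k e \<in> S" for k using that step.hyps sub by blast
      show "free_ext (adjoin e S) (adjoin e T)"
        using free_ext_adjoin step.hyps by blast
    qed
  next
    case False
    then obtain h d where h: "b - zmult d h \<in> S" "\<And>k. zmult k h \<in> S \<Longrightarrow> k = 0"
      "free_ext (adjoin h S) T"
      using step.IH[OF b(1) False] by auto
    have hT: "h \<in> T"
      using free_ext_subspace(3)[OF h(3)] adjoin_self[OF sub(1)] by blast
    have d: "d \<noteq> 0"
      using h(1) False by auto
    define g where "g = gcd d c"
    have "g \<noteq> 0" using d by (simp add: g_def)
    obtain d' c' where dc: "d = g * d'" "c = g * c'"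
      unfolding g_def by (metis dvd_def gcd_dvd1 gcd_dvd2)
    obtain u v where "u * d + v * c = g"
      unfolding g_def using bezout_int by blast
    then have "g * (u * d' + v * c') = g * 1"
      by (simp add: dc algebra_simps)
    then have uv: "u * d' + v * c' = 1"
      using \<open>g \<noteq> 0\<close> by (metis mult_left_cancel)
    \<comment> \<open>The matrix with rows (d', c') and (-v, u) has determinant
      \<open>u * d' + v * c' = 1\<close>, so \<open>h1\<close>, \<open>h2\<close> generate the same
      group over \<open>S\<close> as \<open>h\<close>, \<open>e\<close>, while \<beta> becomes
      \<open>g\<close> times \<open>h1\<close> modulo \<open>S\<close>.\<close>
    define h1 where "h1 = zmult d' h + zmult c' e"
    define h2 where "h2 = zmult u e - zmult v h"
    have indep: "m = 0 \<and> n = 0" if "zmult m h + zmult n e \<in> S" for m n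
    proof -
      have "zmult m h + zmult n e - zmult m h \<in> T"
        using that sub hT by (meson subsetD zmod.subspace_diff zmod.subspace_scale)
      then have "zmult n e \<in> T" by simp
      then have n: "n = 0" by (rule step.hyps)
      then have "zmult m h \<in> S" using that by simp
      with n h(2) show ?thesis by blast
    qed
    have h1: "k = 0" if k1: "zmult k h1 \<in> S" for k
    proof -
      have "zmult (k * d') h + zmult (k * c') e \<in> S"
        using k1 by (simp add: h1_def zmod.scale_right_distrib)
      then have "k * d' = 0 \<and> k * c' = 0" by (rule indep)
      moreover have "k = k * d' * u + k * c' * v"
        using uv by (metis distrib_left mult.assoc mult.commute mult.right_neutral)
      ultimately show ?thesis by (metis add_0 mult_zero_left)
    qed
    have h2: "k = 0" if k2: "zmult k h2 \<in> adjoin h1 S" for k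
    proof -
      obtain s m where s: "s \<in> S" "zmult k h2 = s + zmult m h1"
        using k2 by (auto elim: adjoinE)
      then have "s = zmult k h2 - zmult m h1" by simp
      also have "\<dots> = zmult (- (k * v) - m * d') h + zmult (k * u - m * c') e"
        by (simp add: h1_def h2_def zmod.scale_right_distrib zmod.scale_right_diff_distrib
            zmod.scale_left_diff_distrib)
      finally have "s = zmult (- (k * v) - m * d') h + zmult (k * u - m * c') e" .
      then have "- (k * v) - m * d' = 0 \<and> k * u - m * c' = 0"
        using s(1) indep by metis
      then have "k * v = - (m * d')" "k * u = m * c'" by auto
      moreover have "k = k * u * d' + k * v * c'"
        using uv by (metis distrib_left mult.assoc mult.right_neutral)
      ultimately show ?thesis by (simp add: algebra_simps)
    qed
    have "adjoin h2 (adjoin h1 S) = adjoin e (adjoin h S)"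
    proof (rule equalityI; rule adjoin_minimal; (rule adjoin_minimal)?)
      have sp: "zmod.subspace (adjoin e (adjoin h S))" "zmod.subspace (adjoin h2 (adjoin h1 S))"
        using sub by (simp_all add: subspace_adjoin)
      then show "zmod.subspace (adjoin e (adjoin h S))" "zmod.subspace (adjoin e (adjoin h S))"
        "zmod.subspace (adjoin h2 (adjoin h1 S))" "zmod.subspace (adjoin h2 (adjoin h1 S))"
        by auto
      show "S \<subseteq> adjoin e (adjoin h S)" "S \<subseteq> adjoin h2 (adjoin h1 S)"
        using adjoin_superset by blast+
      have he: "h \<in> adjoin e (adjoin h S)" "e \<in> adjoin e (adjoin h S)"
        using adjoin_self[OF sub(1)] adjoin_self[OF subspace_adjoin[OF sub(1)]] adjoin_superset
        by blast+
      then show "h1 \<in> adjoin e (adjoin h S)" "h2 \<in> adjoin e (adjoin h S)"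
        unfolding h1_def h2_def
        by (meson sp zmod.subspace_add zmod.subspace_diff zmod.subspace_scale)+
      have h12: "h1 \<in> adjoin h2 (adjoin h1 S)" "h2 \<in> adjoin h2 (adjoin h1 S)"
        using adjoin_self[OF sub(1)] adjoin_self[OF subspace_adjoin[OF sub(1)]] adjoin_superset
        by blast+
      have "zmult u h1 - zmult c' h2 = zmult (u * d' + v * c') h"
        "zmult v h1 + zmult d' h2 = zmult (u * d' + v * c') e"
        by (simp_all only: h1_def h2_def zmod.scale_right_distrib zmod.scale_right_diff_distrib
            zmod.scale_left_distrib zmod.scale_scale) (simp_all add: algebra_simps)
      then have "h = zmult u h1 - zmult c' h2" "e = zmult v h1 + zmult d' h2"
        by (simp_all add: uv)
      then show "h \<in> adjoin h2 (adjoin h1 S)" "e \<in> adjoin h2 (adjoin h1 S)"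
        using h12 by (metis sp(2) zmod.subspace_add zmod.subspace_diff zmod.subspace_scale)+
    qed
    moreover have "free_ext (adjoin h1 S) (adjoin h2 (adjoin h1 S))"
      using sub h2 by (intro free_ext.step free_ext.base subspace_adjoin)
    moreover have "free_ext (adjoin e (adjoin h S)) (adjoin e T)"
      using free_ext_adjoin[OF h(3)] step.hyps by blast
    ultimately have "free_ext (adjoin h1 S) (adjoin e T)"
      using free_ext_trans by metis
    moreover have "\<beta> - zmult g h1 \<in> S"
      using h(1) by (simp add: b h1_def dc zmod.scale_right_distrib)
    ultimately show ?thesis using h1 by blast
  qed
qed

text \<open>The generators of the tower, adjoined to the trivial group instead of to
  \<open>S\<close>, build the complement; independence at each stage keeps the sum direct.\<close>

lemma free_ext_complement:
  assumes "free_ext S T"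
  shows "\<exists>R. direct_summands T S R"
  using assms
proof (induction)
  case base
  then show ?case
    by (intro exI[of _ "{0}"]) (auto simp: direct_summands_def zmod.subspace_0)
next
  case (step T e)
  then obtain R where R: "zmod.subspace S" "zmod.subspace R" "S \<inter> R = {0}"
    "T = {x + y | x y. x \<in> S \<and> y \<in> R}"
    by (auto simp: direct_summands_def)
  have T: "zmod.subspace T" using step.hyps free_ext_subspace by blast
  have "S \<inter> adjoin e R = {0}"
  proof -
    have "x = 0" if "x \<in> S" and xe: "x \<in> adjoin e R" for x
    proof -
      obtain y m where y: "y \<in> R" "x = y + zmult m e"
        using xe by (auto elim: adjoinE)
      then have "zmult m e = x + (- y)" by simp
      moreover have "- y \<in> R" using y R zmod.subspace_neg by blast
      ultimately have "zmult m e \<in> T" using that R(4) by blast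
      then have "m = 0" by (rule step.hyps)
      then show ?thesis using y that R(3) by auto
    qed
    then show ?thesis
      using R zmod.subspace_0 subspace_adjoin by blast
  qed
  moreover have "adjoin e T = {x + y | x y. x \<in> S \<and> y \<in> adjoin e R}"
  proof (intro equalityI subsetI)
    fix z assume "z \<in> adjoin e T"
    then obtain x y m where "x \<in> S" "y \<in> R" "z = x + y + zmult m e"
      unfolding adjoin_def R(4) by blast
    then show "z \<in> {x + y | x y. x \<in> S \<and> y \<in> adjoin e R}"
      using adjoinI[of y R m e] by (auto simp: add.assoc)
  next
    fix z assume "z \<in> {x + y | x y. x \<in> S \<and> y \<in> adjoin e R}"
    then obtain x y m where "x \<in> S" "y \<in> R" "z = x + y + zmult m e"
      by (auto elim!: adjoinE simp: add.assoc)
    then show "z \<in> adjoin e T"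
      using R(4) by (auto intro!: adjoinI)
  qed
  ultimately show ?case
    using R subspace_adjoin unfolding direct_summands_def by blast
qed

text \<open>The bridge from bases to towers: a basis is adjoined one element at a time, and
  conversely a generator independent of the span of a basis enlarges that basis.\<close>

lemma free_abelian_iff: "free_abelian_finite_rank \<Gamma> \<longleftrightarrow> free_ext {0} \<Gamma>"
proof
  assume "free_abelian_finite_rank \<Gamma>"
  then obtain b where "finite b" "zmod.independent b" "zmod.span b = \<Gamma>"
    by (auto simp: free_abelian_finite_rank_def)
  then show "free_ext {0} \<Gamma>"
  proof (induction b arbitrary: \<Gamma> rule: finite_induct)
    case empty
    then show ?case by (auto intro: free_ext.base)
  next
    case (insert e b)
    have ind: "zmod.independent b"
      using insert.prems zmod.independent_mono by blast
    have "k = 0" if ke: "zmult k e \<in> zmod.span b" for k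
    proof (rule ccontr)
      assume "k \<noteq> 0"
      obtain u where u: "zmult k e = (\<Sum>v\<in>b. zmult (u v) v)"
        using ke insert.hyps by (auto simp: zmod.span_finite)
      define w where "w = (\<lambda>v. if v = e then - k else u v)"
      have "(\<Sum>v\<in>b. zmult (w v) v) = (\<Sum>v\<in>b. zmult (u v) v)"
        using insert.hyps by (intro sum.cong) (auto simp: w_def)
      then have "(\<Sum>v\<in>insert e b. zmult (w v) v) = 0"
        using insert.hyps u by (simp add: w_def)
      moreover have "w e \<noteq> 0" using \<open>k \<noteq> 0\<close> by (simp add: w_def)
      ultimately show False
        using insert.prems insert.hyps zmod.dependent_finite[of "insert e b"] by blast
    qed
    then have "free_ext {0} (adjoin e (zmod.span b))"
      using insert.IH[OF ind refl] by (intro free_ext.step) auto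
    then show ?case using insert.prems by (simp add: adjoin_span)
  qed
next
  assume "free_ext {0} \<Gamma>"
  then show "free_abelian_finite_rank \<Gamma>"
  proof (induction)
    case base
    show ?case unfolding free_abelian_finite_rank_def
      by (rule exI[of _ "{}"]) (auto simp: zmod.independent_empty)
  next
    case (step T e)
    then obtain b where b: "finite b" "zmod.independent b" "zmod.span b = T"
      by (auto simp: free_abelian_finite_rank_def)
    have "e \<notin> b"
    proof
      assume "e \<in> b"
      then have "zmult 1 e \<in> T" using b zmod.span_base by auto
      then show False using step.hyps(2)[of 1] by simp
    qed
    have "zmod.independent (insert e b)"
    proof
      assume "zmod.dependent (insert e b)"
      then obtain u v where u: "v \<in> insert e b" "u v \<noteq> 0" "(\<Sum>v\<in>insert e b. zmult (u v) v) = 0"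
        using b zmod.dependent_finite[of "insert e b"] by auto
      have eq: "zmult (u e) e + (\<Sum>v\<in>b. zmult (u v) v) = 0"
        using u(3) b(1) \<open>e \<notin> b\<close> by simp
      then have "zmult (u e) e = - (\<Sum>v\<in>b. zmult (u v) v)"
        by (rule eq_neg_iff_add_eq_0[THEN iffD2])
      moreover have "- (\<Sum>v\<in>b. zmult (u v) v) \<in> T"
        unfolding b(3)[symmetric]
        by (intro zmod.span_neg zmod.span_sum zmod.span_scale zmod.span_base)
      ultimately have "u e = 0" using step.hyps by metis
      then have "v \<in> b" "(\<Sum>v\<in>b. zmult (u v) v) = 0" using eq u by auto
      then show False using u(2) b zmod.dependent_finite[of b] by blast
    qed
    then show ?case
      unfolding free_abelian_finite_rank_def
      using b adjoin_span[of e b] by (intro exI[of _ "insert e b"]) simp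
  qed
qed

text \<open>For torsion-free \<Gamma> this is the trace on \<Gamma> of the rational span of
  \<open>B\<close>. As a closure operator it is the matroid of linear dependence over the rationals,
  expressed with integer multiples only.\<close>

definition sat :: "'a::ab_group_add set \<Rightarrow> 'a set \<Rightarrow> 'a set" where
  "sat \<Gamma> B = {x \<in> \<Gamma>. \<exists>k. k \<noteq> 0 \<and> zmult k x \<in> zmod.span B}"

lemma sat_subset: "sat \<Gamma> B \<subseteq> \<Gamma>"
  by (auto simp: sat_def)

lemma sat_superset: "B \<subseteq> \<Gamma> \<Longrightarrow> B \<subseteq> sat \<Gamma> B"
  unfolding sat_def using zmod.span_base by (auto intro!: exI[of _ 1])

lemma sat_mono: "B \<subseteq> C \<Longrightarrow> sat \<Gamma> B \<subseteq> sat \<Gamma> C"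
  unfolding sat_def using zmod.span_mono by blast

lemma subspace_sat:
  assumes "zmod.subspace \<Gamma>"
  shows "zmod.subspace (sat \<Gamma> B)"
proof (rule zmod.subspaceI)
  show "0 \<in> sat \<Gamma> B"
    using zmod.subspace_0[OF assms] by (auto simp: sat_def zmod.span_zero intro!: exI[of _ 1])
next
  fix x y assume "x \<in> sat \<Gamma> B" "y \<in> sat \<Gamma> B"
  then obtain k l where kl: "k \<noteq> 0" "zmult k x \<in> zmod.span B" "l \<noteq> 0" "zmult l y \<in> zmod.span B"
    and xy: "x \<in> \<Gamma>" "y \<in> \<Gamma>"
    by (auto simp: sat_def)
  have "zmult (k * l) (x + y) = zmult l (zmult k x) + zmult k (zmult l y)"
    by (simp add: zmod.scale_right_distrib mult.commute)
  also have "\<dots> \<in> zmod.span B"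
    using kl by (simp only: zmod.span_add zmod.span_scale)
  finally show "x + y \<in> sat \<Gamma> B"
    using kl xy zmod.subspace_add[OF assms] unfolding sat_def
    by (auto intro!: exI[of _ "k * l"])
next
  fix c x assume "x \<in> sat \<Gamma> B"
  then obtain k where k: "k \<noteq> 0" "zmult k x \<in> zmod.span B" and x: "x \<in> \<Gamma>"
    by (auto simp: sat_def)
  have "zmult k (zmult c x) = zmult c (zmult k x)"
    by (simp add: mult.commute)
  also have "\<dots> \<in> zmod.span B" using k by (simp only: zmod.span_scale)
  finally show "zmult c x \<in> sat \<Gamma> B"
    using k x zmod.subspace_scale[OF assms] unfolding sat_def by blast
qed

lemma sat_trans:
  assumes "zmod.subspace \<Gamma>" "V \<subseteq> sat \<Gamma> W"
  shows "sat \<Gamma> V \<subseteq> sat \<Gamma> W"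
proof
  fix x assume "x \<in> sat \<Gamma> V"
  then obtain k where k: "k \<noteq> 0" "zmult k x \<in> zmod.span V" and x: "x \<in> \<Gamma>"
    by (auto simp: sat_def)
  have "zmod.span V \<subseteq> sat \<Gamma> W"
    using assms subspace_sat zmod.span_minimal by blast
  then obtain l where "l \<noteq> 0" "zmult l (zmult k x) \<in> zmod.span W"
    using k unfolding sat_def by blast
  then show "x \<in> sat \<Gamma> W"
    using k x unfolding sat_def by (auto intro!: exI[of _ "l * k"])
qed

text \<open>The exchange axiom. In the relation expressing a multiple of \<open>y\<close>, the
  coefficient of \<open>x\<close> cannot vanish, since otherwise \<open>y\<close> would lie in the
  closure of \<open>V\<close>; hence a multiple of \<open>x\<close> can be solved for.\<close>

lemma sat_exchange:
  assumes "x \<in> \<Gamma>" "y \<in> sat \<Gamma> (insert x V)" "y \<notin> sat \<Gamma> V"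
  shows "x \<in> sat \<Gamma> (insert y V)"
proof -
  obtain k where k: "k \<noteq> 0" "zmult k y \<in> zmod.span (insert x V)" and y: "y \<in> \<Gamma>"
    using assms by (auto simp: sat_def)
  then obtain m where m: "zmult k y - zmult m x \<in> zmod.span V"
    by (auto simp: zmod.span_insert)
  have "m \<noteq> 0"
    using m k y assms(3) by (auto simp: sat_def)
  have "- (zmult k y - zmult m x) \<in> zmod.span V"
    using m by (rule zmod.span_neg)
  then have "zmult m x - zmult k y \<in> zmod.span V" by simp
  then have "zmult m x \<in> zmod.span (insert y V)"
    by (auto simp: zmod.span_insert)
  then show ?thesis using \<open>m \<noteq> 0\<close> assms(1) by (auto simp: sat_def)
qed

lemma sat_insert_eq:
  assumes "zmod.subspace \<Gamma>" "B \<subseteq> \<Gamma>" "\<beta> \<in> sat \<Gamma> B"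
  shows "sat \<Gamma> (insert \<beta> B) = sat \<Gamma> B"
  using sat_trans[of \<Gamma> "insert \<beta> B" B] sat_mono[of B "insert \<beta> B"] sat_superset[of B] assms by blast

text \<open>Modulo the old saturation \<beta> is \<open>d\<close> times \<open>h\<close> with
  \<open>d\<close> nonzero, so both have the same rational span. That nothing further is picked up
  is the purity of \<open>adjoin h (sat \<Gamma> B)\<close> in \<Gamma>.\<close>

lemma sat_insert_adjoin:
  assumes "free_ext (adjoin h (sat \<Gamma> B)) \<Gamma>" "B \<subseteq> \<Gamma>" "\<beta> \<in> \<Gamma>" "\<beta> \<notin> sat \<Gamma> B"
    and dh: "\<beta> - zmult d h \<in> sat \<Gamma> B"
  shows "sat \<Gamma> (insert \<beta> B) = adjoin h (sat \<Gamma> B)"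
proof
  note sub = free_ext_subspace[OF assms(1)]
  have sS: "zmod.subspace (sat \<Gamma> B)" using sub subspace_sat by blast
  have "d \<noteq> 0" using dh assms(4) by auto
  have hG: "h \<in> \<Gamma>" using adjoin_self[OF sS] sub by blast
  have sI: "zmod.subspace (sat \<Gamma> (insert \<beta> B))" using sub subspace_sat by blast
  have "\<beta> \<in> sat \<Gamma> (insert \<beta> B)"
    using sat_superset[of "insert \<beta> B" \<Gamma>] assms by blast
  moreover have "\<beta> - zmult d h \<in> sat \<Gamma> (insert \<beta> B)"
    using dh sat_mono[of B "insert \<beta> B"] by blast
  ultimately have "\<beta> - (\<beta> - zmult d h) \<in> sat \<Gamma> (insert \<beta> B)"
    using sI zmod.subspace_diff by blast
  then obtain k where k: "k \<noteq> 0" "zmult k (zmult d h) \<in> zmod.span (insert \<beta> B)"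
    by (auto simp: sat_def)
  then have "h \<in> sat \<Gamma> (insert \<beta> B)"
    using hG \<open>d \<noteq> 0\<close> by (auto simp: sat_def intro!: exI[of _ "k * d"])
  then show "adjoin h (sat \<Gamma> B) \<subseteq> sat \<Gamma> (insert \<beta> B)"
    using sI sat_mono[of B "insert \<beta> B" \<Gamma>] by (intro adjoin_minimal) auto
  have "\<beta> \<in> adjoin h (sat \<Gamma> B)"
    using dh adjoin_iff by blast
  then have "insert \<beta> B \<subseteq> adjoin h (sat \<Gamma> B)"
    using sat_superset[OF assms(2)] adjoin_superset by blast
  then have "zmod.span (insert \<beta> B) \<subseteq> adjoin h (sat \<Gamma> B)"
    using sub(1) zmod.span_minimal by blast
  then show "sat \<Gamma> (insert \<beta> B) \<subseteq> adjoin h (sat \<Gamma> B)"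
    using free_ext_pure[OF assms(1)] unfolding sat_def by blast
qed

lemma sat_empty:
  assumes "free_ext {0} \<Gamma>"
  shows "sat \<Gamma> {} = {0}"
  using free_ext_pure[OF assms] zmod.subspace_0[OF free_ext_subspace(2)[OF assms]]
  by (auto simp: sat_def intro!: exI[of _ 1])

text \<open>Places the saturation as an intermediate stage of a tower from 0 to \<Gamma>. Each
  direction outside the current saturation is replaced by a primitive element \<open>h\<close>,
  which is adjoined below and split off above.\<close>

lemma free_ext_sat:
  assumes "free_ext {0} \<Gamma>" "finite B" "B \<subseteq> \<Gamma>"
  shows "free_ext {0} (sat \<Gamma> B) \<and> free_ext (sat \<Gamma> B) \<Gamma>"
  using assms(2,3)
proof (induction B rule: finite_induct)
  case empty
  then show ?case
    using assms(1) sat_empty[OF assms(1)] free_ext.base[OF zmod.subspace_single_0] by metis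
next
  case (insert \<beta> B)
  show ?case
  proof (cases "\<beta> \<in> sat \<Gamma> B")
    case True
    then have "sat \<Gamma> (insert \<beta> B) = sat \<Gamma> B"
      using sat_insert_eq insert.prems free_ext_subspace(2)[OF assms(1)] by blast
    then show ?thesis using insert by auto
  next
    case False
    then obtain h d where h: "\<beta> - zmult d h \<in> sat \<Gamma> B" "\<And>k. zmult k h \<in> sat \<Gamma> B \<Longrightarrow> k = 0"
      "free_ext (adjoin h (sat \<Gamma> B)) \<Gamma>"
      using free_ext_primitive[of "sat \<Gamma> B" \<Gamma> \<beta>] insert by auto
    then have "sat \<Gamma> (insert \<beta> B) = adjoin h (sat \<Gamma> B)"
      using sat_insert_adjoin[OF h(3) _ _ False h(1)] insert.prems by simp
    moreover have "free_ext {0} (adjoin h (sat \<Gamma> B))"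
      using insert h(2) by (intro free_ext.step) auto
    ultimately show ?thesis using h(3) by simp
  qed
qed

lemma free_ext_finite_span:
  assumes "free_ext {0} \<Gamma>"
  obtains F where "finite F" "\<Gamma> = zmod.span F"
  using assms unfolding free_abelian_iff[symmetric] free_abelian_finite_rank_def by blast

text \<open>Provides primitive directions for members and their traces. The element 0 is a
  legitimate direction, and then \<open>h\<close> is 0 too.\<close>

lemma sat_singleton:
  assumes "free_ext {0} \<Gamma>" "\<beta> \<in> \<Gamma>"
  obtains h where "h \<in> \<Gamma>" "sat \<Gamma> {\<beta>} = zmod.span {h}"
proof (cases "\<beta> = 0")
  case True
  then have "sat \<Gamma> {\<beta>} = zmod.span {0}"
    using sat_insert_eq[of \<Gamma> "{}" 0] sat_empty[OF assms(1)] free_ext_subspace(2)[OF assms(1)]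
    by (auto simp: zmod.span_singleton)
  then show ?thesis
    using that[of 0] zmod.subspace_0[OF free_ext_subspace(2)[OF assms(1)]] by blast
next
  case False
  then obtain h d where h: "\<beta> - zmult d h \<in> {0}" "free_ext (adjoin h {0}) \<Gamma>"
    using free_ext_primitive[OF assms] by auto
  then have "sat \<Gamma> {\<beta>} = adjoin h {0}"
    using sat_insert_adjoin[of h \<Gamma> "{}" \<beta> d] assms False by (auto simp: sat_empty)
  also have "\<dots> = zmod.span {h}"
    using adjoin_span[of h "{}"] by simp
  finally have "sat \<Gamma> {\<beta>} = zmod.span {h}" .
  moreover have "h \<in> \<Gamma>"
    using free_ext_subspace(3)[OF h(2)] adjoin_self[of "{0}" h] by auto
  ultimately show ?thesis using that by blast
qed

subsection \<open>Rank\<close>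

definition sat_indep :: "'a::ab_group_add set \<Rightarrow> 'a set \<Rightarrow> bool" where
  "sat_indep \<Gamma> J \<longleftrightarrow> finite J \<and> J \<subseteq> \<Gamma> \<and> (\<forall>x\<in>J. x \<notin> sat \<Gamma> (J - {x}))"

definition mrank :: "'a::ab_group_add set \<Rightarrow> 'a set \<Rightarrow> nat" where
  "mrank \<Gamma> V = Max (card ` {J. J \<subseteq> V \<and> sat_indep \<Gamma> J})"

lemma sat_indep_subset: "sat_indep \<Gamma> J \<Longrightarrow> K \<subseteq> J \<Longrightarrow> sat_indep \<Gamma> K"
  unfolding sat_indep_def
  by (metis (no_types, opaque_lifting) Diff_mono finite_subset order_refl sat_mono subset_iff)

lemma sat_indep_insert:
  assumes "zmod.subspace \<Gamma>" "sat_indep \<Gamma> J" "x \<in> \<Gamma>" "x \<notin> sat \<Gamma> J"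
  shows "sat_indep \<Gamma> (insert x J)"
proof -
  have J: "J \<subseteq> \<Gamma>" "finite J" using assms by (auto simp: sat_indep_def)
  have "x \<notin> J" using sat_superset[OF J(1)] assms by blast
  have "y \<notin> sat \<Gamma> (insert x J - {y})" if y: "y \<in> J" for y
  proof
    assume *: "y \<in> sat \<Gamma> (insert x J - {y})"
    have "insert x J - {y} = insert x (J - {y})" using \<open>x \<notin> J\<close> y by blast
    moreover have "y \<notin> sat \<Gamma> (J - {y})" using y assms by (simp add: sat_indep_def)
    ultimately have "x \<in> sat \<Gamma> (insert y (J - {y}))"
      using sat_exchange assms(3) * by metis
    then show False using assms(4) y by (simp add: insert_absorb)
  qed
  then show ?thesis
    using assms J \<open>x \<notin> J\<close> by (auto simp: sat_indep_def)
qed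

text \<open>Steinitz exchange: some \<open>j\<close> in \<open>J\<close> outside \<open>K\<close> is
  traded for an element of \<open>K\<close> outside the closure of the rest of \<open>J\<close>.
  Size and independence survive, and \<open>J - K\<close> shrinks.\<close>

lemma steinitz_card_le:
  assumes \<Gamma>: "zmod.subspace \<Gamma>" and "sat_indep \<Gamma> J" "finite K" "K \<subseteq> \<Gamma>" "J \<subseteq> sat \<Gamma> K"
  shows "card J \<le> card K"
  using assms(2,5)
proof (induction "card (J - K)" arbitrary: J rule: less_induct)
  case less
  then have J: "finite J" "J \<subseteq> \<Gamma>" by (auto simp: sat_indep_def)
  show ?case
  proof (cases "J \<subseteq> K")
    case True
    then show ?thesis using assms(3) card_mono by blast
  next
    case False
    then obtain j where j: "j \<in> J" "j \<notin> K" by blast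
    define I where "I = J - {j}"
    have jI: "j \<notin> sat \<Gamma> I" using less.prems j by (simp add: sat_indep_def I_def)
    have indI: "sat_indep \<Gamma> I" using sat_indep_subset less.prems I_def by blast
    have "\<not> K \<subseteq> sat \<Gamma> I"
      using sat_trans[OF \<Gamma>] jI j less.prems by blast
    then obtain k where k: "k \<in> K" "k \<notin> sat \<Gamma> I" by blast
    have kI: "k \<notin> I" using k sat_superset[of I \<Gamma>] J I_def by blast
    have "card (insert k I) \<le> card K"
    proof (rule less.hyps)
      show "sat_indep \<Gamma> (insert k I)"
        using sat_indep_insert[OF \<Gamma> indI] k assms by blast
      show "insert k I \<subseteq> sat \<Gamma> K"
        using less.prems k sat_superset[OF assms(4)] I_def by blast
      have "insert k I - K \<subset> J - K"
        using j k by (auto simp: I_def)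
      then show "card (insert k I - K) < card (J - K)"
        using J by (meson finite_Diff psubset_card_mono)
    qed
    then show ?thesis
    proof -
      have "card (insert k I) = card J"
        using card.remove[OF J(1) j(1)] kI J(1) by (simp add: I_def)
      then show ?thesis using \<open>card (insert k I) \<le> card K\<close> by metis
    qed
  qed
qed

text \<open>An independent set of maximal size spans, since any element outside its closure could be
  added.\<close>

lemma mrank_basis:
  assumes "zmod.subspace \<Gamma>" "finite V" "V \<subseteq> \<Gamma>"
  obtains J where "J \<subseteq> V" "sat_indep \<Gamma> J" "card J = mrank \<Gamma> V" "sat \<Gamma> J = sat \<Gamma> V"
proof -
  let ?C = "card ` {J. J \<subseteq> V \<and> sat_indep \<Gamma> J}"
  have fin: "finite ?C" using assms by auto
  have "{} \<in> {J. J \<subseteq> V \<and> sat_indep \<Gamma> J}" by (auto simp: sat_indep_def)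
  then have "?C \<noteq> {}" by blast
  then have "Max ?C \<in> ?C" using fin by (intro Max_in) auto
  then obtain J where J: "J \<subseteq> V" "sat_indep \<Gamma> J" "card J = mrank \<Gamma> V"
    by (auto simp: mrank_def)
  have fJ: "finite J" "J \<subseteq> \<Gamma>" using J by (auto simp: sat_indep_def)
  have "V \<subseteq> sat \<Gamma> J"
  proof
    fix x assume x: "x \<in> V"
    show "x \<in> sat \<Gamma> J"
    proof (rule ccontr)
      assume n: "x \<notin> sat \<Gamma> J"
      then have "sat_indep \<Gamma> (insert x J)" "x \<notin> J"
        using sat_indep_insert assms J x sat_superset[OF fJ(2)] by blast+
      then have "card (insert x J) \<le> mrank \<Gamma> V"
        unfolding mrank_def using fin J x by (intro Max_ge) auto
      then show False using J \<open>x \<notin> J\<close> fJ by simp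
    qed
  qed
  then have "sat \<Gamma> J = sat \<Gamma> V"
    using sat_trans[OF assms(1)] sat_mono[OF J(1)] by blast
  then show ?thesis using that J by blast
qed

lemma mrank_mono_sat:
  assumes "zmod.subspace \<Gamma>" "finite V" "V \<subseteq> \<Gamma>" "finite W" "W \<subseteq> \<Gamma>" "V \<subseteq> sat \<Gamma> W"
  shows "mrank \<Gamma> V \<le> mrank \<Gamma> W"
proof -
  obtain J where J: "J \<subseteq> V" "sat_indep \<Gamma> J" "card J = mrank \<Gamma> V"
    using mrank_basis assms by metis
  obtain K where K: "K \<subseteq> W" "sat_indep \<Gamma> K" "card K = mrank \<Gamma> W" "sat \<Gamma> K = sat \<Gamma> W"
    using mrank_basis assms by metis
  have "finite K" "K \<subseteq> \<Gamma>" using K by (auto simp: sat_indep_def)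
  then have "card J \<le> card K"
    using assms J K by (intro steinitz_card_le[of \<Gamma>]) auto
  then show ?thesis using J K by simp
qed

text \<open>The source of unit increase and of the closure property of the rank: whether the rank
  rises depends only on membership in the saturation, which is monotone in \<open>V\<close>.\<close>

lemma mrank_insert:
  assumes "zmod.subspace \<Gamma>" "finite V" "V \<subseteq> \<Gamma>" "x \<in> \<Gamma>"
  shows "mrank \<Gamma> (insert x V) = mrank \<Gamma> V + (if x \<in> sat \<Gamma> V then 0 else 1)"
proof -
  obtain J where J: "J \<subseteq> V" "sat_indep \<Gamma> J" "card J = mrank \<Gamma> V" "sat \<Gamma> J = sat \<Gamma> V"
    using mrank_basis assms by metis
  obtain K where K: "K \<subseteq> insert x V" "sat_indep \<Gamma> K" "card K = mrank \<Gamma> (insert x V)"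
    "sat \<Gamma> K = sat \<Gamma> (insert x V)"
    using mrank_basis[of \<Gamma> "insert x V"] assms by auto
  have fJ: "finite J" "J \<subseteq> \<Gamma>" "finite K" "K \<subseteq> \<Gamma>" using J K by (auto simp: sat_indep_def)
  show ?thesis
  proof (cases "x \<in> sat \<Gamma> V")
    case True
    have sub: "insert x V \<subseteq> sat \<Gamma> V" "V \<subseteq> sat \<Gamma> (insert x V)"
      using assms True sat_superset[of V \<Gamma>] sat_superset[of "insert x V" \<Gamma>] by auto
    have ins: "finite (insert x V)" "insert x V \<subseteq> \<Gamma>" using assms by auto
    have "mrank \<Gamma> (insert x V) = mrank \<Gamma> V"
      using mrank_mono_sat[OF assms(1) ins assms(2,3) sub(1)]
        mrank_mono_sat[OF assms(1-3) ins sub(2)] by (rule antisym)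
    then show ?thesis using True by simp
  next
    case False
    then have ind: "sat_indep \<Gamma> (insert x J)" and xJ: "x \<notin> J"
      using sat_indep_insert[OF assms(1) J(2)] assms J sat_superset[OF fJ(2)] by auto
    have "sat \<Gamma> V \<subseteq> sat \<Gamma> (insert x J)"
      using J(4) sat_mono[of J "insert x J"] by blast
    then have sub: "insert x V \<subseteq> sat \<Gamma> (insert x J)"
      using sat_superset[of "insert x J" \<Gamma>] sat_superset[of V \<Gamma>] assms fJ by blast
    have "card K \<le> card (insert x J)"
      using assms fJ K sub by (intro steinitz_card_le[of \<Gamma>]) auto
    moreover have "insert x J \<subseteq> sat \<Gamma> K"
      using assms J(1) K(4) sat_superset[of "insert x V" \<Gamma>] by blast
    then have "card (insert x J) \<le> card K"
      using assms(1) ind fJ(3,4) by (intro steinitz_card_le[of \<Gamma>])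
    ultimately show ?thesis using False J K xJ fJ by simp
  qed
qed

lemma mrank_empty: "mrank \<Gamma> {} = 0"
proof -
  have "{J. J \<subseteq> {} \<and> sat_indep \<Gamma> J} = {{}}" by (auto simp: sat_indep_def)
  then show ?thesis by (simp add: mrank_def)
qed

text \<open>If some \<open>w\<close> in \<open>W\<close> were outside the closure of
  \<open>V\<close>, adding it to \<open>V\<close> would push the rank above that of
  \<open>W\<close>.\<close>

lemma mrank_eq_imp_sat:
  assumes "zmod.subspace \<Gamma>" "finite V" "V \<subseteq> \<Gamma>" "finite W" "W \<subseteq> \<Gamma>" "V \<subseteq> sat \<Gamma> W"
    and "mrank \<Gamma> V = mrank \<Gamma> W"
  shows "sat \<Gamma> V = sat \<Gamma> W"
proof -
  have "w \<in> sat \<Gamma> V" if w: "w \<in> W" for w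
  proof (rule ccontr)
    assume "w \<notin> sat \<Gamma> V"
    then have "mrank \<Gamma> (insert w V) = mrank \<Gamma> V + 1"
      using mrank_insert[OF assms(1-3), of w] assms(5) w by auto
    moreover have "mrank \<Gamma> (insert w V) \<le> mrank \<Gamma> W"
      using assms w sat_superset[of W \<Gamma>] by (intro mrank_mono_sat[of \<Gamma>]) auto
    ultimately show False using assms by simp
  qed
  then show ?thesis using sat_trans[OF assms(1)] assms by blast
qed

section \<open>Multiplication by an integer on an abelian Lie group\<close>

text \<open>The estimate compares two arbitrary points near \<open>q\<close>, as contraction and
  injectivity arguments require. It comes from continuity of the derivative and the mean value
  inequality for \<open>F\<close> minus its linearization at \<open>q\<close>.\<close>

lemma smooth_on_strictly_differentiable:
  fixes F :: "'a::euclidean_space \<Rightarrow> 'b::euclidean_space"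
  assumes "smooth_on S F" "open S" "q \<in> S"
  obtains L where "(F has_derivative L) (at q)"
    "\<And>e. e > 0 \<Longrightarrow> \<exists>d>0. ball q d \<subseteq> S \<and>
       (\<forall>x\<in>ball q d. \<forall>y\<in>ball q d. norm (F x - F y - L (x - y)) \<le> e * norm (x - y))"
proof -
  have "Ck_on (Suc 0) S F" using assms by (auto simp only: smooth_on_def)
  then have dif: "\<And>x. x \<in> S \<Longrightarrow> F differentiable (at x)"
    and cont: "\<And>v. continuous_on S (\<lambda>x. frechet_derivative F (at x) v)"
    by auto
  define L where "L x = frechet_derivative F (at x)" for x
  have der: "(F has_derivative L x) (at x)" if "x \<in> S" for x
    using dif[OF that] unfolding L_def by (simp add: frechet_derivative_works)
  have "\<exists>d>0. ball q d \<subseteq> S \<and>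
       (\<forall>x\<in>ball q d. \<forall>y\<in>ball q d. norm (F x - F y - L q (x - y)) \<le> e * norm (x - y))"
    if e: "e > 0" for e :: real
  proof -
    \<comment> \<open>A linear map is controlled by its values on the basis: \<open>DIM('a)\<close>
      errors of size \<open>e'\<close> add up to \<open>e\<close>.\<close>
    define e' where "e' = e / DIM('a)"
    have e': "e' > 0" using e by (simp add: e'_def)
    have "\<forall>\<^sub>F x in at q. dist (L x b) (L q b) < e'" for b
    proof -
      have "((\<lambda>x. L x b) \<longlongrightarrow> L q b) (at q)"
        using cont[of b] assms(2,3) unfolding L_def
        by (meson continuous_on_eq_continuous_at isContD)
      then show ?thesis using e' by (rule tendstoD)
    qed
    then have "\<forall>\<^sub>F x in at q. \<forall>b\<in>Basis. dist (L x b) (L q b) < e'"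
      by (simp add: eventually_ball_finite)
    moreover have "\<forall>\<^sub>F x in at q. x \<in> S"
      using assms(2,3) eventually_at_topological by blast
    ultimately have "\<forall>\<^sub>F x in at q. x \<in> S \<and> (\<forall>b\<in>Basis. dist (L x b) (L q b) < e')"
      by eventually_elim auto
    then obtain d where d: "d > 0" "\<And>x. x \<noteq> q \<Longrightarrow> dist x q < d \<Longrightarrow>
        x \<in> S \<and> (\<forall>b\<in>Basis. dist (L x b) (L q b) < e')"
      unfolding eventually_at by auto
    then have d': "x \<in> S \<and> (\<forall>b\<in>Basis. dist (L x b) (L q b) < e')" if "x \<in> ball q d" for x
      using that assms(3) e' d(2)[of x] by (cases "x = q") (simp_all add: dist_commute)
    have bl: "bounded_linear (L x)" if "x \<in> S" for x
      using der[OF that] has_derivative_bounded_linear by blast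
    have on: "onorm (\<lambda>v. L x v - L q v) \<le> e" if x: "x \<in> ball q d" for x
    proof (rule onorm_le)
      fix v :: 'a
      define G where "G = (\<lambda>v. L x v - L q v)"
      have lin: "linear G"
        unfolding G_def using bl d'[OF x] assms(3)
        by (intro linear_compose_sub bounded_linear.linear) auto
      have "G v = G (\<Sum>b\<in>Basis. (v \<bullet> b) *\<^sub>R b)"
        by (simp add: euclidean_representation)
      also have "\<dots> = (\<Sum>b\<in>Basis. (v \<bullet> b) *\<^sub>R G b)"
        using lin by (simp add: linear_sum linear_scale)
      finally have "norm (G v) = norm (\<Sum>b\<in>Basis. (v \<bullet> b) *\<^sub>R G b)" by simp
      also have "\<dots> \<le> (\<Sum>b\<in>Basis. norm ((v \<bullet> b) *\<^sub>R G b))"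
        by (rule norm_sum)
      also have "\<dots> \<le> (\<Sum>b\<in>(Basis::'a set). norm v * e')"
      proof (rule sum_mono)
        fix b :: 'a assume b: "b \<in> Basis"
        have "norm (G b) \<le> e'"
          using d'[OF x] b by (auto simp: G_def dist_norm less_imp_le)
        then show "norm ((v \<bullet> b) *\<^sub>R G b) \<le> norm v * e'"
          using b e' by (auto intro!: mult_mono Basis_le_norm)
      qed
      also have "\<dots> = e * norm v" by (simp add: e'_def)
      finally show "norm (L x v - L q v) \<le> e * norm v" by (simp add: G_def)
    qed
    have "norm (F x - F y - L q (x - y)) \<le> e * norm (x - y)"
      if xy: "x \<in> ball q d" "y \<in> ball q d" for x y
    proof -
      have "norm ((F x - L q x) - (F y - L q y)) \<le> e * norm (x - y)"
      proof (rule differentiable_bound[where f' = "\<lambda>x v. L x v - L q v" and S = "ball q d"])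
        fix z assume z: "z \<in> ball q d"
        have "(L q has_derivative L q) (at z)"
          using bl[OF assms(3)] by (rule bounded_linear_imp_has_derivative)
        with der[OF conjunct1[OF d'[OF z]]]
        show "((\<lambda>x. F x - L q x) has_derivative (\<lambda>v. L z v - L q v)) (at z within ball q d)"
          by (rule has_derivative_at_withinI[OF has_derivative_diff])
      next
        show "convex (ball q d)" by (rule convex_ball)
        show "onorm (\<lambda>v. L z v - L q v) \<le> e" if "z \<in> ball q d" for z
          using that by (rule on)
        show "x \<in> ball q d" "y \<in> ball q d" by (rule xy)+
      qed
      moreover have "L q (x - y) = L q x - L q y"
        using bl[OF assms(3)] by (simp add: bounded_linear.linear linear_diff)
      moreover have "F x - F y - (L q x - L q y) = (F x - L q x) - (F y - L q y)" by simp
      ultimately show ?thesis by metis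
    qed
    moreover have "ball q d \<subseteq> S" using d' by blast
    ultimately show ?thesis using d(1) by (intro exI[of _ d]) simp
  qed
  then show ?thesis by (intro that[of "L q"] der assms(3)) simp
qed

text \<open>In a chart at \<open>0\<close> the group law is \<open>x + y\<close> to first order, hence \<open>k\<close>-fold multiplication is
  \<open>x \<mapsto> k x\<close> to first order.\<close>

locale chart_at_zero =
  fixes U :: "'g::{topological_ab_group_add, t2_space} set" and \<phi> :: "'g \<Rightarrow> 'e::euclidean_space"
  assumes chart: "chart (U, \<phi>)" and zero: "0 \<in> U"
    and smooth_plus: "smooth_on {(\<phi> g, \<phi> h) | g h. g \<in> U \<and> h \<in> U \<and> g + h \<in> U}
          (\<lambda>(x, y). \<phi> (inv_into U \<phi> x + inv_into U \<phi> y))"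
begin

abbreviation "\<psi> \<equiv> inv_into U \<phi>"
abbreviation "p \<equiv> \<phi> 0"

lemma open_U: "open U" and open_img: "open (\<phi> ` U)"
  and hom: "homeomorphism U (\<phi> ` U) \<phi> \<psi>"
  using chart by (auto simp: chart_def)

lemma psi_phi: "g \<in> U \<Longrightarrow> \<psi> (\<phi> g) = g"
  using hom by (simp add: homeomorphism_def)

lemma phi_psi: "x \<in> \<phi> ` U \<Longrightarrow> \<phi> (\<psi> x) = x"
  by (simp add: f_inv_into_f)

lemma psi_in: "x \<in> \<phi> ` U \<Longrightarrow> \<psi> x \<in> U"
  by (simp add: inv_into_into)

lemma cont_psi: "continuous_on (\<phi> ` U) \<psi>"
  using hom by (simp add: homeomorphism_def)

lemma cont_phi: "continuous_on U \<phi>"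
  using hom by (simp add: homeomorphism_def)

definition D where "D = {(\<phi> g, \<phi> h) | g h. g \<in> U \<and> h \<in> U \<and> g + h \<in> U}"

lemma D_iff: "(x, y) \<in> D \<longleftrightarrow> x \<in> \<phi> ` U \<and> y \<in> \<phi> ` U \<and> \<psi> x + \<psi> y \<in> U"
  unfolding D_def by (auto simp: psi_phi) (metis psi_phi)

lemma open_D: "open D"
proof -
  have "continuous_on (\<phi> ` U \<times> \<phi> ` U) (\<lambda>z. \<psi> (fst z) + \<psi> (snd z))"
    by (intro continuous_intros continuous_on_compose2[OF cont_psi]) auto
  then have "open ((\<lambda>z. \<psi> (fst z) + \<psi> (snd z)) -` U \<inter> (\<phi> ` U \<times> \<phi> ` U))"
    using open_U open_img open_Times continuous_on_open_vimage by blast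
  moreover have "D = (\<lambda>z. \<psi> (fst z) + \<psi> (snd z)) -` U \<inter> (\<phi> ` U \<times> \<phi> ` U)"
    by (auto simp: D_iff)
  ultimately show ?thesis by simp
qed

definition m where "m = (\<lambda>(x, y). \<phi> (\<psi> x + \<psi> y))"

lemma p_in: "p \<in> \<phi> ` U"
  using zero by blast

lemma pp: "(p, p) \<in> D"
  using zero p_in by (simp add: D_iff psi_phi)

lemma m_left: "x \<in> \<phi> ` U \<Longrightarrow> m (x, p) = x" and m_right: "x \<in> \<phi> ` U \<Longrightarrow> m (p, x) = x"
  by (simp_all add: m_def psi_phi zero phi_psi)

text \<open>Since \<open>p\<close> is a two-sided unit for \<open>m\<close>, the derivative at
  \<open>(p, p)\<close> is the identity in each variable separately, hence by linearity it is
  addition.\<close>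

lemma m_strict:
  assumes "e > 0"
  shows "\<exists>d>0. ball (p, p) d \<subseteq> D \<and> (\<forall>z\<in>ball (p, p) d. \<forall>w\<in>ball (p, p) d.
      norm (m z - m w - ((fst z - fst w) + (snd z - snd w))) \<le> e * norm (z - w))"
proof -
  have "smooth_on D m" using smooth_plus by (simp add: D_def m_def)
  then obtain L where L: "(m has_derivative L) (at (p, p))"
    and str: "\<And>e. e > 0 \<Longrightarrow> \<exists>d>0. ball (p, p) d \<subseteq> D \<and>
       (\<forall>x\<in>ball (p, p) d. \<forall>y\<in>ball (p, p) d. norm (m x - m y - L (x - y)) \<le> e * norm (x - y))"
    using smooth_on_strictly_differentiable[of D m "(p, p)"] open_D pp by metis
  have L1: "L (u, 0) = u" for u
  proof -
    have "((\<lambda>x. m (x, p)) has_derivative (\<lambda>u. L (u, 0))) (at p)"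
      by (rule has_derivative_compose[where g = m and f = "\<lambda>x. (x, p)", OF _ L])
        (auto intro!: derivative_eq_intros)
    moreover have "((\<lambda>x. m (x, p)) has_derivative (\<lambda>u. u)) (at p)"
      by (rule has_derivative_transform_within_open[OF _ open_img p_in]) 
        (auto simp: m_left)
    ultimately show ?thesis using has_derivative_unique by metis
  qed
  have L2: "L (0, u) = u" for u
  proof -
    have "((\<lambda>x. m (p, x)) has_derivative (\<lambda>u. L (0, u))) (at p)"
      by (rule has_derivative_compose[where g = m and f = "\<lambda>x. (p, x)", OF _ L])
        (auto intro!: derivative_eq_intros)
    moreover have "((\<lambda>x. m (p, x)) has_derivative (\<lambda>u. u)) (at p)"
      by (rule has_derivative_transform_within_open[OF _ open_img p_in])
        (auto simp: m_right)
    ultimately show ?thesis using has_derivative_unique by metis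
  qed
  have lin: "linear L" using L has_derivative_linear by blast
  have "L z = fst z + snd z" for z
    using linear_add[OF lin, of "(fst z, 0)" "(0, snd z)"] L1 L2 by simp
  then show ?thesis using str[OF assms] by simp
qed

lemma multiple_strict:
  assumes "e > 0"
  shows "\<exists>d>0. ball p d \<subseteq> \<phi> ` U \<and> (\<forall>x\<in>ball p d. nmult k (\<psi> x) \<in> U) \<and>
    (\<forall>x\<in>ball p d. \<forall>y\<in>ball p d.
      norm (\<phi> (nmult k (\<psi> x)) - \<phi> (nmult k (\<psi> y)) - real k *\<^sub>R (x - y)) \<le> e * norm (x - y))"
  using assms
proof (induction k arbitrary: e)
  case 0
  obtain d where "d > 0" "ball p d \<subseteq> \<phi> ` U"
    using open_img p_in openE by blast
  then show ?case using 0 zero by auto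
next
  case (Suc k)
  define f where "f x = \<phi> (nmult k (\<psi> x))" for x
  \<comment> \<open>The cap 1 gives \<open>f\<close> the Lipschitz constant \<open>k + 1\<close>, so
    \<open>x \<mapsto> (x, f x)\<close> has constant \<open>k + 2\<close>, which \<open>e2\<close>
    divides out. The error of \<open>m\<close> and the error of \<open>f\<close> are then at most
    \<open>e / 2\<close> times the distance each.\<close>
  define e1 where "e1 = min 1 (e / 2)"
  define e2 where "e2 = e / (2 * (real k + 2))"
  have e12: "e1 > 0" "e1 \<le> 1" "e1 \<le> e / 2" "e2 > 0" using Suc.prems by (auto simp: e1_def e2_def)
  obtain d1 where d1: "d1 > 0" "ball p d1 \<subseteq> \<phi> ` U" "\<And>x. x \<in> ball p d1 \<Longrightarrow> nmult k (\<psi> x) \<in> U"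
    "\<And>x y. x \<in> ball p d1 \<Longrightarrow> y \<in> ball p d1 \<Longrightarrow>
        norm (f x - f y - real k *\<^sub>R (x - y)) \<le> e1 * norm (x - y)"
    using Suc.IH[OF e12(1)] unfolding f_def by blast
  obtain d2 where d2: "d2 > 0" "ball (p, p) d2 \<subseteq> D" "\<And>z w. z \<in> ball (p, p) d2 \<Longrightarrow>
      w \<in> ball (p, p) d2 \<Longrightarrow>
      norm (m z - m w - ((fst z - fst w) + (snd z - snd w))) \<le> e2 * norm (z - w)"
    using m_strict[OF e12(4)] by metis
  \<comment> \<open>Dividing by the Lipschitz constant \<open>k + 2\<close> keeps
    \<open>(x, f x)\<close> in the ball of radius \<open>d2\<close>.\<close>
  define d where "d = min d1 (d2 / (real k + 2))"
  have d: "d > 0" "d \<le> d1" "d * (real k + 2) \<le> d2"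
  proof -
    have "d * (real k + 2) \<le> d2 / (real k + 2) * (real k + 2)"
      by (intro mult_right_mono) (auto simp: d_def)
    then show "d * (real k + 2) \<le> d2" by simp
  qed (use d1(1) d2(1) in \<open>auto simp: d_def\<close>)
  have fp: "f p = p" by (simp add: f_def psi_phi zero nmult_zero_right)
  have lip: "norm (f x - f y) \<le> (real k + 1) * norm (x - y)"
    if "x \<in> ball p d" "y \<in> ball p d" for x y
  proof -
    have "norm (f x - f y) \<le> norm (f x - f y - real k *\<^sub>R (x - y)) + norm (real k *\<^sub>R (x - y))"
      by (metis norm_triangle_sub add.commute)
    also have "\<dots> \<le> e1 * norm (x - y) + real k * norm (x - y)"
      using d1(4)[of x y] that d by auto
    also have "\<dots> \<le> 1 * norm (x - y) + real k * norm (x - y)"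
      using e12 by (intro add_right_mono mult_right_mono) auto
    finally show ?thesis by (simp add: algebra_simps)
  qed
  have pair: "norm ((x, f x) - (y, f y)) \<le> (real k + 2) * norm (x - y)"
    if "x \<in> ball p d" "y \<in> ball p d" for x y
  proof -
    have "norm ((x, f x) - (y, f y)) \<le> norm (x - y) + norm (f x - f y)"
      by (simp add: norm_Pair_le)
    then show ?thesis using lip[OF that] by (simp add: algebra_simps)
  qed
  have pball: "p \<in> ball p d" using d by simp
  have inball: "(x, f x) \<in> ball (p, p) d2" if x: "x \<in> ball p d" for x
  proof -
    have "norm ((x, f x) - (p, p)) \<le> (real k + 2) * norm (x - p)"
      using pair[OF x pball] fp by simp
    also have "\<dots> < (real k + 2) * d"
      using x by (intro mult_strict_left_mono) (auto simp: dist_norm norm_minus_commute)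
    also have "\<dots> \<le> d2" using d by (simp add: mult.commute)
    finally have "dist (x, f x) (p, p) < d2" by (simp only: dist_norm)
    then show ?thesis by (simp only: mem_ball dist_commute)
  qed
  have psif: "\<psi> (f x) = nmult k (\<psi> x)" if "x \<in> ball p d" for x
    using that d d1(3) by (simp add: f_def psi_phi)
  have mf: "\<phi> (nmult (Suc k) (\<psi> x)) = m (x, f x)" if "x \<in> ball p d" for x
    using psif[OF that] by (simp add: m_def)
  have inU: "nmult (Suc k) (\<psi> x) \<in> U" if "x \<in> ball p d" for x
    using inball[OF that] d2(2) psif[OF that] D_iff by auto
  have est: "norm (\<phi> (nmult (Suc k) (\<psi> x)) - \<phi> (nmult (Suc k) (\<psi> y)) - real (Suc k) *\<^sub>R (x - y))
      \<le> e * norm (x - y)" if xy: "x \<in> ball p d" "y \<in> ball p d" for x y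
  proof -
    have "norm (m (x, f x) - m (y, f y) - ((x - y) + (f x - f y))) \<le> e2 * norm ((x, f x) - (y, f y))"
      using d2(3)[OF inball[OF xy(1)] inball[OF xy(2)]] by simp
    also have "\<dots> \<le> e2 * ((real k + 2) * norm (x - y))"
      using e12 pair[OF xy] by (intro mult_left_mono) auto
    also have "\<dots> = e / 2 * norm (x - y)"
      by (simp add: e2_def field_simps)
    finally have 1: "norm (m (x, f x) - m (y, f y) - ((x - y) + (f x - f y))) \<le> e / 2 * norm (x - y)" .
    have "norm (f x - f y - real k *\<^sub>R (x - y)) \<le> e1 * norm (x - y)"
      using d1(4) xy d by auto
    also have "\<dots> \<le> e / 2 * norm (x - y)"
      using e12 by (intro mult_right_mono) auto
    finally have 2: "norm (f x - f y - real k *\<^sub>R (x - y)) \<le> e / 2 * norm (x - y)" .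
    have "m (x, f x) - m (y, f y) - real (Suc k) *\<^sub>R (x - y) =
        (m (x, f x) - m (y, f y) - ((x - y) + (f x - f y))) + (f x - f y - real k *\<^sub>R (x - y))"
      by (simp add: algebra_simps)
    then have "norm (m (x, f x) - m (y, f y) - real (Suc k) *\<^sub>R (x - y)) \<le> e * norm (x - y)"
      using norm_triangle_mono[OF 1 2] by (simp add: field_simps)
    then show ?thesis using mf[OF xy(1)] mf[OF xy(2)] by metis
  qed
  show ?case using d(1) d1(2) d(2) inU est by (intro exI[of _ d]) auto
qed

lemma open_psi_image: "open B \<Longrightarrow> B \<subseteq> \<phi> ` U \<Longrightarrow> open (\<psi> ` B)"
proof -
  assume B: "open B" "B \<subseteq> \<phi> ` U"
  have "open (\<phi> -` B \<inter> U)"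
    using cont_phi open_U B continuous_on_open_vimage by blast
  moreover have "\<psi> ` B = \<phi> -` B \<inter> U"
  proof
    show "\<psi> ` B \<subseteq> \<phi> -` B \<inter> U" using B psi_in phi_psi by (auto simp: subset_iff)
    show "\<phi> -` B \<inter> U \<subseteq> \<psi> ` B" by (auto intro!: image_eqI psi_phi[symmetric])
  qed
  ultimately show ?thesis by simp
qed

text \<open>Division by \<open>k\<close> is solved by a contraction on a closed ball in the chart;
  the solution stays in that ball, so the compact set lies in its own \<open>k\<close>-fold
  multiple. The same estimate, with error 1/2 against slope at least 2, shows that only 0 is sent to
  0 nearby.\<close>

lemma divisible_neighbourhood:
  assumes k: "k \<ge> 2"
  shows "\<exists>(K::'g set) V. compact K \<and> V \<subseteq> K \<and> open V \<and> 0 \<in> V \<and> K \<subseteq> nmult k ` K \<and>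
    (\<forall>x\<in>V. nmult k x = 0 \<longrightarrow> x = 0)"
proof -
  obtain d where d: "d > 0" "ball p d \<subseteq> \<phi> ` U" "\<And>x. x \<in> ball p d \<Longrightarrow> nmult k (\<psi> x) \<in> U"
    "\<And>x y. x \<in> ball p d \<Longrightarrow> y \<in> ball p d \<Longrightarrow>
      norm (\<phi> (nmult k (\<psi> x)) - \<phi> (nmult k (\<psi> y)) - real k *\<^sub>R (x - y)) \<le> 1 / 2 * norm (x - y)"
    using multiple_strict[of "1 / 2" k] by auto
  define f where "f x = \<phi> (nmult k (\<psi> x))" for x
  note est = d(4)[folded f_def]
  define r where "r = d / 2"
  have r: "r > 0" "cball p r \<subseteq> ball p d" "ball p r \<subseteq> cball p r"
    using d(1) by (auto simp: r_def)
  have fp: "f p = p" by (simp add: f_def psi_phi zero nmult_zero_right)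
  have kpos: "real k \<ge> 2" using k by simp
  have surj: "\<exists>x\<in>cball p r. f x = y" if y: "y \<in> cball p r" for y
  proof -
    \<comment> \<open>A Newton step with the derivative frozen at \<open>k\<close>; its fixed points
      solve \<open>f x = y\<close>. The Lipschitz constant is at most 1/4 and \<open>p\<close> moves
      by at most \<open>r / 2\<close>, so the ball is mapped into itself.\<close>
    define T where "T x = x - (f x - y) /\<^sub>R real k" for x
    have Tdiff: "norm (T x - T x') \<le> 1 / 4 * norm (x - x')"
      if "x \<in> cball p r" "x' \<in> cball p r" for x x'
    proof -
      have "T x - T x' = - (f x - f x' - real k *\<^sub>R (x - x')) /\<^sub>R real k"
        using kpos by (simp add: T_def algebra_simps)
      then have "norm (T x - T x') = norm (f x - f x' - real k *\<^sub>R (x - x')) / real k"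
        using kpos by (simp add: norm_minus_commute divide_inverse_commute)
      also have "\<dots> \<le> (1 / 2 * norm (x - x')) / real k"
        using est[OF subsetD[OF r(2) that(1)] subsetD[OF r(2) that(2)]]
        by (intro divide_right_mono) auto
      also have "\<dots> \<le> (1 / 2 * norm (x - x')) / 2"
        using kpos by (intro divide_left_mono) auto
      finally show ?thesis by simp
    qed
    have "\<exists>!x\<in>cball p r. T x = x"
    proof (rule Banach_fix)
      show "complete (cball p r)" by (simp add: compact_imp_complete)
      show "cball p r \<noteq> {}" using r by auto
      show "(0::real) \<le> 1 / 4" "1 / 4 < (1::real)" by auto
      show "T ` cball p r \<subseteq> cball p r"
      proof safe
        fix x assume x: "x \<in> cball p r"
        have "norm (T p - p) = norm (y - p) / real k"
          using kpos by (simp add: T_def fp norm_minus_commute divide_inverse_commute)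
        also have "\<dots> \<le> r / 2"
          using y kpos r by (intro frac_le) (auto simp: dist_norm norm_minus_commute)
        finally have 1: "norm (T p - p) \<le> r / 2" .
        have "norm (T x - T p) \<le> 1 / 4 * norm (x - p)"
          using x r by (intro Tdiff) auto
        also have "\<dots> \<le> r / 4" using x by (simp add: dist_norm norm_minus_commute)
        finally have 2: "norm (T x - T p) \<le> r / 4" .
        have "norm (T x - p) \<le> r / 4 + r / 2"
          using norm_triangle_mono[OF 2 1] by simp
        then show "T x \<in> cball p r" using r by (simp add: dist_norm norm_minus_commute)
      qed
      show "\<And>x x'. x \<in> cball p r \<Longrightarrow> x' \<in> cball p r \<Longrightarrow> dist (T x) (T x') \<le> 1 / 4 * dist x x'"
        using Tdiff by (simp add: dist_norm)
    qed
    then obtain x where "x \<in> cball p r" "T x = x" by blast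
    then show ?thesis using kpos by (auto simp: T_def)
  qed
  show ?thesis
  proof (rule exI[of _ "\<psi> ` cball p r"], rule exI[of _ "\<psi> ` ball p r"], intro conjI)
    have sub: "cball p r \<subseteq> \<phi> ` U" using r d by blast
    show "compact (\<psi> ` cball p r)"
      using continuous_on_subset[OF cont_psi sub] by (intro compact_continuous_image) auto
    show "\<psi> ` ball p r \<subseteq> \<psi> ` cball p r" using r by blast
    show "open (\<psi> ` ball p r)" using sub r by (intro open_psi_image) auto
    show "0 \<in> \<psi> ` ball p r"
      using r zero by (intro image_eqI[of _ _ p]) (auto simp: psi_phi)
    show "\<psi> ` cball p r \<subseteq> nmult k ` \<psi> ` cball p r"
    proof safe
      fix y assume y: "y \<in> cball p r"
      then obtain x where x: "x \<in> cball p r" "f x = y" using surj by blast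
      then have "\<psi> y = nmult k (\<psi> x)"
        using d(3)[of x] r by (auto simp: f_def psi_phi)
      then show "\<psi> y \<in> nmult k ` \<psi> ` cball p r" using x by blast
    qed
    show "\<forall>x\<in>\<psi> ` ball p r. nmult k x = 0 \<longrightarrow> x = 0"
    proof safe
      fix x assume x: "x \<in> ball p r" "nmult k (\<psi> x) = 0"
      have "norm (f x - f p - real k *\<^sub>R (x - p)) \<le> 1 / 2 * norm (x - p)"
        using x(1) r d(1) by (intro est subsetD[OF r(2)]) auto
      moreover have "f x = f p" using x(2) fp by (simp add: f_def)
      ultimately have "real k * norm (x - p) \<le> 1 / 2 * norm (x - p)" by simp
      moreover have "2 * norm (x - p) \<le> real k * norm (x - p)"
        using kpos by (intro mult_right_mono) auto
      ultimately have "norm (x - p) \<le> 0" by argo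
      then show "\<psi> x = 0" by (simp add: psi_phi zero)
    qed
  qed
qed

text \<open>A Euclidean space has a basis vector, so the chart contains points other than
  \<open>p\<close>.\<close>

lemma nontrivial: "\<exists>g::'g. g \<noteq> 0"
proof -
  obtain d where d: "d > 0" "ball p d \<subseteq> \<phi> ` U"
    using open_img p_in openE by blast
  obtain b :: 'e where b: "b \<in> Basis" using nonempty_Basis by blast
  define x where "x = p + (d / 2) *\<^sub>R b"
  have x: "x \<in> ball p d" "x \<noteq> p" using b d by (auto simp: x_def dist_norm)
  then have "\<psi> x \<noteq> 0" using phi_psi d(2) by fastforce
  then show ?thesis by blast
qed

end

lemma abelian_lie_group_chart:
  fixes \<U> :: "('g::{topological_ab_group_add, t2_space, second_countable_topology} set
                 \<times> ('g \<Rightarrow> 'e::euclidean_space)) set"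
  assumes "abelian_lie_group \<U>"
  obtains U and \<phi> :: "'g \<Rightarrow> 'e" where "chart_at_zero U \<phi>"
proof -
  have "smooth_atlas \<U>" using assms by (simp add: abelian_lie_group_def)
  then have "0 \<in> (\<Union>(U, \<phi>)\<in>\<U>. U)" and charts: "\<And>c. c \<in> \<U> \<Longrightarrow> chart c"
    by (auto simp: smooth_atlas_def)
  then obtain U \<phi> where U: "(U, \<phi>) \<in> \<U>" "0 \<in> U" by auto
  have "chart (U, \<phi>)" using charts U by blast
  have "smooth_on {(\<phi> g, \<phi> h) | g h. g \<in> U \<and> h \<in> U \<and> g + h \<in> U}
          (\<lambda>(x, y). \<phi> (inv_into U \<phi> x + inv_into U \<phi> y))"
    using assms U(1) unfolding abelian_lie_group_def by blast
  then have "chart_at_zero U \<phi>"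
    using U \<open>chart (U, \<phi>)\<close> by unfold_locales
  then show thesis by (rule that)
qed

section \<open>Covering and packing by translates in a topological group\<close>

lemma finite_translates_cover:
  fixes C :: "'g::topological_ab_group_add set"
  assumes "compact C" "open W" "0 \<in> W"
  obtains F where "finite F" "\<And>x. x \<in> C \<Longrightarrow> \<exists>f\<in>F. x - f \<in> W"
proof -
  have "open ((\<lambda>x. x - f) -` W)" for f
    using assms(2) by (intro open_vimage continuous_intros)
  moreover have "C \<subseteq> (\<Union>f\<in>C. (\<lambda>x. x - f) -` W)" using assms(3) by auto
  ultimately obtain F where "F \<subseteq> C" "finite F" "C \<subseteq> (\<Union>f\<in>F. (\<lambda>x. x - f) -` W)"
    using compactE_image[OF assms(1), of C "\<lambda>f. (\<lambda>x. x - f) -` W"] by metis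
  then show ?thesis using that[of F] by blast
qed

definition separated :: "'g::ab_group_add set \<Rightarrow> 'g set \<Rightarrow> bool" where
  "separated U S \<longleftrightarrow> (\<forall>x\<in>S. \<forall>y\<in>S. x \<noteq> y \<longrightarrow> x - y \<notin> U)"

lemma separated_subset: "separated U S \<Longrightarrow> T \<subseteq> S \<Longrightarrow> separated U T"
  unfolding separated_def by blast

text \<open>The bound must not depend on the translate \<open>g\<close>. With \<open>W - W\<close>
  inside \<open>U\<close> and finitely many translates of \<open>W\<close> covering
  \<open>C\<close>, two points in the same translate differ by an element of \<open>U\<close>, so
  each translate holds at most one point.\<close>

lemma separated_card_bound:
  fixes C :: "'g::topological_ab_group_add set"
  assumes "compact C" "open U" "0 \<in> U"
  obtains M where "\<And>S g. separated U S \<Longrightarrow> (\<And>x. x \<in> S \<Longrightarrow> x - g \<in> C) \<Longrightarrow> finite S \<and> card S \<le> M"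
proof -
  have "open ((\<lambda>z::'g\<times>'g. fst z - snd z) -` U)"
    using assms(2) by (intro open_vimage continuous_intros)
  moreover have "(0, 0) \<in> (\<lambda>z::'g\<times>'g. fst z - snd z) -` U" using assms(3) by simp
  ultimately obtain A B where AB: "open A" "open B" "(0, 0) \<in> A \<times> B"
    "A \<times> B \<subseteq> (\<lambda>z::'g\<times>'g. fst z - snd z) -` U"
    by (rule open_prod_elim) 
  define W where "W = A \<inter> B"
  have W: "open W" "0 \<in> W" "\<And>x y. x \<in> W \<Longrightarrow> y \<in> W \<Longrightarrow> x - y \<in> U"
    using AB by (auto simp: W_def)
  obtain F where F: "finite F" "\<And>x. x \<in> C \<Longrightarrow> \<exists>f\<in>F. x - f \<in> W"
    using finite_translates_cover[OF assms(1) W(1,2)] by metis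
  have "finite S \<and> card S \<le> card F"
    if S: "separated U S" "\<And>x. x \<in> S \<Longrightarrow> x - g \<in> C" for S g
  proof -
    have "\<forall>x\<in>S. \<exists>f. f \<in> F \<and> x - g - f \<in> W" using F(2) S(2) by blast
    then obtain h where h: "\<And>x. x \<in> S \<Longrightarrow> h x \<in> F \<and> x - g - h x \<in> W" by metis
    have "inj_on h S"
    proof (rule inj_onI)
      fix x y assume xy: "x \<in> S" "y \<in> S" "h x = h y"
      have "(x - g - h x) - (y - g - h y) \<in> U"
        using W(3) h xy by blast
      then have "x - y \<in> U" using xy(3) by (simp add: algebra_simps)
      then show "x = y" using S(1) xy unfolding separated_def by blast
    qed
    moreover have "h ` S \<subseteq> F" using h by blast
    ultimately show ?thesis
      using inj_on_finite[of h S F] card_inj_on_le[of h S F] F(1) by simp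
  qed
  then show ?thesis by (rule that)
qed

text \<open>The base 4 is chosen above \<open>exp 1\<close>, so that the statement reduces to the
  decay of \<open>x ^ d / exp x\<close>; the constant \<open>c\<close> absorbs \<open>M\<close> and
  the factor \<open>(r + 1) ^ d\<close>.\<close>

lemma polynomial_less_exponential: "\<exists>j. real M * (real j * r + 1) ^ d < 4 ^ j" if "r \<ge> 0"
proof -
  define c where "c = real M * (r + 1) ^ d + 1"
  have c: "c > 0" using that by (simp add: c_def add_nonneg_pos)
  have "((\<lambda>x::real. x ^ d / exp x) \<longlongrightarrow> 0) at_top"
    by (rule tendsto_power_div_exp_0)
  then have "\<forall>\<^sub>F x::real in at_top. x ^ d / exp x < 1 / c"
    using c by (intro order_tendstoD(2)[where y = 0]) auto
  then obtain N where N: "\<And>x::real. x \<ge> N \<Longrightarrow> x ^ d / exp x < 1 / c"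
    by (auto simp: eventually_at_top_linorder)
  obtain j :: nat where j: "real j \<ge> max N 1"
    using real_arch_simple by blast
  have "exp (real j) \<le> 4 ^ j"
    using exp_le by (simp add: exp_of_nat_mult[of j "1::real", simplified] power_mono)
  have "real M * (real j * r + 1) ^ d \<le> real M * (real j * (r + 1)) ^ d"
    using j that by (intro mult_left_mono power_mono) (auto simp: algebra_simps)
  also have "\<dots> = real M * (r + 1) ^ d * real j ^ d"
    by (simp add: power_mult_distrib)
  also have "\<dots> \<le> c * real j ^ d"
    by (intro mult_right_mono) (auto simp: c_def)
  also have "\<dots> < exp (real j)"
    using N[of "real j"] j c by (simp add: field_simps)
  also have "\<dots> \<le> 4 ^ j" by fact
  finally show ?thesis by blast
qed

text \<open>The packing numbers \<open>c(n)\<close> of the \<open>n\<close>-fold sums \<open>n K\<close> grow polynomially, since \<open>n K\<close> is covered by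
  translates of \<open>K\<close> along a finitely generated abelian group. As \<open>n K\<close> lies in \<open>k (n K)\<close>, a set of \<open>N\<close>
  torsion points in \<open>r K\<close> gives \<open>N c(n) \<le> C c(n + r)\<close> with \<open>C\<close> independent of \<open>N\<close>; so \<open>N\<close> is bounded.\<close>

locale self_divisible_compact =
  fixes K V :: "'g::{topological_ab_group_add, t2_space} set" and k :: nat
  assumes compact_K: "compact K" and V_K: "V \<subseteq> K" and open_V: "open V" and zero_V: "0 \<in> V"
    and K_div: "K \<subseteq> nmult k ` K" and torsion_V: "\<And>x. x \<in> V \<Longrightarrow> nmult k x = 0 \<Longrightarrow> x = 0"
    and connected_G: "connected (UNIV :: 'g set)"
begin

primrec msum :: "nat \<Rightarrow> 'g set" where
  "msum 0 = {0}"
| "msum (Suc n) = {x + y | x y. x \<in> K \<and> y \<in> msum n}"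

lemma zero_K: "0 \<in> K"
  using V_K zero_V by blast

lemma msum_add: "x \<in> msum a \<Longrightarrow> y \<in> msum b \<Longrightarrow> x + y \<in> msum (a + b)"
proof (induction a arbitrary: x)
  case (Suc a)
  then obtain u v where "u \<in> K" "v \<in> msum a" "x = u + v" by auto
  then show ?case using Suc by (auto simp: add.assoc)
qed simp

lemma zero_msum: "0 \<in> msum n"
  by (induction n) (use zero_K in \<open>force+\<close>)

lemma msum_mono: "a \<le> b \<Longrightarrow> msum a \<subseteq> msum b"
  using msum_add[of _ a 0 "b - a"] zero_msum by auto

lemma msum_SucI: "x \<in> K \<Longrightarrow> y \<in> msum n \<Longrightarrow> x + y \<in> msum (Suc n)"
  by auto

text \<open>The union is open because it absorbs \<open>x + V\<close>; its complement is open
  because it absorbs \<open>x - V\<close>, as a sum \<open>y\<close> in \<open>x - V\<close> would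
  make \<open>x\<close> a sum as well. Connectedness finishes.\<close>

lemma msum_exhaust: "(\<Union>n. msum n) = UNIV"
proof -
  let ?A = "\<Union>n. msum n"
  have "open ?A"
  proof (subst open_subopen, safe)
    fix x n assume x: "x \<in> msum n"
    show "\<exists>T. open T \<and> x \<in> T \<and> T \<subseteq> ?A"
    proof (intro exI conjI)
      show "open ((\<lambda>y. y - x) -` V)"
        using open_V by (intro open_vimage continuous_intros)
      show "x \<in> (\<lambda>y. y - x) -` V" using zero_V by simp
      show "(\<lambda>y. y - x) -` V \<subseteq> ?A"
      proof
        fix y assume "y \<in> (\<lambda>y. y - x) -` V"
        then have "y - x \<in> K" using V_K by auto
        then have "y \<in> msum (Suc n)"
          using x msum_SucI[of "y - x" x n] by simp
        then show "y \<in> ?A" by (rule UN_I[OF UNIV_I])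
      qed
    qed
  qed
  moreover have "open (- ?A)"
  proof (subst open_subopen, intro ballI)
    fix x assume x: "x \<in> - ?A"
    show "\<exists>T. open T \<and> x \<in> T \<and> T \<subseteq> - ?A"
    proof (intro exI conjI)
      show "open ((\<lambda>y. x - y) -` V)"
        using open_V by (intro open_vimage continuous_intros)
      show "x \<in> (\<lambda>y. x - y) -` V" using zero_V by simp
      show "(\<lambda>y. x - y) -` V \<subseteq> - ?A"
      proof safe
        fix y n assume "x - y \<in> V" "y \<in> msum n"
        then have "x - y \<in> K" "y \<in> msum n" using V_K by auto
        then have "x \<in> msum (Suc n)"
          using msum_SucI[of "x - y" y n] by simp
        then show False using x by blast
      qed
    qed
  qed
  ultimately have "?A = {} \<or> ?A = UNIV"
    using connectedD[OF connected_G, of ?A "- ?A"] by auto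
  then show ?thesis using zero_msum by blast
qed

lemma msum_div: "msum n \<subseteq> nmult k ` msum n"
proof (induction n)
  case 0
  then show ?case by (simp add: nmult_zero_right)
next
  case (Suc n)
  show ?case
  proof
    fix z assume "z \<in> msum (Suc n)"
    then obtain x y where "x \<in> K" "y \<in> msum n" "z = x + y" by auto
    moreover then obtain x' y' where "x' \<in> K" "x = nmult k x'" "y' \<in> msum n" "y = nmult k y'"
      using K_div Suc by blast
    ultimately show "z \<in> nmult k ` msum (Suc n)"
      by (intro image_eqI[of _ _ "x' + y'"]) (auto simp: nmult_add_right)
  qed
qed

lemma divisible: "\<exists>y. nmult k y = (x::'g)"
proof -
  have "x \<in> (\<Union>n. msum n)" using msum_exhaust by simp
  then obtain n where "x \<in> msum n" by blast
  then show ?thesis using msum_div[of n] by auto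
qed

text \<open>The set \<open>K + K\<close> is covered by translates of \<open>V\<close> by elements of
  a finite set \<open>F\<close>. Each further summand from \<open>K\<close> thus costs a single
  generator, which bounds the coefficients after \<open>n\<close> summands by
  \<open>n\<close>.\<close>

lemma msum_growth:
  obtains F where "finite F"
    "\<And>n x. x \<in> msum n \<Longrightarrow> \<exists>a\<in>F \<rightarrow>\<^sub>E {..n}. x - (\<Sum>f\<in>F. nmult (a f) f) \<in> K"
proof -
  have "compact ((\<lambda>z. fst z + snd z) ` (K \<times> K))"
    by (intro compact_continuous_image compact_Times compact_K continuous_intros)
  then obtain F where F: "finite F"
    "\<And>x. x \<in> (\<lambda>z. fst z + snd z) ` (K \<times> K) \<Longrightarrow> \<exists>f\<in>F. x - f \<in> V"
    using finite_translates_cover[OF _ open_V zero_V] by metis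
  have "\<exists>a\<in>F \<rightarrow>\<^sub>E {..n}. x - (\<Sum>f\<in>F. nmult (a f) f) \<in> K" if "x \<in> msum n" for n x
    using that
  proof (induction n arbitrary: x)
    case 0
    then show ?case using zero_K by (intro bexI[of _ "\<lambda>f\<in>F. 0"]) auto
  next
    case (Suc n)
    then obtain u v where uv: "u \<in> K" "v \<in> msum n" "x = u + v" by auto
    obtain a where a: "a \<in> F \<rightarrow>\<^sub>E {..n}" "v - (\<Sum>f\<in>F. nmult (a f) f) \<in> K"
      using Suc.IH[OF uv(2)] by blast
    then have "u + (v - (\<Sum>f\<in>F. nmult (a f) f)) \<in> (\<lambda>z. fst z + snd z) ` (K \<times> K)"
      using uv by (intro image_eqI[of _ _ "(u, v - (\<Sum>f\<in>F. nmult (a f) f))"]) auto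
    then obtain g where g: "g \<in> F" "u + (v - (\<Sum>f\<in>F. nmult (a f) f)) - g \<in> K"
      using F(2) V_K by blast
    define b where "b = a(g := Suc (a g))"
    have "(\<Sum>f\<in>F. nmult (b f) f) = nmult (b g) g + (\<Sum>f\<in>F - {g}. nmult (b f) f)"
      using F(1) g(1) by (simp add: sum.remove)
    also have "(\<Sum>f\<in>F - {g}. nmult (b f) f) = (\<Sum>f\<in>F - {g}. nmult (a f) f)"
      by (intro sum.cong) (auto simp: b_def)
    also have "nmult (b g) g + \<dots> = g + (\<Sum>f\<in>F. nmult (a f) f)"
      using F(1) g(1) by (simp add: sum.remove b_def add.assoc)
    finally have "x - (\<Sum>f\<in>F. nmult (b f) f) \<in> K"
      using g(2) uv(3) by (simp add: algebra_simps)
    moreover have "b \<in> F \<rightarrow>\<^sub>E {..Suc n}"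
      using a(1) g(1) by (auto simp: b_def PiE_iff extensional_def le_SucI)
    ultimately show ?case by blast
  qed
  then show ?thesis using that F(1) by blast
qed

text \<open>There are \<open>(n + 1) ^ card F\<close> coefficient vectors, and the part of the set
  lying in one translate of \<open>K\<close> has at most \<open>M\<close> elements.\<close>

lemma packing_growth:
  assumes "open U" "0 \<in> U"
  obtains M d where "\<And>S n. separated U S \<Longrightarrow> S \<subseteq> msum n \<Longrightarrow> finite S \<and> card S \<le> M * (n + 1) ^ d"
proof -
  obtain F where F: "finite F"
    "\<And>n x. x \<in> msum n \<Longrightarrow> \<exists>a\<in>F \<rightarrow>\<^sub>E {..n}. x - (\<Sum>f\<in>F. nmult (a f) f) \<in> K"
    using msum_growth by metis
  obtain M where M: "\<And>S g. separated U S \<Longrightarrow> (\<And>x. x \<in> S \<Longrightarrow> x - g \<in> K) \<Longrightarrow> finite S \<and> card S \<le> M"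
    using separated_card_bound[OF compact_K assms] by metis
  have "finite S \<and> card S \<le> M * (n + 1) ^ card F" if S: "separated U S" "S \<subseteq> msum n" for S n
  proof -
    define P where "P a = {x \<in> S. x - (\<Sum>f\<in>F. nmult (a f) f) \<in> K}" for a
    have P: "finite (P a) \<and> card (P a) \<le> M" for a
      using M[OF separated_subset[OF S(1)], of "P a"] by (auto simp: P_def)
    have fin: "finite (F \<rightarrow>\<^sub>E {..n})" using F(1) by (simp add: finite_PiE)
    have eq: "S = (\<Union>a\<in>F \<rightarrow>\<^sub>E {..n}. P a)" using F(2) S(2) by (auto simp: P_def)
    have "card (\<Union>a\<in>F \<rightarrow>\<^sub>E {..n}. P a) \<le> (\<Sum>a\<in>F \<rightarrow>\<^sub>E {..n}. card (P a))"
      using fin by (rule card_UN_le)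
    also have "\<dots> \<le> (\<Sum>a\<in>F \<rightarrow>\<^sub>E {..n}. M)" using P by (intro sum_mono) auto
    also have "\<dots> = M * (n + 1) ^ card F" using F(1) by (simp add: card_PiE)
    finally show ?thesis using eq P fin by auto
  qed
  then show ?thesis using that by blast
qed

lemma finite_torsion: "finite {x::'g. nmult k x = 0}"
proof -
  let ?T = "{x::'g. nmult k x = 0}"
  obtain M d where M: "\<And>S n. separated V S \<Longrightarrow> S \<subseteq> msum n \<Longrightarrow> finite S \<and> card S \<le> M * (n + 1) ^ d"
    using packing_growth[OF open_V zero_V] by metis
  define c where "c n = Max (card ` {S. S \<subseteq> msum n \<and> separated V S})" for n
  have fin: "finite (card ` {S. S \<subseteq> msum n \<and> separated V S})" for n
    by (rule finite_subset[of _ "{..M * (n + 1) ^ d}"]) (use M in auto)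
  have c_ge: "card S \<le> c n" if "S \<subseteq> msum n" "separated V S" for S n
    unfolding c_def using that fin by (intro Max_ge) auto
  have c_ex: "\<exists>S. S \<subseteq> msum n \<and> separated V S \<and> card S = c n" for n
  proof -
    have "{} \<in> {S. S \<subseteq> msum n \<and> separated V S}" by (auto simp: separated_def)
    then have "c n \<in> card ` {S. S \<subseteq> msum n \<and> separated V S}"
      unfolding c_def using fin by (intro Max_in) auto
    then show ?thesis by auto
  qed
  have c0: "c 0 \<ge> 1"
    using c_ge[of "{0}" 0] by (auto simp: separated_def)
  \<comment> \<open>Fine enough to see both coordinates of a point \<open>h s + x\<close>:
    multiplication by \<open>k\<close> recovers \<open>s\<close> up to \<open>V\<close>, and once
    the \<open>s\<close> agree the torsion parts differ by an element of \<open>V\<close>.\<close>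
  define U where "U = nmult k -` V \<inter> V"
  have cont: "continuous_on UNIV (\<lambda>x::'g. nmult n x)" for n
    by (induction n) (auto intro!: continuous_intros)
  have U: "open U" "0 \<in> U"
    unfolding U_def using open_V zero_V cont
    by (auto intro!: open_Int open_vimage simp: nmult_zero_right)
  \<comment> \<open>Maximality of a separated set gives a difference in \<open>V\<close> in one of
    the two orders, hence the symmetric set.\<close>
  let ?C = "K \<union> uminus ` K"
  have "compact ?C"
    by (intro compact_Un compact_K compact_continuous_image continuous_intros)
  then obtain C where C: "\<And>S g. separated U S \<Longrightarrow> (\<And>x. x \<in> S \<Longrightarrow> x - g \<in> ?C) \<Longrightarrow>
      finite S \<and> card S \<le> C"
    using separated_card_bound[OF _ U] by metis
  have C1: "C \<ge> 1"
    using C[of "{0}" 0] zero_K by (auto simp: separated_def)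
  \<comment> \<open>With more than \<open>4 * C\<close> torsion points, \<open>c\<close> would grow
    by a factor of at least 4 every \<open>r\<close> steps, against its polynomial bound.\<close>
  have bound: "card D \<le> 4 * C" if D: "finite D" "D \<subseteq> ?T" for D
  proof (rule ccontr)
    assume "\<not> card D \<le> 4 * C"
    then have N: "card D > 4 * C" by simp
    have "\<exists>r. D \<subseteq> msum r"
      using D(1)
    proof (induction D rule: finite_induct)
      case (insert x D)
      then obtain r where "D \<subseteq> msum r" by blast
      moreover obtain s where "x \<in> msum s" using msum_exhaust by blast
      ultimately have "insert x D \<subseteq> msum (max r s)"
        using msum_mono[of r "max r s"] msum_mono[of s "max r s"] by auto
      then show ?case by blast
    qed simp
    then obtain r where r: "D \<subseteq> msum r" by blast
    have key: "card D * c n \<le> C * c (n + r)" for n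
    proof -
      obtain S where S: "S \<subseteq> msum n" "separated V S" "card S = c n" using c_ex by blast
      have "\<forall>s\<in>S. \<exists>y\<in>msum n. nmult k y = s" using S(1) msum_div by blast
      then obtain h where h: "\<And>s. s \<in> S \<Longrightarrow> h s \<in> msum n" "\<And>s. s \<in> S \<Longrightarrow> nmult k (h s) = s"
        by metis
      \<comment> \<open>Every point of an optimal packing of the \<open>n\<close>-fold sums is
        divided by \<open>k\<close> and then shifted by all torsion points of \<open>D\<close>; this
        multiplies the number of points by \<open>card D\<close> at the price of the finer
        separation \<open>U\<close>.\<close>
      define S' where "S' = (\<lambda>(s, x). h s + x) ` (S \<times> D)"
      have sub: "S' \<subseteq> msum (n + r)"
        using h r msum_add by (auto simp: S'_def)
      have eq: "s = s' \<and> x = x'"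
        if "s \<in> S" "s' \<in> S" "x \<in> D" "x' \<in> D" "(h s + x) - (h s' + x') \<in> U" for s s' x x'
      proof -
        have z: "nmult k x = 0" "nmult k x' = 0" using that D by auto
        have "nmult k ((h s + x) - (h s' + x')) = s - s'"
          using that h(2) by (simp add: nmult_diff_right nmult_add_right z)
        then have "s - s' \<in> V" using that(5) by (metis IntD1 U_def vimageE)
        then have "s = s'" using S(2) that unfolding separated_def by blast
        then have "x - x' \<in> V" using that(5) by (simp add: U_def)
        then have "x - x' = 0"
          by (rule torsion_V) (simp add: nmult_diff_right z)
        then show ?thesis using \<open>s = s'\<close> by simp
      qed
      have "inj_on (\<lambda>(s, x). h s + x) (S \<times> D)"
        using eq U(2) by (auto simp: inj_on_def)
      then have card: "card S' = c n * card D"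
        unfolding S'_def using S(3) by (simp add: card_image card_cartesian_product)
      have "separated U S'"
        unfolding separated_def
      proof (intro ballI impI)
        fix a b assume ab: "a \<in> S'" "b \<in> S'" "a \<noteq> b"
        then obtain s x s' x' where "s \<in> S" "x \<in> D" "a = h s + x" "s' \<in> S" "x' \<in> D" "b = h s' + x'"
          by (auto simp: S'_def)
        then show "a - b \<notin> U" using eq[of s s' x x'] ab(3) by metis
      qed
      \<comment> \<open>A maximal \<open>V\<close>-separated subset has at most
        \<open>c (n + r)\<close> points, and each point of \<open>S'\<close> is within
        \<open>?C\<close> of one of them. At most \<open>C\<close> points of \<open>S'\<close> lie
        near any one, which compares the two scales of separation.\<close>
      obtain T where T: "T \<subseteq> S'" "separated V T" "\<And>T'. T' \<subseteq> S' \<Longrightarrow> separated V T' \<Longrightarrow> T \<subseteq> T' \<Longrightarrow> T' = T"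
      proof -
        have "finite S" using M S by blast
        then have "finite S'" using D by (simp add: S'_def)
        then have "finite {T. T \<subseteq> S' \<and> separated V T}" by auto
        moreover have "{} \<in> {T. T \<subseteq> S' \<and> separated V T}" by (auto simp: separated_def)
        ultimately obtain T where "T \<in> {T. T \<subseteq> S' \<and> separated V T}"
          "\<forall>T'\<in>{T. T \<subseteq> S' \<and> separated V T}. T \<subseteq> T' \<longrightarrow> T = T'"
          using finite_has_maximal2[of "{T. T \<subseteq> S' \<and> separated V T}" "{}"] by blast
        then show thesis by (intro that[of T]) auto
      qed
      have finT: "finite T" using M[of T "n + r"] T sub by blast
      have cover: "\<exists>t\<in>T. y - t \<in> ?C" if y: "y \<in> S'" for y
      proof (cases "y \<in> T")
        case True
        then show ?thesis using zero_K by (intro bexI[of _ y]) auto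
      next
        case False
        then have "\<not> separated V (insert y T)" using T y by blast
        then obtain t where t: "t \<in> T" "y - t \<in> V \<or> t - y \<in> V"
          using T(2) unfolding separated_def by blast
        then have "y - t \<in> K \<or> - (t - y) \<in> uminus ` K" using V_K by blast
        then show ?thesis using t(1) by auto
      qed
      define P where "P t = {y \<in> S'. y - t \<in> ?C}" for t
      have P: "finite (P t) \<and> card (P t) \<le> C" for t
      proof (rule C[of "P t" t])
        show "separated U (P t)"
          by (rule separated_subset[OF \<open>separated U S'\<close>]) (auto simp: P_def)
      qed (simp add: P_def)
      have "S' = (\<Union>t\<in>T. P t)" using cover by (auto simp: P_def)
      then have "card S' \<le> (\<Sum>t\<in>T. card (P t))"
        using card_UN_le[OF finT, of P] by simp
      also have "\<dots> \<le> (\<Sum>t\<in>T. C)" using P by (intro sum_mono) auto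
      also have "\<dots> = card T * C" by simp
      also have "\<dots> \<le> c (n + r) * C"
        using c_ge[of T "n + r"] T sub by (intro mult_right_mono) auto
      finally show ?thesis using card by (simp add: mult.commute)
    qed
    have "4 ^ j \<le> c (j * r)" for j
    proof (induction j)
      case 0
      then show ?case using c0 by simp
    next
      case (Suc j)
      have "C * (4 * c (j * r)) \<le> card D * c (j * r)"
        using mult_le_mono1[of "4 * C" "card D" "c (j * r)"] N by (simp add: ac_simps)
      also have "\<dots> \<le> C * c (j * r + r)" by (rule key)
      finally have "4 * c (j * r) \<le> c (j * r + r)" using C1 by simp
      then show ?case using Suc by (simp add: add.commute)
    qed
    moreover have "c n \<le> M * (n + 1) ^ d" for n
      using c_ex[of n] M by metis
    ultimately have "4 ^ j \<le> M * (j * r + 1) ^ d" for j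
      using order_trans by blast
    then have "4 ^ j \<le> real M * (real j * real r + 1) ^ d" for j
      by (metis (mono_tags) of_nat_1 of_nat_add of_nat_le_iff of_nat_mult of_nat_numeral of_nat_power)
    then show False
      using polynomial_less_exponential[of "real r" M d] by (metis not_le of_nat_0_le_iff)
  qed
  show ?thesis
    using finite_if_finite_subsets_card_bdd[of ?T "4 * C"] bound by blast
qed

end

section \<open>Arrangements with a rank function\<close>

text \<open>Criterion for computing chain lengths: strict growth of \<open>f\<close> bounds every
  chain below \<open>x\<close> by \<open>f x + 1\<close> elements, and descending by one until
  \<open>f\<close> is 0 produces a chain of that size.\<close>

lemma rank_of_eqI:
  assumes fin: "finite (elts P)"
    and reflP: "\<And>y. y \<in> elts P \<Longrightarrow> le P y y"
    and transP: "\<And>x y z. x \<in> elts P \<Longrightarrow> y \<in> elts P \<Longrightarrow> z \<in> elts P \<Longrightarrow> le P x y \<Longrightarrow> le P y z \<Longrightarrow> le P x z"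
    and strict: "\<And>y z. y \<in> elts P \<Longrightarrow> z \<in> elts P \<Longrightarrow> le P y z \<Longrightarrow> y \<noteq> z \<Longrightarrow> f y < f z"
    and step: "\<And>y. y \<in> elts P \<Longrightarrow> f y > 0 \<Longrightarrow> \<exists>z\<in>elts P. le P z y \<and> Suc (f z) = f y"
    and x: "x \<in> elts P"
  shows "rank_of P x = f x"
proof -
  have ex: "\<exists>C. C \<subseteq> elts (lower P y) \<and> Complete_Partial_Order.chain (le P) C \<and> card C = Suc n"
    if "y \<in> elts P" "f y = n" for n y
    using that
  proof (induction n arbitrary: y)
    case 0
    then show ?case
      using reflP by (intro exI[of _ "{y}"]) (auto simp: lower_def chain_def)
  next
    case (Suc n)
    then obtain z where z: "z \<in> elts P" "le P z y" "Suc (f z) = f y" using step by force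
    then obtain C where C: "C \<subseteq> elts (lower P z)" "Complete_Partial_Order.chain (le P) C"
      "card C = Suc n"
      using Suc by auto
    have Cz: "c \<in> elts P \<and> le P c z" if "c \<in> C" for c using C(1) that by (auto simp: lower_def)
    have "y \<notin> C"
    proof
      assume "y \<in> C"
      then have "le P y z" using Cz by blast
      then show False using strict[of y z] z Suc.prems by (cases "y = z") auto
    qed
    moreover have "finite C" using C(3) by (metis card.infinite nat.distinct(1))
    ultimately have "card (insert y C) = Suc (Suc n)" using C(3) by simp
    moreover have Cy: "c \<in> elts P \<and> le P c y" if "c \<in> C" for c
      using Cz[OF that] transP[of c z y] z(1,2) Suc.prems(1) by blast
    then have "insert y C \<subseteq> elts (lower P y)"
      using Suc.prems(1) reflP[of y] by (auto simp: lower_def)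
    moreover have "Complete_Partial_Order.chain (le P) (insert y C)"
      using C(2) Cy Suc.prems(1) reflP[of y] by (auto simp: chain_def)
    ultimately show ?case by blast
  qed
  have "card C \<le> Suc (f x)"
    if C: "C \<subseteq> elts (lower P x)" "Complete_Partial_Order.chain (le P) C" for C
  proof -
    have Cx: "c \<in> elts P \<and> le P c x" if "c \<in> C" for c using C(1) that by (auto simp: lower_def)
    have "inj_on f C"
      using C(2) Cx strict unfolding inj_on_def chain_def by (metis less_irrefl)
    moreover have "f ` C \<subseteq> {..f x}"
      using Cx strict x by (auto simp: less_imp_le) (metis le_eq_less_or_eq order_refl)
    ultimately have "card C \<le> card {..f x}" by (intro card_inj_on_le) auto
    then show ?thesis by simp
  qed
  then have le: "n \<le> Suc (f x)"
    if "n \<in> card ` {C. C \<subseteq> elts (lower P x) \<and> Complete_Partial_Order.chain (le P) C}" for n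
    using that by auto
  obtain C where "C \<subseteq> elts (lower P x)" "Complete_Partial_Order.chain (le P) C" "card C = Suc (f x)"
    using ex[OF x refl] by blast
  then have "Suc (f x) \<in> card ` {C. C \<subseteq> elts (lower P x) \<and> Complete_Partial_Order.chain (le P) C}"
    by (intro image_eqI[of _ _ C]) auto
  moreover have "finite (card ` {C. C \<subseteq> elts (lower P x) \<and> Complete_Partial_Order.chain (le P) C})"
    using fin by (auto simp: lower_def)
  ultimately have "Max (card ` {C. C \<subseteq> elts (lower P x) \<and> Complete_Partial_Order.chain (le P) C}) = Suc (f x)"
    using le by (intro Max_eqI)
  then show ?thesis by (simp add: rank_of_def)
qed

text \<open>Injectivity is free: two elements with the same image are comparable both ways.\<close>

lemma poset_isoI:
  assumes "F ` elts P = elts Q"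
    and "\<And>x y. x \<in> elts P \<Longrightarrow> y \<in> elts P \<Longrightarrow> le P x y \<longleftrightarrow> le Q (F x) (F y)"
    and "\<And>x y. x \<in> elts P \<Longrightarrow> y \<in> elts P \<Longrightarrow> le P x y \<Longrightarrow> le P y x \<Longrightarrow> x = y"
    and "\<And>z. z \<in> elts Q \<Longrightarrow> le Q z z"
  shows "poset_iso P Q F"
proof -
  have "inj_on F (elts P)"
  proof (rule inj_onI)
    fix x y assume *: "x \<in> elts P" "y \<in> elts P" "F x = F y"
    have "le Q (F x) (F x)" using assms(1,4) *(1) by blast
    then show "x = y" using *(3) by (intro assms(3) *(1,2)) (simp_all add: assms(2) *)
  qed
  then show ?thesis using assms(1,2) by (simp add: poset_iso_def bij_betw_def)
qed

text \<open>The interface between group theory and combinatorics. The conditions on \<open>r\<close>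
  alone are those of a matroid rank function, \<open>r_closed\<close> being diminishing returns in
  unit steps. \<open>component_rank\<close> makes the rank strict on layers, and
  \<open>component_meets\<close> is the geometric content of axiom (M5).\<close>

locale ranked_arrangement =
  fixes A :: "('i, 'p::topological_space) arrangement" and r :: "'i set \<Rightarrow> nat"
  assumes finite_idx: "finite (idx A)"
    and space_connected: "connected (space A)" and space_nonempty: "space A \<noteq> {}"
    and mem_connected: "\<And>i. i \<in> idx A \<Longrightarrow> connected (mem A i)"
    and mem_nonempty: "\<And>i. i \<in> idx A \<Longrightarrow> mem A i \<noteq> {}"
    and mem_space: "\<And>i. i \<in> idx A \<Longrightarrow> mem A i \<subseteq> space A"
    and r_empty: "r {} = 0"
    and r_insert: "\<And>B i. B \<subseteq> idx A \<Longrightarrow> i \<in> idx A \<Longrightarrow> r (insert i B) = r B \<or> r (insert i B) = Suc (r B)"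
    and r_closed: "\<And>B C i. B \<subseteq> C \<Longrightarrow> C \<subseteq> idx A \<Longrightarrow> i \<in> idx A \<Longrightarrow> r (insert i B) = r B \<Longrightarrow>
      r (insert i C) = r C"
    and finite_components: "\<And>B. B \<subseteq> idx A \<Longrightarrow> finite (components (intersection A B))"
    and component_rank: "\<And>B C X Y. B \<subseteq> idx A \<Longrightarrow> C \<subseteq> idx A \<Longrightarrow>
      X \<in> components (intersection A B) \<Longrightarrow> Y \<in> components (intersection A C) \<Longrightarrow> X \<subseteq> Y \<Longrightarrow>
      r C \<le> r B \<and> (r B = r C \<longrightarrow> X = Y)"
    and component_meets: "\<And>B i X. B \<subseteq> idx A \<Longrightarrow> i \<in> idx A \<Longrightarrow>
      X \<in> components (intersection A B) \<Longrightarrow> r (insert i B) \<noteq> r B \<Longrightarrow> X \<inter> mem A i \<noteq> {}"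
begin

abbreviation "I \<equiv> idx A"
abbreviation "comps B \<equiv> components (intersection A B)"
abbreviation "M \<equiv> arr_scheme A"
abbreviation "flat X \<equiv> {i \<in> I. X \<subseteq> mem A i}"

section \<open>Matroid rank inequalities\<close>

lemma finite_subset_I: "B \<subseteq> I \<Longrightarrow> finite B"
  using finite_idx finite_subset by blast

lemma r_le_insert: "B \<subseteq> I \<Longrightarrow> i \<in> I \<Longrightarrow> r B \<le> r (insert i B)"
  using r_insert[of B i] by linarith

lemma r_mono:
  assumes "B \<subseteq> C" "C \<subseteq> I"
  shows "r B \<le> r C"
proof -
  have "r B \<le> r (B \<union> D)" if "finite D" "D \<subseteq> I" for D
    using that
  proof (induction D rule: finite_induct)
    case (insert i D)
    then show ?case using r_le_insert[of "B \<union> D" i] assms by force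
  qed simp
  from this[of C] show ?thesis using assms finite_subset_I by (simp add: Un_absorb1)
qed

lemma r_Un_eq:
  assumes "B \<subseteq> I" "C \<subseteq> I" "\<And>i. i \<in> C \<Longrightarrow> r (insert i B) = r B"
  shows "r (B \<union> C) = r B"
proof -
  have "r (B \<union> D) = r B" if "finite D" "D \<subseteq> C" for D
    using that
  proof (induction D rule: finite_induct)
    case (insert i D)
    then have "r (insert i (B \<union> D)) = r (B \<union> D)"
      using assms by (intro r_closed[of B "B \<union> D"]) auto
    then show ?case using insert by simp
  qed simp
  from this[of C] show ?thesis using assms(2) finite_subset_I by simp
qed

lemma r_le_card: "B \<subseteq> I \<Longrightarrow> r B \<le> card B"
proof -
  assume "B \<subseteq> I"
  with finite_subset_I[OF this] show ?thesis
  proof (induction B rule: finite_induct)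
    case (insert i B)
    then show ?case using r_insert[of B i] by auto
  qed (simp add: r_empty)
qed

text \<open>The elements of \<open>B\<close> are added one at a time to both \<open>C\<close> and
  \<open>B \<inter> C\<close>. By \<open>r_closed\<close> an element that raises the rank of the
  larger set also raises that of the smaller one.\<close>

lemma r_submodular:
  assumes "B \<subseteq> I" "C \<subseteq> I"
  shows "r (B \<union> C) + r (B \<inter> C) \<le> r B + r C"
proof -
  have "r (C \<union> D) + r (B \<inter> C) \<le> r (B \<inter> C \<union> D) + r C" if "finite D" "D \<subseteq> B" for D
    using that
  proof (induction D rule: finite_induct)
    case (insert i D)
    then have i: "i \<in> I" "D \<subseteq> I" using assms by auto
    have eq: "C \<union> insert i D = insert i (C \<union> D)" "B \<inter> C \<union> insert i D = insert i (B \<inter> C \<union> D)"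
      using insert by auto
    have "B \<inter> C \<union> D \<subseteq> C \<union> D" "C \<union> D \<subseteq> I" "B \<inter> C \<union> D \<subseteq> I" using assms i by auto
    then show ?case
      unfolding eq using insert r_closed[of "B \<inter> C \<union> D" "C \<union> D" i] r_insert[of "C \<union> D" i]
        r_insert[of "B \<inter> C \<union> D" i] i by auto
  qed simp
  from this[of B] show ?thesis
    using assms finite_subset_I by (simp add: Un_commute Int_absorb1 sup.absorb2)
qed

text \<open>Take a minimal set between \<open>C\<close> and \<open>B\<close> of full rank; dropping
  one of its elements outside \<open>C\<close> lowers the rank by exactly one. Keeping
  \<open>C\<close> inside is what the restriction needs, with \<open>C = {i0}\<close>.\<close>

lemma r_pred:
  assumes "B \<subseteq> I" "r C < r B" "C \<subseteq> B"
  shows "\<exists>D. C \<subseteq> D \<and> D \<subseteq> B \<and> Suc (r D) = r B"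
proof -
  let ?S = "{D. C \<subseteq> D \<and> D \<subseteq> B \<and> r D = r B}"
  have "finite ?S" using finite_subset_I[OF assms(1)] by auto
  moreover have "B \<in> ?S" using assms by auto
  ultimately have "\<exists>D\<in>?S. D \<subseteq> B \<and> (\<forall>E\<in>?S. E \<subseteq> D \<longrightarrow> D = E)"
    by (rule finite_has_minimal2)
  then obtain D where D: "D \<in> ?S" "\<forall>E\<in>?S. E \<subseteq> D \<longrightarrow> D = E" by auto
  have "D \<noteq> C" using D assms by auto
  then obtain i where i: "i \<in> D" "i \<notin> C" using D(1) by blast
  have "r (D - {i}) \<noteq> r B"
  proof
    assume "r (D - {i}) = r B"
    then have "D - {i} \<in> ?S" using D(1) i by auto
    then have "D = D - {i}" using D(2) by blast
    then show False using i by blast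
  qed
  moreover have "insert i (D - {i}) = D" using i(1) by (rule insert_Diff)
  moreover have "D \<subseteq> B" using D(1) by simp
  then have "D - {i} \<subseteq> I" "i \<in> I" using assms(1) i(1) by auto
  ultimately have "Suc (r (D - {i})) = r B" using r_insert[of "D - {i}" i] D(1) by auto
  then show ?thesis using D(1) i by (intro exI[of _ "D - {i}"]) auto
qed

section \<open>Components of nested intersections\<close>

lemma intersection_mono: "B \<subseteq> C \<Longrightarrow> intersection A C \<subseteq> intersection A B"
  by (auto simp: intersection_def)

lemma component_above:
  assumes "X \<in> comps B" "C \<subseteq> B"
  shows "\<exists>Y\<in>comps C. X \<subseteq> Y"
proof -
  have "X \<subseteq> intersection A C" "X \<noteq> {}" "connected X"
    using assms intersection_mono[of C B] in_components_subset in_components_nonempty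
      in_components_connected by blast+
  then show ?thesis using exists_component_superset[of X "intersection A C"] by blast
qed

text \<open>One common point decides containment: \<open>X\<close> is connected and lies in the
  larger intersection, so it lies in any component there that it touches.\<close>

lemma component_absorb:
  assumes "Y \<in> comps C" "Z \<subseteq> X" "Z \<noteq> {}" "Z \<subseteq> Y" "X \<in> comps B" "C \<subseteq> B"
  shows "X \<subseteq> Y"
proof (rule components_maximal[OF assms(1)])
  show "connected X" using assms in_components_connected by blast
  show "X \<subseteq> intersection A C"
    using assms(5,6) intersection_mono[of C B] in_components_subset by blast
  show "Y \<inter> X \<noteq> {}" using assms by blast
qed

text \<open>Adding all members that contain \<open>X\<close> shrinks the intersection but still
  leaves \<open>X\<close> inside, so \<open>X\<close> remains a component. The ranks agree by
  comparing \<open>X\<close> with itself in both directions.\<close>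

lemma component_flat:
  assumes "X \<in> comps B" "B \<subseteq> I"
  shows "B \<subseteq> flat X" "X \<in> comps (flat X)" "r (flat X) = r B"
proof -
  have X: "X \<subseteq> intersection A B" "X \<noteq> {}" "connected X"
    using assms in_components_subset in_components_nonempty in_components_connected by blast+
  then show B: "B \<subseteq> flat X" using assms by (auto simp: intersection_def)
  have "X \<subseteq> intersection A (flat X)" using X by (auto simp: intersection_def)
  then obtain Y where Y: "Y \<in> comps (flat X)" "X \<subseteq> Y"
    using exists_component_superset[of X "intersection A (flat X)"] X by blast
  then have "Y \<subseteq> X" using component_absorb[OF assms(1) Y(2) X(2) _ Y(1) B] by blast
  then show "X \<in> comps (flat X)" using Y by auto
  then show "r (flat X) = r B"
    using component_rank[of "flat X" B X X] component_rank[of B "flat X" X X] assms by auto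
qed

lemma layers_elts: "X \<in> elts (layers A) \<longleftrightarrow> (\<exists>B\<subseteq>I. X \<in> comps B)"
  by (auto simp: layers_def)

lemma finite_layers: "finite (elts (layers A))"
  using finite_idx finite_components by (auto simp: layers_def)

lemma layers_le [simp]: "le (layers A) X Y \<longleftrightarrow> Y \<subseteq> X"
  by (simp add: layers_def)

text \<open>Turns chain lengths into matroid rank. The function \<open>r (flat X)\<close> is strict
  by \<open>component_rank\<close>; a step down omits indices by \<open>r_pred\<close> and passes to
  the component above.\<close>

lemma rank_of_layer:
  assumes "B \<subseteq> I" "X \<in> comps B"
  shows "rank_of (layers A) X = r B"
proof -
  have "rank_of (layers A) X = r (flat X)"
  proof (rule rank_of_eqI[where f = "\<lambda>X. r (flat X)"])
    fix Y Z assume YZ: "Y \<in> elts (layers A)" "Z \<in> elts (layers A)" "le (layers A) Y Z" "Y \<noteq> Z"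
    then have "Y \<in> comps (flat Y)" "Z \<in> comps (flat Z)"
      using component_flat by (auto simp: layers_elts)
    then have "r (flat Y) \<le> r (flat Z) \<and> (r (flat Z) = r (flat Y) \<longrightarrow> Z = Y)"
      using YZ by (intro component_rank) auto
    then show "r (flat Y) < r (flat Z)" using YZ by auto
  next
    fix Y assume Y: "Y \<in> elts (layers A)" "r (flat Y) > 0"
    then have Yc: "Y \<in> comps (flat Y)" using component_flat by (auto simp: layers_elts)
    have "r {} < r (flat Y)" using Y r_empty by simp
    then obtain D where D: "D \<subseteq> flat Y" "Suc (r D) = r (flat Y)"
      using r_pred[of "flat Y" "{}"] by auto
    then obtain Z where Z: "Z \<in> comps D" "Y \<subseteq> Z" using component_above Yc by blast
    moreover have "D \<subseteq> I" using D by blast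
    ultimately show "\<exists>Z\<in>elts (layers A). le (layers A) Z Y \<and> Suc (r (flat Z)) = r (flat Y)"
      using D component_flat(3)[of Z D] by (intro bexI[of _ Z]) (auto simp: layers_elts)
  qed (use finite_layers assms layers_elts in auto)
  then show ?thesis using component_flat assms by simp
qed

section \<open>The simplicial poset of an arrangement\<close>

lemma elts_M [simp]: "(B, X) \<in> elts M \<longleftrightarrow> B \<subseteq> I \<and> X \<in> comps B"
  by (simp add: arr_scheme_def)

lemma le_M [simp]: "le M (B, X) (C, Y) \<longleftrightarrow> B \<subseteq> C \<and> Y \<subseteq> X"
  by (simp add: arr_scheme_def)

lemma le_M_trans: "le M x y \<Longrightarrow> le M y z \<Longrightarrow> le M x z"
  by (cases x; cases y; cases z) auto

lemma le_M_antisym: "le M x y \<Longrightarrow> le M y x \<Longrightarrow> x = y"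
  by (cases x; cases y) auto

lemma rho_M: "B \<subseteq> I \<Longrightarrow> X \<in> comps B \<Longrightarrow> rho M (B, X) = r B"
  by (simp add: arr_scheme_def rank_of_layer)

lemma finite_M: "finite (elts M)"
proof (rule finite_subset)
  show "elts M \<subseteq> Pow I \<times> (\<Union>B\<in>Pow I. comps B)" by (auto simp: arr_scheme_def)
  show "finite (Pow I \<times> (\<Union>B\<in>Pow I. comps B))"
    using finite_idx finite_components by auto
qed

lemma is_poset_M: "is_poset M"
  unfolding is_poset_def partial_order_on_def preorder_on_def
  by (auto simp: refl_on_def trans_def antisym_def)

lemma component_unique: "X \<in> comps B \<Longrightarrow> Y \<in> comps B \<Longrightarrow> Z \<noteq> {} \<Longrightarrow> Z \<subseteq> X \<Longrightarrow> Z \<subseteq> Y \<Longrightarrow> X = Y"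
  using components_eq by blast

lemma comps_empty: "comps {} = {space A}"
proof -
  have "intersection A {} = space A" by (simp add: intersection_def)
  moreover have "components (space A) = {space A}"
    using space_connected space_nonempty by (simp add: components_eq_sing_iff)
  ultimately show ?thesis by simp
qed

lemma comps_single: "i \<in> I \<Longrightarrow> comps {i} = {mem A i}"
proof -
  assume i: "i \<in> I"
  have "intersection A {i} = mem A i" using mem_space[OF i] by (auto simp: intersection_def)
  moreover have "components (mem A i) = {mem A i}"
    using mem_connected[OF i] mem_nonempty[OF i] by (simp add: components_eq_sing_iff)
  ultimately show ?thesis by simp
qed

text \<open>Two comparable pairs with the same index set have the same component, so going up
  strictly always adds indices, and indices can be removed one at a time.\<close>

lemma rank_of_M:
  assumes "B \<subseteq> I" "X \<in> comps B"
  shows "rank_of M (B, X) = card B"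
proof -
  have "rank_of M (B, X) = (card \<circ> fst) (B, X)"
  proof (rule rank_of_eqI)
    fix y z assume *: "y \<in> elts M" "z \<in> elts M" "le M y z" "y \<noteq> z"
    obtain B X C Y where yz: "y = (B, X)" "z = (C, Y)" by (metis surj_pair)
    have "B \<noteq> C"
    proof
      assume "B = C"
      then have "X = Y" using component_unique[of X B Y Y] * yz in_components_nonempty by auto
      then show False using * yz \<open>B = C\<close> by simp
    qed
    then have "B \<subset> C" using * yz by auto
    then show "(card \<circ> fst) y < (card \<circ> fst) z"
      using * yz finite_subset_I psubset_card_mono by auto
  next
    fix y assume y: "y \<in> elts M" "(card \<circ> fst) y > 0"
    obtain B X where BX: "y = (B, X)" by (metis surj_pair)
    then have "B \<subseteq> I" "X \<in> comps B" "card B > 0" using y by auto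
    moreover then obtain i where i: "i \<in> B" by fastforce
    ultimately obtain Y where "Y \<in> comps (B - {i})" "X \<subseteq> Y"
      using component_above[of X B "B - {i}"] by auto
    moreover have "Suc (card (B - {i})) = card B"
      using i \<open>B \<subseteq> I\<close> finite_subset_I card.remove by (metis)
    ultimately show "\<exists>z\<in>elts M. le M z y \<and> Suc ((card \<circ> fst) z) = (card \<circ> fst) y"
      using BX \<open>B \<subseteq> I\<close> by (intro bexI[of _ "(B - {i}, Y)"]) auto
  next
    show "le M x z" if "le M x y" "le M y z" for x y z using that by (rule le_M_trans)
    show "le M y y" for y by (cases y) simp
    show "(B, X) \<in> elts M" using assms by simp
  qed (rule finite_M)
  then show ?thesis by simp
qed

lemma least_M: "least_elt M z \<longleftrightarrow> z = ({}, space A)"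
proof -
  have l: "least_elt M ({}, space A)"
    using comps_empty in_components_subset by (fastforce simp: least_elt_def intersection_def)
  have "z = ({}, space A)" if "least_elt M z"
  proof -
    obtain B X where z: "z = (B, X)" by (metis surj_pair)
    have "le M z ({}, space A)" using that l by (auto simp: least_elt_def)
    then show ?thesis using that comps_empty by (auto simp: z least_elt_def)
  qed
  then show ?thesis using l by blast
qed

text \<open>For any new index \<open>i\<close> there is an intermediate pair over
  \<open>insert i B\<close>, which the covering relation forces to be the upper one.\<close>

lemma covers_M_card:
  assumes "covers M (B, X) (C, Y)"
  shows "\<exists>i. i \<notin> B \<and> C = insert i B"
proof -
  have a: "B \<subseteq> I" "X \<in> comps B" "C \<subseteq> I" "Y \<in> comps C" "B \<subseteq> C" "Y \<subseteq> X" "(B, X) \<noteq> (C, Y)"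
    and max: "\<And>z. z \<in> elts M \<Longrightarrow> le M (B, X) z \<Longrightarrow> le M z (C, Y) \<Longrightarrow> z = (B, X) \<or> z = (C, Y)"
    using assms unfolding covers_def by simp_all
  have Yne: "Y \<noteq> {}" using a in_components_nonempty by blast
  have "B \<noteq> C" using component_unique[of X B Y Y] a Yne by blast
  then obtain i where i: "i \<in> C" "i \<notin> B" using a by blast
  obtain Z where Z: "Z \<in> comps (insert i B)" "Y \<subseteq> Z"
    using component_above[OF a(4), of "insert i B"] i a by blast
  have "Z \<subseteq> X" using component_absorb[OF a(2) Z(2) Yne a(6) Z(1)] by blast
  then have "(insert i B, Z) = (B, X) \<or> (insert i B, Z) = (C, Y)"
    using a i Z by (intro max) auto
  then show ?thesis using i by blast
qed

lemma ranked_M: "ranked M"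
  unfolding ranked_def
proof (intro allI impI)
  fix x y assume c: "covers M x y"
  obtain B X C Y where xy: "x = (B, X)" "y = (C, Y)" by (metis surj_pair)
  then obtain i where "i \<notin> B" "C = insert i B" using covers_M_card c by blast
  moreover have "x \<in> elts M" "y \<in> elts M" using c by (auto simp: covers_def)
  ultimately show "rank_of M y = rank_of M x + 1"
    using xy finite_subset_I by (simp add: rank_of_M)
qed

lemma atom_M: "atom M a \<longleftrightarrow> (\<exists>i\<in>I. a = arr_atom A i)"
proof
  assume "atom M a"
  moreover obtain B X where a: "a = (B, X)" by (metis surj_pair)
  ultimately have c: "covers M ({}, space A) (B, X)" by (auto simp: atom_def least_M)
  then obtain i where i: "B = {i}" using covers_M_card by blast
  have "B \<subseteq> I" "X \<in> comps B" using c by (auto simp: covers_def)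
  then show "\<exists>i\<in>I. a = arr_atom A i"
    using i a comps_single by (auto simp: arr_atom_def)
next
  assume "\<exists>i\<in>I. a = arr_atom A i"
  then obtain i where i: "i \<in> I" "a = ({i}, mem A i)" by (auto simp: arr_atom_def)
  have "z = ({}, space A) \<or> z = ({i}, mem A i)"
    if z: "z \<in> elts M" "le M z ({i}, mem A i)" for z
  proof -
    obtain B X where BX: "z = (B, X)" by (metis surj_pair)
    then have "B = {} \<or> B = {i}" using z by auto
    then show ?thesis using z BX i comps_empty comps_single by auto
  qed
  then have "covers M ({}, space A) ({i}, mem A i)"
    using i comps_empty comps_single mem_space by (auto simp: covers_def)
  then show "atom M a" using i by (auto simp: atom_def least_M)
qed

text \<open>For \<open>C \<subseteq> B\<close> exactly one component of the intersection over
  \<open>C\<close> contains \<open>X\<close>, so the interval is the power set of \<open>B\<close>.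
  Passing to atoms is injective even when members coincide as sets, since an atom records its
  index.\<close>

lemma boolean_lower:
  assumes "B \<subseteq> I" "X \<in> comps B"
  shows "poset_iso (lower M (B, X)) (boolean_lattice {a. atom M a \<and> le M a (B, X)})
    (\<lambda>y. arr_atom A ` fst y)"
proof -
  have Xne: "X \<noteq> {}" using assms in_components_nonempty by blast
  have Xm: "X \<subseteq> mem A i" if "i \<in> B" for i
    using in_components_subset[OF assms(2)] that by (auto simp: intersection_def)
  have at: "{a. atom M a \<and> le M a (B, X)} = arr_atom A ` B"
  proof
    show "{a. atom M a \<and> le M a (B, X)} \<subseteq> arr_atom A ` B"
      by (auto simp: atom_M) (auto simp: arr_atom_def)
    show "arr_atom A ` B \<subseteq> {a. atom M a \<and> le M a (B, X)}"
    proof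
      fix a assume "a \<in> arr_atom A ` B"
      then obtain i where i: "i \<in> B" "a = arr_atom A i" by blast
      then have "atom M a" using assms atom_M by blast
      moreover have "le M a (B, X)"
        using i Xm by (simp add: arr_atom_def subset_iff)
      ultimately show "a \<in> {a. atom M a \<and> le M a (B, X)}" by simp
    qed
  qed
  have inj: "inj (arr_atom A)" by (auto simp: inj_on_def arr_atom_def)
  have img: "arr_atom A ` C \<subseteq> arr_atom A ` D \<longleftrightarrow> C \<subseteq> D" for C D
    using inj by (simp add: inj_image_subset_iff)
  have low: "(C, Y) \<in> elts (lower M (B, X)) \<longleftrightarrow> C \<subseteq> B \<and> Y \<in> comps C \<and> X \<subseteq> Y" for C Y
    using assms by (auto simp: lower_def)
  have le: "le M (C, Y) (D, Z) \<longleftrightarrow> C \<subseteq> D"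
    if "(C, Y) \<in> elts (lower M (B, X))" "(D, Z) \<in> elts (lower M (B, X))" for C Y D Z
    using that component_absorb[of Y C X Z D] Xne by (auto simp: low)
  show ?thesis
    unfolding at
  proof (rule poset_isoI)
    show "(\<lambda>y. arr_atom A ` fst y) ` elts (lower M (B, X)) = elts (boolean_lattice (arr_atom A ` B))"
    proof (intro equalityI subsetI)
      fix w assume "w \<in> (\<lambda>y. arr_atom A ` fst y) ` elts (lower M (B, X))"
      then obtain C Y where "(C, Y) \<in> elts (lower M (B, X))" "w = arr_atom A ` C" by force
      then show "w \<in> elts (boolean_lattice (arr_atom A ` B))"
        using low by (simp add: boolean_lattice_def image_mono)
    next
      fix w assume "w \<in> elts (boolean_lattice (arr_atom A ` B))"
      then obtain C where C: "C \<subseteq> B" "w = arr_atom A ` C"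
        by (auto simp: boolean_lattice_def subset_image_iff)
      then obtain Y where "Y \<in> comps C" "X \<subseteq> Y" using component_above assms by blast
      then show "w \<in> (\<lambda>y. arr_atom A ` fst y) ` elts (lower M (B, X))"
        using C low by (intro image_eqI[of _ _ "(C, Y)"]) auto
    qed
  next
    fix y z assume yz: "y \<in> elts (lower M (B, X))" "z \<in> elts (lower M (B, X))"
    obtain C Y D Z where eq: "y = (C, Y)" "z = (D, Z)" by (metis surj_pair)
    show "le (lower M (B, X)) y z \<longleftrightarrow>
        le (boolean_lattice (arr_atom A ` B)) (arr_atom A ` fst y) (arr_atom A ` fst z)"
      using le[of C Y D Z] yz eq img[of C D] by (simp add: boolean_lattice_def lower_def)
    show "y = z" if "le (lower M (B, X)) y z" "le (lower M (B, X)) z y"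
      using that le_M_antisym by (simp add: lower_def)
  qed (simp add: boolean_lattice_def)
qed

lemma simplicial_M: "finite_simplicial_poset M"
  unfolding finite_simplicial_poset_def
proof (intro conjI ballI)
  show "\<exists>!z. least_elt M z" by (simp add: least_M)
  fix x assume "x \<in> elts M"
  then show "\<exists>f. poset_iso (lower M x) (boolean_lattice {a. atom M a \<and> le M a x}) f"
    using boolean_lower[of "fst x" "snd x"] by (cases x) auto
qed (rule is_poset_M finite_M ranked_M)+

lemma joins_M:
  assumes "(B, X) \<in> elts M" "(C, Y) \<in> elts M" "Z \<in> comps (B \<union> C)" "Z \<subseteq> X" "Z \<subseteq> Y"
  shows "(B \<union> C, Z) \<in> joins M {(B, X), (C, Y)}"
proof -
  have "v = (B \<union> C, Z)"
    if v: "v \<in> elts M" "\<forall>t\<in>{(B, X), (C, Y)}. le M t v" "le M v (B \<union> C, Z)" for v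
  proof -
    obtain D V where v': "v = (D, V)" by (metis surj_pair)
    then have "D = B \<union> C" using v by auto
    moreover have "V = Z"
      using component_unique[of V D Z Z] v v' calculation assms in_components_nonempty[of Z] by auto
    ultimately show ?thesis using v' by simp
  qed
  then show ?thesis using assms by (auto simp: joins_def)
qed

lemma matroid_scheme_M: "matroid_scheme M"
  unfolding matroid_scheme_def
proof (intro conjI ballI impI)
  show "finite_simplicial_poset M" by (rule simplicial_M)
next
  fix x assume x: "x \<in> elts M"
  obtain B X where "x = (B, X)" by (metis surj_pair)
  then show "rho M x \<le> rank_of M x"
    using x r_le_card by (simp add: rank_of_M rho_M)
next
  fix x y assume xy: "x \<in> elts M" "y \<in> elts M" "le M x y"
  obtain B X C Y where "x = (B, X)" "y = (C, Y)" by (metis surj_pair)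
  then show "rho M x \<le> rho M y" using xy r_mono by (simp add: rho_M)
next
  fix x y u l assume *: "x \<in> elts M" "y \<in> elts M" "u \<in> joins M {x, y}" "l \<in> meets M {x, y}"
  obtain B X C Y where xy: "x = (B, X)" "y = (C, Y)" by (metis surj_pair)
  obtain D U E L where ul: "u = (D, U)" "l = (E, L)" by (metis surj_pair)
  have BX: "B \<subseteq> I" "X \<in> comps B" "C \<subseteq> I" "Y \<in> comps C" using * xy by auto
  have u: "D \<subseteq> I" "U \<in> comps D" "B \<subseteq> D" "C \<subseteq> D" "U \<subseteq> X" "U \<subseteq> Y"
    and umin: "\<And>v. v \<in> elts M \<Longrightarrow> le M x v \<Longrightarrow> le M y v \<Longrightarrow> le M v u \<Longrightarrow> v = u"
    using *(3) unfolding joins_def xy ul by auto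
  have l: "E \<subseteq> I" "L \<in> comps E" "E \<subseteq> B" "E \<subseteq> C" "X \<subseteq> L" "Y \<subseteq> L"
    and lmax: "\<And>v. v \<in> elts M \<Longrightarrow> le M v x \<Longrightarrow> le M v y \<Longrightarrow> le M l v \<Longrightarrow> v = l"
    using *(4) unfolding meets_def xy ul by auto
  have Une: "U \<noteq> {}" using u in_components_nonempty by blast
  \<comment> \<open>Axiom (M3). The component over \<open>B \<union> C\<close> around
    \<open>U\<close> is an upper bound below \<open>u\<close>, so minimality gives
    \<open>D = B \<union> C\<close>.\<close>
  obtain Z where Z: "Z \<in> comps (B \<union> C)" "U \<subseteq> Z" using component_above u by (metis Un_least)
  have "Z \<subseteq> X" "Z \<subseteq> Y"
    using component_absorb[OF BX(2) Z(2) Une u(5) Z(1)] component_absorb[OF BX(4) Z(2) Une u(6) Z(1)]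
    by auto
  with BX u Z have "(B \<union> C, Z) = u" by (intro umin) (simp_all add: xy ul)
  then have D: "D = B \<union> C" using ul by simp
  \<comment> \<open>Here the common upper bound matters: \<open>X\<close> and \<open>Y\<close> both
    contain \<open>U\<close>, hence lie in the same component over \<open>B \<inter> C\<close>.
    Maximality of \<open>l\<close> then gives \<open>E = B \<inter> C\<close>, and submodularity
    applies.\<close>
  obtain W where W: "W \<in> comps (B \<inter> C)" "X \<subseteq> W" using component_above[OF BX(2), of "B \<inter> C"] by blast
  have "Y \<subseteq> W" using component_absorb[OF W(1), of U Y C] Une u W BX by blast
  moreover have "W \<subseteq> L" using component_absorb[OF l(2), of U W "B \<inter> C"] Une u W l by blast
  ultimately have "(B \<inter> C, W) = l" using BX W l by (intro lmax) (simp_all add: xy ul le_infI1)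
  then have E: "E = B \<inter> C" using ul by simp
  show "rho M u + rho M l \<le> rho M x + rho M y"
    using r_submodular[OF BX(1,3)] BX u l by (simp add: xy ul rho_M D E)
next
  fix x y l assume *: "x \<in> elts M" "y \<in> elts M" "l \<in> meets M {x, y}" "rho M x = rho M l"
  obtain B X C Y where xy: "x = (B, X)" "y = (C, Y)" by (metis surj_pair)
  obtain E L where l': "l = (E, L)" by (metis surj_pair)
  have BX: "B \<subseteq> I" "X \<in> comps B" "C \<subseteq> I" "Y \<in> comps C" using * xy by auto
  have l: "E \<subseteq> I" "L \<in> comps E" "E \<subseteq> B" "E \<subseteq> C" "X \<subseteq> L" "Y \<subseteq> L"
    using *(3) unfolding meets_def xy l' by auto
  have "r B = r E" using * BX l by (simp add: xy l' rho_M)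
  \<comment> \<open>Axiom (M4). Equal rank makes \<open>X\<close> fill the component
    \<open>L\<close>, which contains \<open>Y\<close>; so \<open>Y\<close> itself lies in the
    intersection over \<open>B \<union> C\<close>.\<close>
  then have "X = L" using component_rank[OF BX(1) l(1) BX(2) l(2) l(5)] by blast
  then have "Y \<subseteq> X" using l by simp
  then have "Y \<subseteq> intersection A (B \<union> C)"
    using in_components_subset[OF BX(2)] in_components_subset[OF BX(4)]
    by (auto simp: intersection_def)
  moreover have "Y \<noteq> {}" "connected Y"
    using BX in_components_nonempty in_components_connected by blast+
  ultimately obtain Z where Z: "Z \<in> comps (B \<union> C)" "Y \<subseteq> Z"
    using exists_component_superset[of Y "intersection A (B \<union> C)"] by blast
  have "Z \<subseteq> X" "Z \<subseteq> Y"
    using component_absorb[OF BX(2), of Y Z "B \<union> C"] component_absorb[OF BX(4), of Y Z "B \<union> C"]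
      Z \<open>Y \<subseteq> X\<close> \<open>Y \<noteq> {}\<close> by blast+
  then show "joins M {x, y} \<noteq> {}"
    using joins_M[of B X C Y Z] * Z xy by auto
next
  fix x y assume *: "x \<in> elts M" "y \<in> elts M" "rho M x < rho M y"
  obtain B X C Y where xy: "x = (B, X)" "y = (C, Y)" by (metis surj_pair)
  have BX: "B \<subseteq> I" "X \<in> comps B" "C \<subseteq> I" "Y \<in> comps C" using * xy by auto
  have "r B < r C" using * BX by (simp add: xy rho_M)
  moreover have "r C \<le> r (B \<union> C)" using BX by (intro r_mono) auto
  ultimately have "r (B \<union> C) \<noteq> r B" by simp
  then obtain i where i: "i \<in> C" "r (insert i B) \<noteq> r B" using r_Un_eq BX by blast
  then have "i \<notin> B" by (auto simp: insert_absorb)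
  have iI: "i \<in> I" using i BX by blast
  obtain p where p: "p \<in> X" "p \<in> mem A i" using component_meets[OF BX(1) iI BX(2) i(2)] by blast
  have "{p} \<subseteq> intersection A (insert i B)"
    using p in_components_subset[OF BX(2)] by (auto simp: intersection_def)
  then obtain Z where Z: "Z \<in> comps (insert i B)" "{p} \<subseteq> Z"
    using exists_component_superset[of "{p}" "intersection A (insert i B)"] by auto
  have "Z \<subseteq> X" using component_absorb[OF BX(2), of "{p}" Z "insert i B"] p Z by blast
  moreover have "Z \<subseteq> mem A i"
    using in_components_subset[OF Z(1)] by (auto simp: intersection_def)
  ultimately have "(B \<union> {i}, Z) \<in> joins M {(B, X), ({i}, mem A i)}"
    using BX iI Z comps_single by (intro joins_M) auto
  moreover have "atom M (arr_atom A i)" using atom_M iI by blast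
  moreover have "Y \<subseteq> mem A i" using in_components_subset[OF BX(4)] i by (auto simp: intersection_def)
  then have "le M (arr_atom A i) y" using i by (simp add: arr_atom_def xy)
  moreover have "\<not> le M (arr_atom A i) x" using \<open>i \<notin> B\<close> by (simp add: arr_atom_def xy)
  ultimately show "\<exists>a. atom M a \<and> le M a y \<and> \<not> le M a x \<and> joins M {x, a} \<noteq> {}"
    by (auto simp: arr_atom_def xy)
qed

text \<open>By \<open>component_rank\<close> a pair above \<open>(B, X)\<close> of the same rank has
  the same component. Closing therefore only enlarges the index set, at most to all members
  containing \<open>X\<close>.\<close>

lemma cl_M:
  assumes "B \<subseteq> I" "X \<in> comps B"
  shows "cl M (B, X) = layer_flat A X"
  unfolding cl_def
proof (rule the_equality)
  note fl = component_flat[OF assms(2,1)]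
  have F: "layer_flat A X = (flat X, X)" by (simp add: layer_flat_def)
  have max: "z \<in> elts M \<and> le M (B, X) z \<and> rho M z = rho M (B, X) \<Longrightarrow> le M z (flat X, X)" for z
  proof -
    assume z: "z \<in> elts M \<and> le M (B, X) z \<and> rho M z = rho M (B, X)"
    obtain D Z where z': "z = (D, Z)" by (metis surj_pair)
    have D: "D \<subseteq> I" "Z \<in> comps D" "Z \<subseteq> X" "r D = r B"
      using z assms by (auto simp: z' rho_M)
    then have "Z = X" using component_rank[OF D(1) assms(1) D(2) assms(2) D(3)] by blast
    then show ?thesis using component_flat(1)[OF D(2,1)] z' by auto
  qed
  have fe: "(flat X, X) \<in> elts M" "le M (B, X) (flat X, X)" "rho M (flat X, X) = rho M (B, X)"
    using fl assms by (auto simp: rho_M)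
  have anti: "z = (flat X, X)" if "le M z (flat X, X)" "le M (flat X, X) z" for z
    using that by (cases z) auto
  show "layer_flat A X \<in> elts M \<and> le M (B, X) (layer_flat A X) \<and> rho M (layer_flat A X) = rho M (B, X) \<and>
     (\<forall>z\<in>elts M. le M (B, X) z \<and> rho M z = rho M (B, X) \<and> le M (layer_flat A X) z \<longrightarrow> z = layer_flat A X)"
    unfolding F using fe max anti by blast
  fix y assume y: "y \<in> elts M \<and> le M (B, X) y \<and> rho M y = rho M (B, X) \<and>
     (\<forall>z\<in>elts M. le M (B, X) z \<and> rho M z = rho M (B, X) \<and> le M y z \<longrightarrow> z = y)"
  then have "(flat X, X) = y" using fe max by blast
  then show "y = layer_flat A X" by (simp add: F)
qed

lemma layers_iso: "poset_iso (layers A) (flats M) (layer_flat A)"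
  unfolding poset_iso_def
proof (intro conjI ballI)
  have F: "layer_flat A X = (flat X, X)" for X by (simp add: layer_flat_def)
  have "elts (flats M) = layer_flat A ` elts (layers A)"
  proof (intro equalityI subsetI)
    fix x assume x: "x \<in> elts (flats M)"
    obtain B X where x': "x = (B, X)" by (metis surj_pair)
    then have "B \<subseteq> I" "X \<in> comps B" "cl M (B, X) = (B, X)" using x by (auto simp: flats_def)
    then show "x \<in> layer_flat A ` elts (layers A)"
      using cl_M x' by (intro image_eqI[of _ _ X]) (auto simp: layers_elts)
  next
    fix x assume "x \<in> layer_flat A ` elts (layers A)"
    then obtain B X where "B \<subseteq> I" "X \<in> comps B" "x = (flat X, X)" by (auto simp: layers_elts F)
    then show "x \<in> elts (flats M)"
      using component_flat[of X B] cl_M[of "flat X" X] by (auto simp: flats_def F)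
  qed
  moreover have "inj_on (layer_flat A) (elts (layers A))" by (auto simp: inj_on_def F)
  ultimately show "bij_betw (layer_flat A) (elts (layers A)) (elts (flats M))"
    by (simp add: bij_betw_def)
  show "le (layers A) X Y \<longleftrightarrow> le (flats M) (layer_flat A X) (layer_flat A Y)" for X Y
    by (auto simp: flats_def F)
qed

lemma mem_layer: "i \<in> I \<Longrightarrow> mem A i \<in> elts (layers A)"
  using comps_single by (auto simp: layers_elts intro!: exI[of _ "{i}"])

text \<open>A proper member has rank 1, so containment between two members is equality of sets, and
  distinctness makes the indices equal.\<close>

lemma layer_flat_mem:
  assumes i: "i \<in> I" and inj: "inj_on (mem A) I" and proper: "\<And>j. j \<in> I \<Longrightarrow> mem A j \<noteq> space A"
  shows "layer_flat A (mem A i) = arr_atom A i"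
proof -
  have r1: "r {j} = 1" if "j \<in> I" for j
  proof -
    have "r {j} \<noteq> 0"
      using component_rank[of "{j}" "{}" "mem A j" "space A"] that comps_single comps_empty
        mem_space proper r_empty by auto
    then show ?thesis using r_le_card[of "{j}"] that by simp
  qed
  have "j = i" if "j \<in> I" "mem A i \<subseteq> mem A j" for j
    using component_rank[of "{i}" "{j}" "mem A i" "mem A j"] i that comps_single r1 inj
    by (auto simp: inj_on_def)
  then have "flat (mem A i) = {i}" using i by auto
  then show ?thesis by (simp add: layer_flat_def arr_atom_def)
qed

section \<open>Deletion\<close>

lemma ranked_deletion: "ranked_arrangement (arr_deletion A i) r"
proof -
  have "intersection (arr_deletion A i) B = intersection A B" for B
    by (simp add: arr_deletion_def intersection_def)
  moreover have "space (arr_deletion A i) = space A" "mem (arr_deletion A i) = mem A"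
    "idx (arr_deletion A i) = I - {i}"
    by (simp_all add: arr_deletion_def)
  moreover have "B \<subseteq> I" if "B \<subseteq> I - {i}" for B using that by blast
  ultimately show ?thesis
    using finite_idx space_connected space_nonempty mem_connected mem_nonempty mem_space r_empty
    by (unfold_locales; (simp only:)?)
      (assumption | simp | rule r_insert r_closed finite_components
        component_rank component_meets; simp)+
qed

text \<open>The identity map. What needs an argument is \<open>rho\<close>: it refers to chains in a
  possibly smaller poset of layers, but in both arrangements it equals \<open>r B\<close>.\<close>

lemma deletion_iso: "arr_scheme (arr_deletion A i) \<cong>\<^sub>M mdeletion M (arr_atom A i)"
proof -
  interpret d: ranked_arrangement "arr_deletion A i" r by (rule ranked_deletion)
  have int_eq: "intersection (arr_deletion A i) B = intersection A B" for B
    by (simp add: arr_deletion_def intersection_def)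
  have idx_eq: "idx (arr_deletion A i) = I - {i}" by (simp add: arr_deletion_def)
  have elts_iff: "(B, X) \<in> elts (mdeletion M (arr_atom A i)) \<longleftrightarrow> (B, X) \<in> elts (arr_scheme (arr_deletion A i))"
    for B X
  proof -
    have "X \<subseteq> mem A i" if "i \<in> B" "X \<in> comps B"
      using that in_components_subset[of X] by (auto simp: intersection_def)
    then show ?thesis
      by (auto simp: mdeletion_def arr_atom_def int_eq idx_eq)
  qed
  then have "elts (mdeletion M (arr_atom A i)) = elts (arr_scheme (arr_deletion A i))" by auto
  moreover have "rho (mdeletion M (arr_atom A i)) (B, X) = rho (arr_scheme (arr_deletion A i)) (B, X)"
    if "(B, X) \<in> elts (arr_scheme (arr_deletion A i))" for B X
    using that d.rho_M[of B X] rho_M[of B X] by (auto simp: mdeletion_def int_eq idx_eq)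
  ultimately show ?thesis
    unfolding mscheme_isomorphic_def poset_iso_def
    by (intro exI[of _ id]) (auto simp: mdeletion_def)
qed

end

section \<open>Homomorphisms into divisible groups\<close>

lemma zmult_eq_nmult: "zmult k x = (if k \<ge> 0 then nmult (nat k) x else - nmult (nat (- k)) x)"
  by (simp add: zmult_def)

lemma Hom_ext:
  assumes "\<phi> \<in> Hom T" "\<psi> \<in> Hom T" "\<And>x. x \<in> T \<Longrightarrow> \<phi> x = \<psi> x"
  shows "\<phi> = \<psi>"
  using assms by (auto simp: Hom_def intro: extensionalityI)

lemma Hom_add: "\<phi> \<in> Hom T \<Longrightarrow> x \<in> T \<Longrightarrow> y \<in> T \<Longrightarrow> \<phi> (x + y) = \<phi> x + \<phi> y"
  by (simp add: Hom_def)

lemma Hom_zero: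
  assumes "\<phi> \<in> Hom T" "zmod.subspace T"
  shows "\<phi> 0 = 0"
  using Hom_add[OF assms(1), of 0 0] zmod.subspace_0[OF assms(2)] by simp

lemma Hom_zmult:
  assumes "\<phi> \<in> Hom T" "zmod.subspace T" "x \<in> T"
  shows "\<phi> (zmult k x) = zmult k (\<phi> x)"
proof -
  have n: "nmult n x \<in> T \<and> \<phi> (nmult n x) = nmult n (\<phi> x)" for n
    using assms by (induction n) (auto simp: Hom_zero Hom_add zmod.subspace_add zmod.subspace_0)
  have "\<phi> (- y) = - \<phi> y" if "y \<in> T" for y
    using Hom_add[OF assms(1) that zmod.subspace_neg[OF assms(2) that]] Hom_zero[OF assms(1,2)]
    by (metis add.inverse_unique add.right_inverse)
  then show ?thesis using n by (auto simp: zmult_eq_nmult)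
qed

lemma Hom_restrict: "\<phi> \<in> Hom T \<Longrightarrow> S \<subseteq> T \<Longrightarrow> zmod.subspace S \<Longrightarrow> restrict \<phi> S \<in> Hom S"
  by (auto simp: Hom_def zmod.subspace_add subset_iff)

lemma Hom_plus: "zmod.subspace T \<Longrightarrow> \<phi> \<in> Hom T \<Longrightarrow> \<psi> \<in> Hom T \<Longrightarrow> (\<lambda>x\<in>T. \<phi> x + \<psi> x) \<in> Hom T"
  by (auto simp: Hom_def zmod.subspace_add)

lemma Hom_const_zero: "zmod.subspace T \<Longrightarrow> (\<lambda>x\<in>T. 0) \<in> Hom T"
  by (auto simp: Hom_def zmod.subspace_add)

lemma Hom_eq_on_span:
  assumes "\<phi> \<in> Hom T" "\<psi> \<in> Hom T" "zmod.subspace T" "B \<subseteq> T" "\<And>x. x \<in> B \<Longrightarrow> \<phi> x = \<psi> x"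
    and "x \<in> zmod.span B"
  shows "\<phi> x = \<psi> x"
proof -
  have "zmod.subspace {x \<in> T. \<phi> x = \<psi> x}"
    using assms(3) by (intro zmod.subspaceI)
      (auto simp: Hom_zero[OF assms(1,3)] Hom_zero[OF assms(2,3)] Hom_add[OF assms(1)]
        Hom_add[OF assms(2)] Hom_zmult[OF assms(1,3)] Hom_zmult[OF assms(2,3)]
        zmod.subspace_0 zmod.subspace_add zmod.subspace_scale)
  then have "zmod.span B \<subseteq> {x \<in> T. \<phi> x = \<psi> x}"
    using assms by (intro zmod.span_minimal) auto
  then show ?thesis using assms by blast
qed

text \<open>Extends \<phi> by sending \<open>e\<close> to \<open>g\<close>. The coefficient along
  \<open>e\<close> is well defined when no nonzero multiple of \<open>e\<close> lies in
  \<open>T\<close>.\<close>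

definition ext_hom :: "'a::ab_group_add set \<Rightarrow> 'a \<Rightarrow> ('a \<Rightarrow> 'g::ab_group_add) \<Rightarrow> 'g \<Rightarrow> 'a \<Rightarrow> 'g" where
  "ext_hom T e \<phi> g = (\<lambda>x\<in>adjoin e T. let m = THE m. x - zmult m e \<in> T in \<phi> (x - zmult m e) + zmult m g)"

lemma ext_hom_apply:
  assumes "zmod.subspace T" "\<forall>k. zmult k e \<in> T \<longrightarrow> k = 0" "y \<in> T"
  shows "ext_hom T e \<phi> g (y + zmult m e) = \<phi> y + zmult m g"
proof -
  have "(THE n. y + zmult m e - zmult n e \<in> T) = m"
  proof (rule the_equality)
    show "y + zmult m e - zmult m e \<in> T" using assms by simp
    fix n assume "y + zmult m e - zmult n e \<in> T"
    then have "y + zmult m e - zmult n e - y \<in> T" using assms zmod.subspace_diff by blast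
    then have "zmult (m - n) e \<in> T" by (simp add: zmod.scale_left_diff_distrib)
    then show "n = m" using assms(2) by fastforce
  qed
  then show ?thesis using adjoinI[OF assms(3), of m e] by (simp add: ext_hom_def)
qed

lemma ext_hom_base:
  assumes "zmod.subspace T" "\<forall>k. zmult k e \<in> T \<longrightarrow> k = 0" "y \<in> T"
  shows "ext_hom T e \<phi> g y = \<phi> y"
  using ext_hom_apply[OF assms, where m = 0] by simp

lemma ext_hom_Hom:
  assumes "zmod.subspace T" "\<forall>k. zmult k e \<in> T \<longrightarrow> k = 0" "\<phi> \<in> Hom T"
  shows "ext_hom T e \<phi> g \<in> Hom (adjoin e T)"
proof -
  note app = ext_hom_apply[OF assms(1,2)]
  have "ext_hom T e \<phi> g (x + y) = ext_hom T e \<phi> g x + ext_hom T e \<phi> g y"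
    if xy: "x \<in> adjoin e T" "y \<in> adjoin e T" for x y
  proof -
    obtain u m v n where uv: "u \<in> T" "x = u + zmult m e" "v \<in> T" "y = v + zmult n e"
      using xy by (metis adjoinE)
    have "x + y = (u + v) + zmult (m + n) e" by (simp add: uv zmod.scale_left_distrib)
    moreover have "u + v \<in> T" using uv assms zmod.subspace_add by blast
    ultimately have "ext_hom T e \<phi> g (x + y) = \<phi> (u + v) + zmult (m + n) g" by (simp add: app)
    then show ?thesis
      by (simp add: uv app Hom_add[OF assms(3)] zmod.scale_left_distrib)
  qed
  then show ?thesis by (simp add: Hom_def) (simp add: ext_hom_def)
qed

text \<open>The fibre of the restriction map to \<open>S\<close>; when nonempty and \<open>T\<close>
  is a subgroup, a coset of the homomorphisms vanishing on \<open>S\<close>.\<close>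

definition agree :: "'a::ab_group_add set \<Rightarrow> 'a set \<Rightarrow> ('a \<Rightarrow> 'g::ab_group_add) \<Rightarrow> ('a \<Rightarrow> 'g) set" where
  "agree T S \<phi> = {\<psi> \<in> Hom T. \<forall>x\<in>S. \<psi> x = \<phi> x}"

lemma continuous_on_nmult:
  "continuous_on S f \<Longrightarrow> continuous_on S (\<lambda>x. nmult n (f x :: 'g::topological_ab_group_add))"
  by (induction n) (auto intro!: continuous_intros)

lemma continuous_on_zmult:
  "continuous_on S f \<Longrightarrow> continuous_on S (\<lambda>x. zmult n (f x :: 'g::topological_ab_group_add))"
  unfolding zmult_def by (intro continuous_intros continuous_on_nmult)

lemma continuous_on_eval: "continuous_on S (\<lambda>\<phi>::'a \<Rightarrow> 'g::topological_space. \<phi> x)"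
  by (rule continuous_on_subset[OF continuous_on_product_coordinates]) simp

text \<open>Along the tower the fibre over \<open>adjoin e T\<close> is the continuous image, under
  \<open>ext_hom\<close>, of the fibre over \<open>T\<close> times the connected group, the second
  factor giving the value at \<open>e\<close>.\<close>

lemma connected_agree:
  assumes "connected (UNIV :: 'g::topological_ab_group_add set)" "free_ext S T" "\<phi> \<in> Hom T"
  shows "connected (agree T S (\<phi> :: 'a::ab_group_add \<Rightarrow> 'g))"
  using assms(2,3)
proof (induction arbitrary: \<phi>)
  case base
  then have "agree S S \<phi> = {\<phi>}"
    by (auto simp: agree_def intro: Hom_ext)
  then show ?case by simp
next
  case (step T e)
  note sub = free_ext_subspace[OF step.hyps(1)]
  have indep: "\<forall>k. zmult k e \<in> T \<longrightarrow> k = 0" using step.hyps(2) by blast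
  have TeT: "T \<subseteq> adjoin e T" by (rule adjoin_superset)
  note app = ext_hom_apply[OF sub(2) indep]
  let ?N = "agree T S (restrict \<phi> T) \<times> (UNIV :: 'g set)"
  let ?f = "\<lambda>z. ext_hom T e (fst z) (snd z)"
  have "connected (agree T S (restrict \<phi> T))"
    using step.prems sub TeT by (intro step.IH Hom_restrict) auto
  then have "connected ?N" using assms(1) by (rule connected_Times)
  moreover have "continuous_on ?N ?f"
  proof (rule continuous_on_coordinatewise_then_product)
    fix x
    show "continuous_on ?N (\<lambda>z. ext_hom T e (fst z) (snd z) x)"
    proof (cases "x \<in> adjoin e T")
      case True
      then obtain y m where y: "y \<in> T" "x = y + zmult m e" by (auto elim: adjoinE)
      have "continuous_on ?N (\<lambda>z. fst z y + zmult m (snd z))"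
        by (intro continuous_intros continuous_on_zmult
            continuous_on_compose2[OF continuous_on_eval[of UNIV y]]) auto
      then show ?thesis using y by (simp add: app)
    next
      case False
      then show ?thesis by (simp add: ext_hom_def)
    qed
  qed
  ultimately have "connected (?f ` ?N)" by (intro connected_continuous_image)
  moreover have "?f ` ?N = agree (adjoin e T) S \<phi>"
  proof (intro equalityI subsetI)
    fix \<psi> assume "\<psi> \<in> ?f ` ?N"
    then obtain \<eta> g where \<eta>: "\<eta> \<in> agree T S (restrict \<phi> T)" "\<psi> = ext_hom T e \<eta> g" by auto
    have "\<psi> x = \<phi> x" if "x \<in> S" for x
    proof -
      have "x \<in> T" using that sub by blast
      then have "\<psi> x = \<eta> x" using \<eta>(2) ext_hom_base[OF sub(2) indep] by simp
      then show ?thesis using \<eta>(1) that \<open>x \<in> T\<close> by (simp add: agree_def)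
    qed
    moreover have "\<psi> \<in> Hom (adjoin e T)"
      using \<eta> ext_hom_Hom[OF sub(2) indep, of \<eta> g] by (simp add: agree_def)
    ultimately show "\<psi> \<in> agree (adjoin e T) S \<phi>" by (simp add: agree_def)
  next
    fix \<psi> assume \<psi>: "\<psi> \<in> agree (adjoin e T) S \<phi>"
    then have H: "\<psi> \<in> Hom (adjoin e T)" by (simp add: agree_def)
    have eT: "e \<in> adjoin e T" using sub adjoin_self by blast
    have rT: "restrict \<psi> T \<in> Hom T" using H TeT sub by (intro Hom_restrict)
    have "\<psi> = ext_hom T e (restrict \<psi> T) (\<psi> e)"
    proof (rule Hom_ext[OF H])
      show "ext_hom T e (restrict \<psi> T) (\<psi> e) \<in> Hom (adjoin e T)"
        using ext_hom_Hom[OF sub(2) indep rT] .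
      fix x assume "x \<in> adjoin e T"
      then obtain y m where y: "y \<in> T" "x = y + zmult m e" by (auto elim: adjoinE)
      have spe: "zmod.subspace (adjoin e T)" using sub subspace_adjoin by blast
      have "\<psi> x = \<psi> y + \<psi> (zmult m e)"
        using Hom_add[OF H] y TeT eT zmod.subspace_scale[OF spe] by blast
      then show "\<psi> x = ext_hom T e (restrict \<psi> T) (\<psi> e) x"
        using y Hom_zmult[OF H spe eT] by (simp add: app)
    qed
    moreover have "restrict \<psi> T \<in> agree T S (restrict \<phi> T)"
      using \<psi> rT sub by (auto simp: agree_def)
    ultimately show "\<psi> \<in> ?f ` ?N" by (intro image_eqI[of _ _ "(restrict \<psi> T, \<psi> e)"]) auto
  qed
  ultimately show ?case by simp
qed

lemma finite_connected_eq:
  fixes S :: "'b::t1_space set"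
  assumes "finite S" "connected S" "a \<in> S" "b \<in> S"
  shows "a = b"
proof (rule ccontr)
  assume "a \<noteq> b"
  have "closed {a}" "closed (S - {a})" using assms(1) by (auto intro: finite_imp_closed)
  then have "{a} \<inter> S = {} \<or> (S - {a}) \<inter> S = {}"
    by (intro connected_closedD[OF assms(2)]) auto
  then show False using assms(3,4) \<open>a \<noteq> b\<close> by blast
qed

text \<open>Collects what the arrangement theory takes from the group. Euclidean space is a second
  instance, so localizations fall under the same lemmas; the \<open>itself\<close> parameter carries
  the type.\<close>

locale divisible_group =
  fixes ty :: "'g::{topological_ab_group_add, t2_space} itself"
  assumes connected_G: "connected (UNIV :: 'g set)"
    and divisible: "\<And>k x. k > 0 \<Longrightarrow> \<exists>y::'g. nmult k y = x"
    and finite_torsion: "\<And>k. k > 0 \<Longrightarrow> finite {x::'g. nmult k x = 0}"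
    and nontrivial: "\<exists>x::'g. x \<noteq> 0"
begin

lemma zdivisible:
  assumes "k \<noteq> 0"
  shows "\<exists>y::'g. zmult k y = x"
proof (cases "k > 0")
  case True
  then show ?thesis using divisible[of "nat k" x] by (auto simp: zmult_eq_nmult)
next
  case False
  then obtain y :: 'g where "nmult (nat (- k)) y = - x"
    using assms divisible[of "nat (- k)" "- x"] by auto
  then show ?thesis using False assms by (intro exI[of _ y]) (auto simp: zmult_eq_nmult)
qed

lemma finite_zmult_eq:
  assumes "k \<noteq> 0"
  shows "finite {y::'g. zmult k y = c}"
proof (cases "{y::'g. zmult k y = c} = {}")
  case False
  then obtain y0 :: 'g where y0: "zmult k y0 = c" by blast
  have "finite {y::'g. zmult k y = 0}"
  proof (cases "k > 0")
    case True
    then show ?thesis using finite_torsion[of "nat k"] by (simp add: zmult_eq_nmult)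
  next
    case False
    then show ?thesis using assms finite_torsion[of "nat (- k)"] by (simp add: zmult_eq_nmult)
  qed
  then have "finite ((\<lambda>z. y0 + z) ` {y::'g. zmult k y = 0})" by simp
  moreover have "{y::'g. zmult k y = c} \<subseteq> (\<lambda>z. y0 + z) ` {y::'g. zmult k y = 0}"
  proof
    fix y :: 'g assume "y \<in> {y. zmult k y = c}"
    then show "y \<in> (\<lambda>z. y0 + z) ` {y::'g. zmult k y = 0}"
      using y0 by (intro image_eqI[of _ _ "y - y0"]) (auto simp: zmod.scale_right_diff_distrib)
  qed
  ultimately show ?thesis by (rule finite_subset[rotated])
qed (metis finite.emptyI)

text \<open>At the stage where \<alpha> acquires a nonzero coefficient \<open>m\<close> along the
  new generator, the zero map is extended by a solution of \<open>m g' = g\<close>, which exists by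
  divisibility; later generators are sent to 0.\<close>

lemma Hom_separates:
  assumes "free_ext S T" "\<alpha> \<in> T" "\<alpha> \<notin> S"
  shows "\<exists>\<psi>\<in>Hom T. (\<forall>x\<in>S. \<psi> x = 0) \<and> \<psi> \<alpha> = (g::'g)"
  using assms
proof (induction)
  case base
  then show ?case by simp
next
  case (step T e)
  note sub = free_ext_subspace[OF step.hyps(1)]
  have indep: "\<forall>k. zmult k e \<in> T \<longrightarrow> k = 0" using step.hyps(2) by blast
  note app = ext_hom_apply[OF sub(2) indep]
  note base = ext_hom_base[OF sub(2) indep]
  note H = ext_hom_Hom[OF sub(2) indep]
  obtain y m where y: "y \<in> T" "\<alpha> = y + zmult m e" using step.prems by (auto elim: adjoinE)
  show ?case
  proof (cases "m = 0")
    case True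
    then obtain \<psi> where "\<psi> \<in> Hom T" "\<forall>x\<in>S. \<psi> x = 0" "\<psi> \<alpha> = g"
      using step.IH step.prems y by auto
    then show ?thesis
      using True y sub(3) by (intro bexI[OF _ H[where \<phi> = \<psi> and g = 0]]) (auto simp: base subset_iff)
  next
    case False
    then obtain g' :: 'g where "zmult m g' = g" using zdivisible by blast
    then show ?thesis
      using y sub(3)
      by (intro bexI[OF _ H[OF Hom_const_zero[OF sub(2)], where g = g']]) (auto simp: app base subset_iff)
  qed
qed

lemma agree_eval:
  assumes "free_ext S T" "\<alpha> \<in> T" "\<alpha> \<notin> S" "\<phi> \<in> Hom T"
  shows "\<exists>\<psi>\<in>agree T S \<phi>. \<psi> \<alpha> = (g::'g)"
proof -
  obtain \<eta> where \<eta>: "\<eta> \<in> Hom T" "\<forall>x\<in>S. \<eta> x = 0" "\<eta> \<alpha> = g - \<phi> \<alpha>"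
    using Hom_separates[OF assms(1-3)] by blast
  note sub = free_ext_subspace[OF assms(1)]
  show ?thesis
    using \<eta> assms sub Hom_plus[OF sub(2) assms(4) \<eta>(1)]
    by (intro bexI[of _ "\<lambda>x\<in>T. \<phi> x + \<eta> x"]) (auto simp: agree_def)
qed

text \<open>A coset remembers its subgroup: at an element outside \<open>S\<close> the value can be
  moved off the prescribed one by a nonzero \<open>h\<close>.\<close>

lemma agree_subset_imp:
  assumes "free_ext S T" "S' \<subseteq> T" "\<phi> \<in> Hom T" "agree T S \<phi> \<subseteq> agree T S' (\<psi> :: 'a::ab_group_add \<Rightarrow> 'g)"
  shows "S' \<subseteq> S"
proof
  fix x assume x: "x \<in> S'"
  show "x \<in> S"
  proof (rule ccontr)
    assume n: "x \<notin> S"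
    have xT: "x \<in> T" using x assms(2) by blast
    obtain h :: 'g where "h \<noteq> 0" using nontrivial by blast
    obtain \<eta> where "\<eta> \<in> agree T S \<phi>" "\<eta> x = \<psi> x + h"
      using agree_eval[OF assms(1) xT n assms(3)] by blast
    moreover then have "\<eta> x = \<psi> x" using assms(4) x by (auto simp: agree_def)
    ultimately show False using \<open>h \<noteq> 0\<close> by simp
  qed
qed

text \<open>Two homomorphisms in the same component agree on the saturation, as their values there are
  confined to finite sets.\<close>

lemma component_agree:
  assumes \<Gamma>: "free_ext {0} \<Gamma>" and B: "finite B" "B \<subseteq> \<Gamma>" and \<phi>: "\<phi> \<in> Hom \<Gamma>"
  shows "connected_component_set (agree \<Gamma> B \<phi>) \<phi> = agree \<Gamma> (sat \<Gamma> B) (\<phi> :: 'a::ab_group_add \<Rightarrow> 'g)"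
proof
  note sub = free_ext_subspace(2)[OF \<Gamma>]
  have fe: "free_ext (sat \<Gamma> B) \<Gamma>" using free_ext_sat[OF \<Gamma> B] by blast
  have "connected (agree \<Gamma> (sat \<Gamma> B) \<phi>)" using connected_agree[OF connected_G fe \<phi>] .
  moreover have "agree \<Gamma> (sat \<Gamma> B) \<phi> \<subseteq> agree \<Gamma> B \<phi>"
    using sat_superset[OF B(2)] by (auto simp: agree_def)
  moreover have "\<phi> \<in> agree \<Gamma> (sat \<Gamma> B) \<phi>" using \<phi> by (simp add: agree_def)
  ultimately show "agree \<Gamma> (sat \<Gamma> B) \<phi> \<subseteq> connected_component_set (agree \<Gamma> B \<phi>) \<phi>"
    using connected_component_maximal by metis
  show "connected_component_set (agree \<Gamma> B \<phi>) \<phi> \<subseteq> agree \<Gamma> (sat \<Gamma> B) \<phi>"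
  proof
    fix \<psi> assume \<psi>: "\<psi> \<in> connected_component_set (agree \<Gamma> B \<phi>) \<phi>"
    let ?C = "connected_component_set (agree \<Gamma> B \<phi>) \<phi>"
    have C: "?C \<subseteq> agree \<Gamma> B \<phi>" by (rule connected_component_subset)
    have \<phi>C: "\<phi> \<in> ?C" using \<phi> by (simp add: agree_def)
    have "\<psi> x = \<phi> x" if x: "x \<in> sat \<Gamma> B" for x
    proof -
      obtain k where k: "k \<noteq> 0" "zmult k x \<in> zmod.span B" and x\<Gamma>: "x \<in> \<Gamma>"
        using x by (auto simp: sat_def)
      have "(\<lambda>\<eta>. \<eta> x) ` ?C \<subseteq> {g. zmult k g = zmult k (\<phi> x)}"
      proof (rule image_subsetI)
        fix \<eta> assume "\<eta> \<in> ?C"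
        then have \<eta>: "\<eta> \<in> Hom \<Gamma>" "\<And>y. y \<in> B \<Longrightarrow> \<eta> y = \<phi> y" using C by (auto simp: agree_def)
        have "\<eta> (zmult k x) = \<phi> (zmult k x)"
          using Hom_eq_on_span[OF \<eta>(1) \<phi> sub B(2) \<eta>(2) k(2)] .
        then show "\<eta> x \<in> {g. zmult k g = zmult k (\<phi> x)}"
          using Hom_zmult[OF \<eta>(1) sub x\<Gamma>] Hom_zmult[OF \<phi> sub x\<Gamma>] by simp
      qed
      then have "finite ((\<lambda>\<eta>. \<eta> x) ` ?C)"
        using finite_zmult_eq[OF k(1)] finite_subset by blast
      moreover have "connected ((\<lambda>\<eta>. \<eta> x) ` ?C)"
        by (intro connected_continuous_image continuous_on_eval connected_connected_component)
      moreover have "\<psi> x \<in> (\<lambda>\<eta>. \<eta> x) ` ?C" "\<phi> x \<in> (\<lambda>\<eta>. \<eta> x) ` ?C" using \<psi> \<phi>C by blast+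
      ultimately show ?thesis by (intro finite_connected_eq)
    qed
    moreover have "\<psi> \<in> Hom \<Gamma>" using \<psi> C by (auto simp: agree_def)
    ultimately show "\<psi> \<in> agree \<Gamma> (sat \<Gamma> B) \<phi>" by (simp add: agree_def)
  qed
qed

end

locale abelian_arr = divisible_group ty for ty :: "'g::{topological_ab_group_add, t2_space} itself" +
  fixes \<Gamma> :: "'a::ab_group_add set" and \<X> :: "'i \<Rightarrow> 'a \<times> 'g" and \<A> :: "('i, 'a \<Rightarrow> 'g) arrangement"
  assumes arr: "abelian_arrangement \<Gamma> \<X> \<A>"
begin

abbreviation "dir i \<equiv> fst (\<X> i)"
abbreviation "Sg B \<equiv> sat \<Gamma> (dir ` B)"
text \<open>Offsets and values in the group do not enter, so a localization, although its group is
  different, has the same rank function.\<close>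

definition "mr B = mrank \<Gamma> (dir ` B)"

lemma free_\<Gamma>: "free_ext {0} \<Gamma>"
  using arr by (simp add: abelian_arrangement_def free_abelian_iff)

lemmas sub_\<Gamma> = free_ext_subspace(2)[OF free_\<Gamma>]

lemma space_\<A>: "space \<A> = Hom \<Gamma>" and fin_idx: "finite (idx \<A>)"
  and dir_\<Gamma>: "i \<in> idx \<A> \<Longrightarrow> dir i \<in> \<Gamma>"
  and mem_\<A>: "i \<in> idx \<A> \<Longrightarrow> mem \<A> i = {\<phi> \<in> Hom \<Gamma>. \<phi> (dir i) = snd (\<X> i)}"
  and mem_conn: "i \<in> idx \<A> \<Longrightarrow> connected (mem \<A> i) \<and> mem \<A> i \<noteq> {}"
  using arr unfolding abelian_arrangement_def hyp_def split_beta by blast+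

lemma dirs:
  assumes "B \<subseteq> idx \<A>"
  shows "finite (dir ` B)" "dir ` B \<subseteq> \<Gamma>" "finite B"
  using assms fin_idx finite_subset dir_\<Gamma> by auto

lemma intersection_\<A>:
  "B \<subseteq> idx \<A> \<Longrightarrow> intersection \<A> B = {\<phi> \<in> Hom \<Gamma>. \<forall>i\<in>B. \<phi> (dir i) = snd (\<X> i)}"
  by (auto simp: intersection_def space_\<A> mem_\<A> subset_iff)

lemma intersection_agree:
  assumes "B \<subseteq> idx \<A>" "\<phi> \<in> intersection \<A> B"
  shows "intersection \<A> B = agree \<Gamma> (dir ` B) \<phi>"
  using assms(2) unfolding intersection_\<A>[OF assms(1)] by (auto simp: agree_def)

lemma comps_\<A>:
  assumes "B \<subseteq> idx \<A>"
  shows "components (intersection \<A> B) = agree \<Gamma> (Sg B) ` intersection \<A> B"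
proof -
  have "connected_component_set (intersection \<A> B) \<phi> = agree \<Gamma> (Sg B) \<phi>"
    if "\<phi> \<in> intersection \<A> B" for \<phi>
    using component_agree[OF free_\<Gamma> dirs(1,2)[OF assms], of \<phi>] intersection_agree[OF assms that] that
    unfolding intersection_\<A>[OF assms] by auto
  then show ?thesis by (auto simp: components_def)
qed

lemma free_Sg: "B \<subseteq> idx \<A> \<Longrightarrow> free_ext {0} (Sg B) \<and> free_ext (Sg B) \<Gamma>"
  using free_ext_sat[OF free_\<Gamma> dirs(1,2)] by simp

text \<open>A component is determined by the values of its points on a finite generating set
  \<open>F\<close> of the saturation. Some nonzero multiple of each generator lies in the span of
  the directions, which confines each value to a translate of finite torsion.\<close>

lemma finite_comps:
  assumes "B \<subseteq> idx \<A>"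
  shows "finite (components (intersection \<A> B))"
proof (cases "intersection \<A> B = {}")
  case False
  then obtain \<phi>0 where \<phi>0: "\<phi>0 \<in> intersection \<A> B" by blast
  obtain F where F: "finite F" "Sg B = zmod.span F"
    using free_ext_finite_span[OF conjunct1[OF free_Sg[OF assms]]] by metis
  have FS: "F \<subseteq> Sg B" using F(2) zmod.span_superset by blast
  then have F\<Gamma>: "F \<subseteq> \<Gamma>" using sat_subset[of \<Gamma> "dir ` B"] by simp
  have "\<forall>x\<in>F. \<exists>k. k \<noteq> 0 \<and> zmult k x \<in> zmod.span (dir ` B)" using FS unfolding sat_def by blast
  then obtain k where k: "\<And>x. x \<in> F \<Longrightarrow> k x \<noteq> 0" "\<And>x. x \<in> F \<Longrightarrow> zmult (k x) x \<in> zmod.span (dir ` B)"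
    by metis
  define Q where "Q = (\<Pi>\<^sub>E x\<in>F. {g. zmult (k x) g = zmult (k x) (\<phi>0 x)})"
  have "finite Q"
    unfolding Q_def using F(1) k(1) finite_zmult_eq by (intro finite_PiE) auto
  have "(\<lambda>\<phi>. restrict \<phi> F) ` intersection \<A> B \<subseteq> Q"
  proof safe
    fix \<phi> assume \<phi>: "\<phi> \<in> intersection \<A> B"
    have H: "\<phi> \<in> Hom \<Gamma>" "\<phi>0 \<in> Hom \<Gamma>" "\<And>y. y \<in> dir ` B \<Longrightarrow> \<phi> y = \<phi>0 y"
      using \<phi> \<phi>0 unfolding intersection_\<A>[OF assms] by auto
    have "zmult (k x) (\<phi> x) = zmult (k x) (\<phi>0 x)" if x: "x \<in> F" for x
      using Hom_eq_on_span[OF H(1,2) sub_\<Gamma> dirs(2)[OF assms] H(3) k(2)[OF x]]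
        Hom_zmult[OF H(1) sub_\<Gamma>, of x "k x"] Hom_zmult[OF H(2) sub_\<Gamma>, of x "k x"] x F\<Gamma> by auto
    then show "restrict \<phi> F \<in> Q" by (auto simp: Q_def)
  qed
  then have fin: "finite ((\<lambda>\<phi>. restrict \<phi> F) ` intersection \<A> B)"
    using \<open>finite Q\<close> finite_subset by blast
  have "agree \<Gamma> (Sg B) \<phi> = agree \<Gamma> F (restrict \<phi> F)" if "\<phi> \<in> intersection \<A> B" for \<phi>
  proof -
    have "\<phi> \<in> Hom \<Gamma>" using that unfolding intersection_\<A>[OF assms] by auto
    then have "\<psi> x = \<phi> x" if "\<psi> \<in> Hom \<Gamma>" "\<forall>y\<in>F. \<psi> y = \<phi> y" "x \<in> Sg B" for \<psi> x
      using Hom_eq_on_span[OF that(1) _ sub_\<Gamma> F\<Gamma>] that(2,3) F(2) by blast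
    then show ?thesis using FS by (auto simp: agree_def)
  qed
  then have "components (intersection \<A> B) = agree \<Gamma> F ` (\<lambda>\<phi>. restrict \<phi> F) ` intersection \<A> B"
    unfolding comps_\<A>[OF assms] image_image by (rule image_cong[OF refl])
  then show ?thesis using fin by simp
qed simp

lemma mr_insert:
  assumes "B \<subseteq> idx \<A>" "i \<in> idx \<A>"
  shows "mr (insert i B) = mr B + (if dir i \<in> Sg B then 0 else 1)"
  using mrank_insert[OF sub_\<Gamma> dirs(1,2)[OF assms(1)] dir_\<Gamma>[OF assms(2)]] by (simp add: mr_def)

text \<open>The rank conditions are matroid theory of saturations; the last two conditions translate
  containment of components and meeting a member into statements about \<open>Sg\<close>.\<close>

lemma ranked: "ranked_arrangement \<A> mr"
proof
  show "finite (idx \<A>)" by (rule fin_idx)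
  have zero: "(\<lambda>x\<in>\<Gamma>. 0) \<in> Hom \<Gamma>" using Hom_const_zero[OF sub_\<Gamma>] .
  then show "space \<A> \<noteq> {}" unfolding space_\<A> by blast
  have "agree \<Gamma> {0} (\<lambda>x\<in>\<Gamma>. 0) = (Hom \<Gamma> :: ('a \<Rightarrow> 'g) set)"
    using Hom_zero[OF _ sub_\<Gamma>] zmod.subspace_0[OF sub_\<Gamma>] by (auto simp: agree_def)
  then show "connected (space \<A>)"
    using connected_agree[OF connected_G free_\<Gamma> zero] by (simp add: space_\<A>)
  show "connected (mem \<A> i)" "mem \<A> i \<noteq> {}" "mem \<A> i \<subseteq> space \<A>" if "i \<in> idx \<A>" for i
    using mem_conn[OF that] mem_\<A>[OF that] by (auto simp: space_\<A>)
  show "mr {} = 0" by (simp add: mr_def mrank_empty)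
  show "finite (components (intersection \<A> B))" if "B \<subseteq> idx \<A>" for B
    using finite_comps that .
  show "mr (insert i B) = mr B \<or> mr (insert i B) = Suc (mr B)" if "B \<subseteq> idx \<A>" "i \<in> idx \<A>" for B i
    using mr_insert[OF that] by simp
  show "mr (insert i C) = mr C"
    if "B \<subseteq> C" "C \<subseteq> idx \<A>" "i \<in> idx \<A>" "mr (insert i B) = mr B" for B C i
  proof -
    have "dir i \<in> Sg B" using mr_insert[OF order_trans[OF that(1,2)] that(3)] that(4) by (simp split: if_splits)
    then have "dir i \<in> Sg C" using sat_mono[of "dir ` B" "dir ` C"] that(1) by blast
    then show ?thesis using mr_insert[of C i] that by simp
  qed
  show "mr C \<le> mr B \<and> (mr B = mr C \<longrightarrow> X = Y)"
    if BC: "B \<subseteq> idx \<A>" "C \<subseteq> idx \<A>" "X \<in> components (intersection \<A> B)"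
      "Y \<in> components (intersection \<A> C)" "X \<subseteq> Y" for B C X Y
  proof -
    obtain \<phi> \<psi> where X: "\<phi> \<in> intersection \<A> B" "X = agree \<Gamma> (Sg B) \<phi>"
      and Y: "\<psi> \<in> intersection \<A> C" "Y = agree \<Gamma> (Sg C) \<psi>"
      using BC(3,4) unfolding comps_\<A>[OF BC(1)] comps_\<A>[OF BC(2)] by blast
    have H: "\<phi> \<in> Hom \<Gamma>" "\<psi> \<in> Hom \<Gamma>"
      using X Y unfolding intersection_\<A>[OF BC(1)] intersection_\<A>[OF BC(2)] by auto
    \<comment> \<open>Containment of cosets reverses to containment of the subgroups on which their
      elements are prescribed.\<close>
    have "Sg C \<subseteq> Sg B"
      using agree_subset_imp[OF _ sat_subset H(1), of "Sg B" "dir ` C" \<psi>] free_Sg[OF BC(1)] BC(5) X Y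
      by simp
    then have CB: "dir ` C \<subseteq> Sg B" using sat_superset[OF dirs(2)[OF BC(2)]] by blast
    note v = dirs(1,2)[OF BC(2)] dirs(1,2)[OF BC(1)]
    have "mr C \<le> mr B" unfolding mr_def using mrank_mono_sat[OF sub_\<Gamma> v CB] .
    moreover have "X = Y" if "mr B = mr C"
    proof -
      have "Sg C = Sg B"
        using mrank_eq_imp_sat[OF sub_\<Gamma> v CB] that by (simp add: mr_def)
      moreover have "\<phi> \<in> Y" using X H BC(5) by (auto simp: agree_def)
      then have "\<forall>x\<in>Sg C. \<phi> x = \<psi> x" using Y by (simp add: agree_def)
      ultimately show ?thesis using X Y by (auto simp: agree_def)
    qed
    ultimately show ?thesis by blast
  qed
  show "X \<inter> mem \<A> i \<noteq> {}"
    if B: "B \<subseteq> idx \<A>" "i \<in> idx \<A>" "X \<in> components (intersection \<A> B)" "mr (insert i B) \<noteq> mr B" for B i X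
  proof -
    obtain \<phi> where X: "\<phi> \<in> intersection \<A> B" "X = agree \<Gamma> (Sg B) \<phi>"
      using B(3) unfolding comps_\<A>[OF B(1)] by blast
    have H: "\<phi> \<in> Hom \<Gamma>" using X unfolding intersection_\<A>[OF B(1)] by auto
    \<comment> \<open>A rise in rank means a direction outside the saturation; there a point of
      \<open>X\<close> may take the prescribed offset.\<close>
    have "dir i \<notin> Sg B" using mr_insert[of B i] B by auto
    then obtain \<psi> where "\<psi> \<in> X" "\<psi> (dir i) = snd (\<X> i)"
      using agree_eval[of "Sg B" \<Gamma> "dir i" \<phi> "snd (\<X> i)"] free_Sg[OF B(1)] dir_\<Gamma>[OF B(2)] H X(2) by auto
    moreover then have "\<psi> \<in> mem \<A> i" using mem_\<A>[OF B(2)] X(2) by (auto simp: agree_def)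
    ultimately show ?thesis by blast
  qed
qed

sublocale ranked_arrangement \<A> mr by (rule ranked)

end

section \<open>Euclidean spaces as target groups\<close>

lemma nmult_eq_scaleR: "nmult k (x::'e::real_vector) = real k *\<^sub>R x"
  by (induction k) (auto simp: algebra_simps)

lemma zmult_eq_scaleR: "zmult k (x::'e::real_vector) = real_of_int k *\<^sub>R x"
  by (auto simp: zmult_eq_nmult nmult_eq_scaleR simp flip: scaleR_minus_left)

lemma divisible_group_euclidean: "divisible_group TYPE('e::euclidean_space)"
proof
  show "connected (UNIV :: 'e set)" by (simp add: convex_connected)
  show "\<exists>y::'e. nmult k y = x" if "k > 0" for k x
    using that by (intro exI[of _ "x /\<^sub>R real k"]) (simp add: nmult_eq_scaleR)
  show "finite {x::'e. nmult k x = 0}" if "k > 0" for k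
    using that by (simp add: nmult_eq_scaleR)
  show "\<exists>x::'e. x \<noteq> 0"
    using nonempty_Basis nonzero_Basis by blast
qed

text \<open>Without torsion, vanishing on a multiple of \<open>x\<close> is vanishing on
  \<open>x\<close>. Central intersections are therefore already their own components.\<close>

lemma agree_zero_euclidean:
  assumes "free_ext {0} \<Gamma>" "finite B" "B \<subseteq> \<Gamma>"
  shows "agree \<Gamma> B (\<lambda>x\<in>\<Gamma>. 0 :: 'e::real_vector) = agree \<Gamma> (sat \<Gamma> B) (\<lambda>x\<in>\<Gamma>. 0)"
proof -
  note sub = free_ext_subspace(2)[OF assms(1)]
  have "\<psi> x = 0" if \<psi>: "\<psi> \<in> agree \<Gamma> B (\<lambda>x\<in>\<Gamma>. 0 :: 'e)" and x: "x \<in> sat \<Gamma> B" for \<psi> x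
  proof -
    obtain k where k: "k \<noteq> 0" "zmult k x \<in> zmod.span B" and x\<Gamma>: "x \<in> \<Gamma>"
      using x by (auto simp: sat_def)
    have H: "\<psi> \<in> Hom \<Gamma>" "\<And>y. y \<in> B \<Longrightarrow> \<psi> y = (\<lambda>x\<in>\<Gamma>. 0 :: 'e) y" using \<psi> by (auto simp: agree_def)
    have "\<psi> (zmult k x) = (\<lambda>x\<in>\<Gamma>. 0) (zmult k x)"
      using Hom_eq_on_span[OF H(1) Hom_const_zero[OF sub] sub assms(3) H(2) k(2)] .
    then have "zmult k (\<psi> x) = 0"
      using Hom_zmult[OF H(1) sub x\<Gamma>] zmod.subspace_scale[OF sub x\<Gamma>] by simp
    then show ?thesis using k(1) by (simp add: zmult_eq_scaleR)
  qed
  then show ?thesis using sat_superset[OF assms(3)] sat_subset[of \<Gamma> B] by (auto simp: agree_def)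
qed

text \<open>The maps for restriction and localization are easier to write starting from the
  contraction and the lower interval, opposite to the stated direction.\<close>

lemma mscheme_isomorphic_sym:
  assumes "M \<cong>\<^sub>M N"
  shows "N \<cong>\<^sub>M M"
proof -
  obtain f where f: "bij_betw f (elts M) (elts N)"
    "\<And>x y. x \<in> elts M \<Longrightarrow> y \<in> elts M \<Longrightarrow> le M x y \<longleftrightarrow> le N (f x) (f y)"
    "\<And>x. x \<in> elts M \<Longrightarrow> rho N (f x) = rho M x"
    using assms by (auto simp: mscheme_isomorphic_def poset_iso_def)
  define g where "g = inv_into (elts M) f"
  have g: "bij_betw g (elts N) (elts M)" using f(1) by (simp add: g_def bij_betw_inv_into)
  have fg: "f (g y) = y" "g y \<in> elts M" if "y \<in> elts N" for y
    using that f(1) bij_betw_inv_into_right[OF f(1)] bij_betwE[OF g] by (auto simp: g_def)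
  show ?thesis
    unfolding mscheme_isomorphic_def poset_iso_def
  proof (intro exI[of _ g] conjI ballI)
    fix x y assume x: "x \<in> elts N" and y: "y \<in> elts N"
    show "le N x y \<longleftrightarrow> le M (g x) (g y)"
      using f(2)[OF fg(2)[OF x] fg(2)[OF y]] fg(1)[OF x] fg(1)[OF y] by simp
  next
    fix x assume x: "x \<in> elts N"
    show "rho M (g x) = rho N x" using f(3)[OF fg(2)[OF x]] fg(1)[OF x] by simp
  qed (rule g)
qed

section \<open>Transport of connected components\<close>

lemma componentsI:
  assumes "X \<noteq> {}" "X \<subseteq> U" "connected X"
    and "\<And>D. X \<subseteq> D \<Longrightarrow> D \<subseteq> U \<Longrightarrow> connected D \<Longrightarrow> D \<subseteq> X"
  shows "X \<in> components U"
proof -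
  obtain D where D: "D \<in> components U" "X \<subseteq> D"
    using exists_component_superset[OF assms(2) _ assms(3)] assms(1,2) by auto
  then have "D \<subseteq> X"
    using assms(4)[OF D(2)] in_components_subset[OF D(1)] in_components_connected[OF D(1)] by simp
  then show ?thesis using D by auto
qed

lemma components_subset:
  assumes "X \<in> components W" "X \<subseteq> U" "U \<subseteq> W"
  shows "X \<in> components U"
proof (rule componentsI)
  show X: "X \<noteq> {}" "connected X"
    using in_components_nonempty[OF assms(1)] in_components_connected[OF assms(1)] by auto
  fix D assume "X \<subseteq> D" "D \<subseteq> U" "connected D"
  then show "D \<subseteq> X" using components_maximal[OF assms(1), of D] X assms(3) by auto
qed (rule assms)

lemma components_homeomorphism:
  assumes "homeomorphism S T f g" "U \<subseteq> S"
  shows "components (f ` U) = (`) f ` components U"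
proof -
  \<comment> \<open>Stated for arbitrary homeomorphisms so that it can be applied to the inverse as
    well.\<close>
  have img: "f ` C \<in> components (f ` U)"
    if h: "homeomorphism S T f g" "U \<subseteq> S" and C: "C \<in> components U"
    for C S T and U :: "'x::topological_space set" and f :: "'x \<Rightarrow> 'y::topological_space" and g
  proof -
    have gf: "g (f x) = x" if "x \<in> S" for x using h that by (simp add: homeomorphism_def)
    have U: "C \<noteq> {}" "C \<subseteq> U" "connected C"
      using in_components_nonempty[OF C] in_components_subset[OF C] in_components_connected[OF C]
      by auto
    have fU: "f ` U \<subseteq> T" and cont: "continuous_on S f" "continuous_on T g"
      using h by (auto simp: homeomorphism_def)
    show ?thesis
    proof (rule componentsI)
      show "f ` C \<noteq> {}" "f ` C \<subseteq> f ` U" using U by auto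
      show "connected (f ` C)"
        using U h(2) continuous_on_subset[OF cont(1), of C] by (intro connected_continuous_image) auto
      fix D assume D: "f ` C \<subseteq> D" "D \<subseteq> f ` U" "connected D"
      have gD: "connected (g ` D)"
        using D fU continuous_on_subset[OF cont(2), of D] by (intro connected_continuous_image) auto
      have "C \<subseteq> g ` D"
      proof
        fix x assume "x \<in> C"
        then have "f x \<in> D" "g (f x) = x" using D(1) gf U(2) h(2) by auto
        then show "x \<in> g ` D" by (metis imageI)
      qed
      moreover have "g ` f ` U \<subseteq> U" using gf h(2) by auto
      then have "g ` D \<subseteq> U" using D(2) by blast
      ultimately have gDC: "g ` D \<subseteq> C" using components_maximal[OF C gD] U(1) by (simp add: Int_absorb2)
      show "D \<subseteq> f ` C"
      proof
        fix y assume y: "y \<in> D"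
        then obtain x where x: "x \<in> U" "y = f x" using D(2) by auto
        then have "g y = x" using gf h(2) by auto
        then show "y \<in> f ` C" using x(2) y gDC by auto
      qed
    qed
  qed
  have gf: "g ` f ` U = U"
  proof -
    have "g (f x) = x" if "x \<in> U" for x using assms that by (auto simp: homeomorphism_def)
    then show ?thesis by force
  qed
  have 1: "D \<in> (`) f ` components U" if D: "D \<in> components (f ` U)" for D
  proof -
    have fUT: "f ` U \<subseteq> T" using assms unfolding homeomorphism_def by blast
    have "g ` D \<in> components (g ` f ` U)"
      using img[OF homeomorphism_symD[OF assms(1)] fUT D] .
    moreover have "D \<subseteq> T" using in_components_subset[OF D] fUT by blast
    then have "f (g y) = y" if "y \<in> D" for y
      using that assms(1) by (simp add: homeomorphism_def subset_iff)
    then have "f ` g ` D = D" by (simp add: image_image)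
    ultimately show ?thesis by (intro image_eqI[of _ _ "g ` D"]) (simp_all add: gf)
  qed
  have 2: "f ` C \<in> components (f ` U)" if "C \<in> components U" for C
    using img[OF assms that] .
  show ?thesis by (intro equalityI subsetI image_subsetI 1 2)
qed

section \<open>Restriction to a member of the arrangement\<close>

text \<open>The topological part of restriction, with the identification of the distinguished member
  with a homomorphism group reduced to an arbitrary homeomorphism \<open>f\<close>.\<close>

locale restricted_arrangement = ranked_arrangement A r
  for A :: "('i, 'p::topological_space) arrangement" and r +
  fixes i0 :: 'i and T :: "'q::topological_space set" and f :: "'p \<Rightarrow> 'q" and g :: "'q \<Rightarrow> 'p"
  assumes i0: "i0 \<in> idx A" and hom: "homeomorphism (mem A i0) T f g"
begin

abbreviation "H0 \<equiv> mem A i0"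

definition R :: "('i \<times> 'p set, 'q) arrangement" where
  "R = \<lparr>space = f ` H0, idx = {(i, C). i \<in> I - {i0} \<and> C \<in> components (H0 \<inter> mem A i)},
        mem = (\<lambda>(i, C). f ` C)\<rparr>"

definition J :: "('i \<times> 'p set) set \<Rightarrow> 'p set" where
  "J B' = H0 \<inter> (\<Inter>(i, C)\<in>B'. C)"

text \<open>For \<open>X\<close> a component over \<open>B\<close> with \<open>i0\<close> in
  \<open>B\<close>, each other index \<open>i\<close> of \<open>B\<close> contributes exactly one
  component of its trace on \<open>H0\<close>, the one around \<open>X\<close>. This is the index
  set in \<open>R\<close> matching \<open>B\<close>.\<close>

definition traces :: "'i set \<Rightarrow> 'p set \<Rightarrow> ('i \<times> 'p set) set" where
  "traces B X = {(i, C). i \<in> B - {i0} \<and> C \<in> components (H0 \<inter> mem A i) \<and> X \<subseteq> C}"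

lemma gf: "x \<in> H0 \<Longrightarrow> g (f x) = x"
  using hom by (simp add: homeomorphism_def)

lemma f_subset_iff:
  assumes "X \<subseteq> H0" "Y \<subseteq> H0"
  shows "f ` X \<subseteq> f ` Y \<longleftrightarrow> X \<subseteq> Y"
proof
  assume sub: "f ` X \<subseteq> f ` Y"
  show "X \<subseteq> Y"
  proof
    fix x assume x: "x \<in> X"
    then obtain y where "y \<in> Y" "f x = f y" using sub by blast
    moreover then have "x = y" using gf[of x] gf[of y] assms x by auto
    ultimately show "x \<in> Y" by simp
  qed
qed blast

lemma idx_R: "(i, C) \<in> idx R \<longleftrightarrow> i \<in> I \<and> i \<noteq> i0 \<and> C \<in> components (H0 \<inter> mem A i)"
  by (auto simp: R_def)

lemma idx_R_subset: "(i, C) \<in> idx R \<Longrightarrow> C \<subseteq> H0 \<inter> mem A i"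
  using idx_R in_components_subset by blast

lemma intersection_R:
  assumes "B' \<subseteq> idx R"
  shows "intersection R B' = f ` J B'"
proof (intro equalityI subsetI)
  fix y assume y: "y \<in> intersection R B'"
  then obtain x where x: "x \<in> H0" "y = f x" by (auto simp: intersection_def R_def)
  have "x \<in> C" if iC: "(i, C) \<in> B'" for i C
  proof -
    have "y \<in> f ` C" using y iC by (auto simp: intersection_def R_def)
    then obtain z where "z \<in> C" "y = f z" by blast
    moreover then have "z \<in> H0" using idx_R_subset[of i C] iC assms by blast
    ultimately show ?thesis using x gf by metis
  qed
  then show "y \<in> f ` J B'" using x by (auto simp: J_def)
next
  fix y assume "y \<in> f ` J B'"
  then show "y \<in> intersection R B'" by (auto simp: intersection_def R_def J_def)
qed

lemma comps_R:
  assumes "B' \<subseteq> idx R"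
  shows "components (intersection R B') = (`) f ` components (J B')"
  unfolding intersection_R[OF assms]
  by (rule components_homeomorphism[OF hom]) (auto simp: J_def)

lemma comp_H0: "X \<in> comps B \<Longrightarrow> i0 \<in> B \<Longrightarrow> X \<subseteq> H0"
  using in_components_subset[of X] by (fastforce simp: intersection_def)

lemma traces_fst:
  assumes "X \<in> comps B" "i0 \<in> B"
  shows "fst ` traces B X = B - {i0}"
proof -
  have "\<exists>C. C \<in> components (H0 \<inter> mem A i) \<and> X \<subseteq> C" if i: "i \<in> B" for i
  proof -
    have "X \<subseteq> H0 \<inter> mem A i"
      using in_components_subset[OF assms(1)] assms(2) i by (auto simp: intersection_def)
    moreover have "X \<noteq> {}" "connected X"
      using assms(1) in_components_nonempty in_components_connected by blast+
    ultimately show ?thesis using exists_component_superset[of X "H0 \<inter> mem A i"] by auto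
  qed
  then have "i \<in> fst ` traces B X" if "i \<in> B - {i0}" for i
    using that unfolding traces_def by force
  then show ?thesis by (auto simp: traces_def)
qed

text \<open>The set \<open>J (traces B X)\<close> lies between \<open>X\<close> and the intersection
  over \<open>B\<close>, so \<open>X\<close> is still a component of it.\<close>

lemma traces_component:
  assumes "B \<subseteq> I" "X \<in> comps B" "i0 \<in> B"
  shows "traces B X \<subseteq> idx R" "X \<in> components (J (traces B X))"
proof -
  show sub: "traces B X \<subseteq> idx R" using assms(1) by (auto simp: traces_def idx_R)
  have "J (traces B X) \<subseteq> intersection A B"
  proof
    fix x assume x: "x \<in> J (traces B X)"
    have "x \<in> mem A i" if i: "i \<in> B" for i
    proof (cases "i = i0")
      case True
      then show ?thesis using x by (simp add: J_def)
    next
      case False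
      then have "i \<in> fst ` traces B X" using traces_fst[OF assms(2,3)] i by simp
      then obtain C where C: "(i, C) \<in> traces B X" by auto
      then have "x \<in> C" using x by (auto simp: J_def)
      then show ?thesis using idx_R_subset[of i C] C sub by blast
    qed
    moreover have "x \<in> space A" using x mem_space[OF i0] by (auto simp: J_def)
    ultimately show "x \<in> intersection A B" by (simp add: intersection_def)
  qed
  moreover have "X \<subseteq> J (traces B X)"
    using comp_H0[OF assms(2,3)] by (auto simp: J_def traces_def)
  ultimately show "X \<in> components (J (traces B X))"
    using components_subset[OF assms(2)] by blast
qed

text \<open>Take the indices underlying \<open>B'\<close> together with \<open>i0\<close>. The
  component over them around \<open>X\<close> stays, by maximality, inside every trace in
  \<open>B'\<close>, hence in \<open>J B'\<close>, and so equals \<open>X\<close>. No index occurs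
  twice, because two components of one trace containing \<open>X\<close> coincide.\<close>

lemma traces_surj:
  assumes "B' \<subseteq> idx R" "X \<in> components (J B')"
  shows "\<exists>B\<subseteq>I. i0 \<in> B \<and> X \<in> comps B \<and> traces B X = B'"
proof -
  define B where "B = insert i0 (fst ` B')"
  have B: "B \<subseteq> I" "i0 \<in> B" using assms(1) i0 by (auto simp: B_def R_def)
  have X: "X \<subseteq> J B'" "X \<noteq> {}" "connected X"
    using assms(2) in_components_subset in_components_nonempty in_components_connected by blast+
  have XC: "X \<subseteq> C" if "(i, C) \<in> B'" for i C using X(1) that by (auto simp: J_def)
  have "X \<subseteq> mem A i" if "i \<in> B" for i
    using that X(1) XC idx_R_subset assms(1) unfolding B_def by (force simp: J_def)
  then have "X \<subseteq> intersection A B" using B mem_space[OF i0] by (fastforce simp: intersection_def)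
  then obtain Y where Y: "Y \<in> comps B" "X \<subseteq> Y"
    using exists_component_superset[OF _ _ X(3), of "intersection A B"] X(2)
    by (metis subset_empty)
  have Yi: "Y \<subseteq> mem A i" if "i \<in> B" for i
    using in_components_subset[OF Y(1)] that by (auto simp: intersection_def)
  have "Y \<subseteq> C" if iC: "(i, C) \<in> B'" for i C
  proof (rule components_maximal)
    show "C \<in> components (H0 \<inter> mem A i)" using iC assms(1) idx_R by blast
    show "connected Y" using Y(1) in_components_connected by blast
    have "i \<in> B" using iC by (force simp: B_def)
    then show "Y \<subseteq> H0 \<inter> mem A i" using Yi B by blast
    show "C \<inter> Y \<noteq> {}" using XC[OF iC] Y(2) X(2) by blast
  qed
  then have "Y \<subseteq> J B'" using Yi[OF B(2)] by (auto simp: J_def)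
  then have "Y \<subseteq> X"
    using components_maximal[OF assms(2), of Y] in_components_connected[OF Y(1)] Y(2) X(2) by auto
  then have XB: "X \<in> comps B" using Y by auto
  have "traces B X = B'"
  proof (intro equalityI subsetI)
    fix z assume "z \<in> traces B X"
    then obtain i C where z: "z = (i, C)" "i \<in> B - {i0}" "C \<in> components (H0 \<inter> mem A i)" "X \<subseteq> C"
      by (auto simp: traces_def)
    then obtain C' where C': "(i, C') \<in> B'" by (auto simp: B_def)
    then have C'i: "C' \<in> components (H0 \<inter> mem A i)" using assms(1) idx_R by blast
    have "C \<inter> C' \<noteq> {}" using XC[OF C'] z(4) X(2) by blast
    then have "C = C'" using components_eq[OF z(3) C'i] by simp
    then show "z \<in> B'" using C' z by simp
  next
    fix z assume z: "z \<in> B'"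
    obtain i C where iC: "z = (i, C)" by (metis surj_pair)
    then have "i \<noteq> i0" "C \<in> components (H0 \<inter> mem A i)" using z assms(1) idx_R by blast+
    moreover have "i \<in> B" using z iC by (force simp: B_def)
    ultimately show "z \<in> traces B X" using XC z iC by (auto simp: traces_def)
  qed
  then show ?thesis using B XB by blast
qed

lemma layers_R: "elts (layers R) = (\<Union>B\<in>{B. B \<subseteq> I \<and> i0 \<in> B}. (`) f ` comps B)"
proof (intro equalityI subsetI)
  fix Y assume "Y \<in> elts (layers R)"
  then obtain B' where B': "B' \<subseteq> idx R" "Y \<in> components (intersection R B')"
    by (auto simp: layers_def)
  then obtain X where X: "X \<in> components (J B')" "Y = f ` X" using comps_R by auto
  obtain B where "B \<subseteq> I" "i0 \<in> B" "X \<in> comps B" using traces_surj[OF B'(1) X(1)] by blast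
  then show "Y \<in> (\<Union>B\<in>{B. B \<subseteq> I \<and> i0 \<in> B}. (`) f ` comps B)" using X(2) by auto
next
  fix Y assume "Y \<in> (\<Union>B\<in>{B. B \<subseteq> I \<and> i0 \<in> B}. (`) f ` comps B)"
  then obtain B X where B: "B \<subseteq> I" "i0 \<in> B" "X \<in> comps B" "Y = f ` X" by auto
  then have "Y \<in> components (intersection R (traces B X))"
    using traces_component[OF B(1,3,2)] comps_R[of "traces B X"] by simp
  then show "Y \<in> elts (layers R)"
    using traces_component(1)[OF B(1,3,2)] by (auto simp: layers_def)
qed

text \<open>Chains of layers of \<open>R\<close> are chains of components whose index sets contain
  \<open>i0\<close>, so they start at rank \<open>r {i0}\<close>. The truncated subtraction is exact
  since \<open>r {i0}\<close> is a lower bound for all ranks involved.\<close>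

lemma rank_of_layer_R:
  assumes "B \<subseteq> I" "X \<in> comps B" "i0 \<in> B"
  shows "rank_of (layers R) (f ` X) = r B - r {i0}"
proof -
  \<comment> \<open>A layer of \<open>R\<close> is the image of a component in \<open>H0\<close>;
    pulling back by \<open>g\<close> recovers that component and the rank of its flat.\<close>
  define h where "h Y = r (flat (g ` Y)) - r {i0}" for Y
  have gfX: "g ` f ` Y = Y" if "Y \<subseteq> H0" for Y
    using gf that by (force simp: image_image subset_iff)
  have h: "h (f ` Y) = r C - r {i0}" if "C \<subseteq> I" "Y \<in> comps C" "i0 \<in> C" for C Y
    using component_flat(3)[OF that(2,1)] gfX[OF comp_H0[OF that(2,3)]] by (simp add: h_def)
  have ge: "r {i0} \<le> r C" if "C \<subseteq> I" "i0 \<in> C" for C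
    using r_mono[of "{i0}" C] that by simp
  have le: "le (layers R) Y Z \<longleftrightarrow> Z \<subseteq> Y" for Y Z by (simp add: layers_def)
  have lay: "\<exists>C X. C \<subseteq> I \<and> i0 \<in> C \<and> X \<in> comps C \<and> Y = f ` X" if "Y \<in> elts (layers R)" for Y
    using that unfolding layers_R by auto
  have lay': "f ` X \<in> elts (layers R)" if "C \<subseteq> I" "i0 \<in> C" "X \<in> comps C" for C X
    using that unfolding layers_R by auto
  have "rank_of (layers R) (f ` X) = h (f ` X)"
  proof (rule rank_of_eqI)
    show "finite (elts (layers R))"
      unfolding layers_R using finite_idx finite_components by auto
    fix Y Z assume YZ: "Y \<in> elts (layers R)" "Z \<in> elts (layers R)" "le (layers R) Y Z" "Y \<noteq> Z"
    obtain C V where C: "C \<subseteq> I" "i0 \<in> C" "V \<in> comps C" "Y = f ` V" using lay[OF YZ(1)] by blast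
    obtain D W where D: "D \<subseteq> I" "i0 \<in> D" "W \<in> comps D" "Z = f ` W" using lay[OF YZ(2)] by blast
    have "W \<subseteq> V" "W \<noteq> V"
      using YZ(3,4) C D f_subset_iff[of W V] comp_H0 by (auto simp: le)
    then have "r C < r D" using component_rank[OF D(1) C(1) D(3) C(3)] by fastforce
    then show "h Y < h Z" using h[OF C(1,3,2)] h[OF D(1,3,2)] ge[OF C(1,2)] C D by simp
  next
    fix Y assume Y: "Y \<in> elts (layers R)" "0 < h Y"
    obtain C V where C: "C \<subseteq> I" "i0 \<in> C" "V \<in> comps C" "Y = f ` V" using lay[OF Y(1)] by blast
    then have "r {i0} < r C" using Y(2) h[OF C(1,3,2)] by simp
    \<comment> \<open>Descending above \<open>{i0}\<close> keeps \<open>i0\<close> among the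
      indices, so the larger component is again a layer of \<open>R\<close>.\<close>
    then obtain D where D: "{i0} \<subseteq> D" "D \<subseteq> C" "Suc (r D) = r C"
      using r_pred[OF C(1)] C(2) by blast
    then obtain W where W: "W \<in> comps D" "V \<subseteq> W" using component_above[OF C(3)] by blast
    have DI: "D \<subseteq> I" "i0 \<in> D" using D C by auto
    have "f ` W \<in> elts (layers R)" using lay'[OF DI W(1)] .
    moreover have "le (layers R) (f ` W) Y" using W C by (auto simp: le)
    moreover have "Suc (h (f ` W)) = h Y"
      using h[OF DI(1) W(1) DI(2)] h[OF C(1,3,2)] ge[OF DI] D(3) C(4) by simp
    ultimately show "\<exists>Z\<in>elts (layers R). le (layers R) Z Y \<and> Suc (h Z) = h Y" by blast
  next
    show "f ` X \<in> elts (layers R)" using lay'[OF assms(1,3,2)] .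
  qed (auto simp: le)
  then show ?thesis using h[OF assms] by simp
qed

text \<open>An element of the contraction is a pair \<open>(B, X)\<close> with \<open>i0\<close> in
  \<open>B\<close>. Projecting traces to their indices recovers \<open>B\<close>, which makes the
  map reflect the order.\<close>

lemma restriction_iso: "arr_scheme R \<cong>\<^sub>M mcontraction M (arr_atom A i0)"
proof (rule mscheme_isomorphic_sym)
  let ?K = "mcontraction M (arr_atom A i0)"
  define F where "F = (\<lambda>(B, X). (traces B X, f ` X))"
  have K: "(B, X) \<in> elts ?K \<longleftrightarrow> B \<subseteq> I \<and> X \<in> comps B \<and> i0 \<in> B" for B X
    using comp_H0 by (auto simp: mcontraction_def arr_atom_def)
  have S: "(B', Y) \<in> elts (arr_scheme R) \<longleftrightarrow> B' \<subseteq> idx R \<and> Y \<in> components (intersection R B')" for B' Y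
    by (simp add: arr_scheme_def)
  have FS: "F (B, X) \<in> elts (arr_scheme R)" if "(B, X) \<in> elts ?K" for B X
    using that traces_component[of B X] comps_R by (auto simp: F_def K S)
  have iff: "le (arr_scheme R) (F (B, X)) (F (C, Y)) \<longleftrightarrow> B \<subseteq> C \<and> Y \<subseteq> X"
    if "(B, X) \<in> elts ?K" "(C, Y) \<in> elts ?K" for B X C Y
  proof -
    have b: "X \<in> comps B" "i0 \<in> B" "Y \<in> comps C" "i0 \<in> C" using that by (auto simp: K)
    have f: "f ` Y \<subseteq> f ` X \<longleftrightarrow> Y \<subseteq> X" using f_subset_iff comp_H0 b by blast
    have "B \<subseteq> C" if "traces B X \<subseteq> traces C Y"
      using image_mono[OF that, of fst] traces_fst[OF b(1,2)] traces_fst[OF b(3,4)] b(4) by auto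
    moreover have "traces B X \<subseteq> traces C Y" if "B \<subseteq> C" "Y \<subseteq> X"
      using that by (auto simp: traces_def)
    ultimately show ?thesis using f by (auto simp: F_def arr_scheme_def)
  qed
  have "poset_iso ?K (arr_scheme R) F"
  proof (rule poset_isoI)
    show "F ` elts ?K = elts (arr_scheme R)"
    proof (intro equalityI subsetI)
      fix z assume "z \<in> F ` elts ?K"
      then show "z \<in> elts (arr_scheme R)" using FS by (metis imageE surj_pair)
    next
      fix z assume z: "z \<in> elts (arr_scheme R)"
      obtain B' Y where BY: "z = (B', Y)" by (metis surj_pair)
      then have B': "B' \<subseteq> idx R" using z S by blast
      then obtain X where "X \<in> components (J B')" "Y = f ` X" using z BY S comps_R by auto
      moreover then obtain B where "B \<subseteq> I" "i0 \<in> B" "X \<in> comps B" "traces B X = B'"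
        using traces_surj[OF B'] by blast
      ultimately show "z \<in> F ` elts ?K"
        using BY K by (intro image_eqI[of _ _ "(B, X)"]) (auto simp: F_def)
    qed
    show "le ?K x y \<longleftrightarrow> le (arr_scheme R) (F x) (F y)" if "x \<in> elts ?K" "y \<in> elts ?K" for x y
      using that iff[of "fst x" "snd x" "fst y" "snd y"]
      by (cases x; cases y) (simp add: mcontraction_def)
    show "x = y" if "le ?K x y" "le ?K y x" for x y
      using that le_M_antisym by (simp add: mcontraction_def)
    show "le (arr_scheme R) z z" for z by (cases z) (simp add: arr_scheme_def)
  qed
  moreover have "rho (arr_scheme R) (F x) = rho ?K x" if x: "x \<in> elts ?K" for x
  proof -
    obtain B X where BX: "x = (B, X)" by (metis surj_pair)
    then have b: "B \<subseteq> I" "X \<in> comps B" "i0 \<in> B" using x K by auto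
    have "rho ?K x = r B - r {i0}"
      using b i0 comps_single[OF i0] rho_M[of "{i0}" H0]
      by (simp add: mcontraction_def BX rho_M arr_atom_def)
    then show ?thesis
      using rank_of_layer_R[OF b] by (simp add: BX F_def arr_scheme_def)
  qed
  ultimately show "?K \<cong>\<^sub>M arr_scheme R"
    unfolding mscheme_isomorphic_def by blast
qed

end

section \<open>Localization and restriction of abelian arrangements\<close>

context abelian_arr
begin

lemma localization_arrangement:
  fixes L :: "('i, 'a \<Rightarrow> 'e::euclidean_space) arrangement" and X :: "('a \<Rightarrow> 'g) set"
  defines "L \<equiv> arr_localization \<Gamma> \<X> \<A> X"
  shows "abelian_arrangement \<Gamma> (\<lambda>i. (dir i, 0)) L"
proof -
  have "connected (hyp \<Gamma> (dir i, 0) :: ('a \<Rightarrow> 'e) set) \<and> hyp \<Gamma> (dir i, 0 :: 'e) \<noteq> {}"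
    if "i \<in> idx \<A>" for i
  proof -
    have i: "{dir i} \<subseteq> \<Gamma>" using dir_\<Gamma>[OF that] by simp
    have zero: "(\<lambda>x\<in>\<Gamma>. 0 :: 'e) \<in> Hom \<Gamma>" using Hom_const_zero[OF sub_\<Gamma>] .
    have eq: "hyp \<Gamma> (dir i, 0) = agree \<Gamma> {dir i} (\<lambda>x\<in>\<Gamma>. 0 :: 'e)"
      using i by (simp add: hyp_def agree_def)
    have "connected (agree \<Gamma> (sat \<Gamma> {dir i}) (\<lambda>x\<in>\<Gamma>. 0 :: 'e))"
      using connected_agree[OF _ _ zero] free_ext_sat[OF free_\<Gamma> _ i] by (simp add: convex_connected)
    moreover have "(\<lambda>x\<in>\<Gamma>. 0 :: 'e) \<in> agree \<Gamma> {dir i} (\<lambda>x\<in>\<Gamma>. 0 :: 'e)"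
      using zero by (simp add: agree_def)
    ultimately show ?thesis
      unfolding eq using agree_zero_euclidean[OF free_\<Gamma> _ i, where 'e = 'e] by auto
  qed
  then show ?thesis
    using fin_idx dir_\<Gamma> free_\<Gamma>
    by (simp add: L_def abelian_arrangement_def arr_localization_def free_abelian_iff)
qed

text \<open>Both posets are the power set of \<open>flat X\<close>: on one side each subset has
  exactly one component containing \<open>X\<close>, on the other each central intersection is
  connected. The ranks agree because both are the rank of the same directions.\<close>

lemma localization_iso:
  fixes L :: "('i, 'a \<Rightarrow> 'e::euclidean_space) arrangement"
  assumes X: "X \<in> elts (layers \<A>)"
  defines "L \<equiv> arr_localization \<Gamma> \<X> \<A> X"
  shows "arr_scheme L \<cong>\<^sub>M mlocalization M (layer_flat \<A> X)"
proof -
  interpret e: divisible_group "TYPE('e)" by (rule divisible_group_euclidean)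
  interpret l: abelian_arr "TYPE('e)" \<Gamma> "\<lambda>i. (dir i, 0)" L
    by unfold_locales (simp add: L_def localization_arrangement)
  have idx_L: "idx L = flat X" by (simp add: L_def arr_localization_def)
  have Xc: "X \<in> comps (flat X)" using X component_flat by (auto simp: layers_elts)
  have Xne: "X \<noteq> {}" using Xc in_components_nonempty by blast
  have compL: "components (intersection L C) = {intersection L C}" if C: "C \<subseteq> flat X" for C
  proof -
    have CL: "C \<subseteq> idx L" and CI: "C \<subseteq> I" using C by (auto simp: idx_L)
    have "intersection L C = agree \<Gamma> (dir ` C) (\<lambda>x\<in>\<Gamma>. 0 :: 'e)"
      using l.intersection_\<A>[OF CL] dirs(2)[OF CI] by (auto simp: agree_def)
    then have "intersection L C = agree \<Gamma> (Sg C) (\<lambda>x\<in>\<Gamma>. 0 :: 'e)"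
      using agree_zero_euclidean[OF free_\<Gamma> dirs(1,2)[OF CI], where 'e = 'e] by simp
    moreover have zero: "(\<lambda>x\<in>\<Gamma>. 0 :: 'e) \<in> Hom \<Gamma>" using Hom_const_zero[OF sub_\<Gamma>] .
    then have "connected (agree \<Gamma> (Sg C) (\<lambda>x\<in>\<Gamma>. 0 :: 'e))"
      using connected_agree[OF e.connected_G _ zero] free_Sg[OF CI] by blast
    moreover have "(\<lambda>x\<in>\<Gamma>. 0 :: 'e) \<in> agree \<Gamma> (Sg C) (\<lambda>x\<in>\<Gamma>. 0 :: 'e)"
      using zero by (simp add: agree_def)
    ultimately show ?thesis using components_eq_sing_iff by (metis empty_iff)
  qed
  let ?K = "mlocalization M (layer_flat \<A> X)"
  define F where "F = (\<lambda>(C, Y :: ('a \<Rightarrow> 'g) set). (C, intersection L C))"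
  have K: "(C, Y) \<in> elts ?K \<longleftrightarrow> C \<subseteq> flat X \<and> Y \<in> comps C \<and> X \<subseteq> Y" for C Y
    by (auto simp: mlocalization_def lower_def layer_flat_def)
  have S: "(C, Y) \<in> elts (arr_scheme L) \<longleftrightarrow> C \<subseteq> flat X \<and> Y = intersection L C" for C Y
    using compL by (auto simp: arr_scheme_def idx_L)
  have leK: "le ?K (C, Y) (D, Z) \<longleftrightarrow> C \<subseteq> D" if "(C, Y) \<in> elts ?K" "(D, Z) \<in> elts ?K" for C Y D Z
  proof -
    have "Z \<subseteq> Y" if "C \<subseteq> D"
      using component_absorb[of Y C X Z D] that Xne \<open>(C, Y) \<in> elts ?K\<close> \<open>(D, Z) \<in> elts ?K\<close>
      by (simp add: K)
    then show ?thesis by (auto simp: mlocalization_def lower_def)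
  qed
  have leL: "le (arr_scheme L) (F (C, Y)) (F (D, Z)) \<longleftrightarrow> C \<subseteq> D" for C Y D Z
    using l.intersection_mono[of C D] by (auto simp: F_def arr_scheme_def)
  have "poset_iso ?K (arr_scheme L) F"
  proof (rule poset_isoI)
    show "F ` elts ?K = elts (arr_scheme L)"
    proof (intro equalityI subsetI)
      fix z assume "z \<in> F ` elts ?K"
      then obtain C Y where "(C, Y) \<in> elts ?K" "z = F (C, Y)" by (metis imageE surj_pair)
      then show "z \<in> elts (arr_scheme L)" using K S by (simp add: F_def)
    next
      fix z assume z: "z \<in> elts (arr_scheme L)"
      obtain C W where CW: "z = (C, W)" by (metis surj_pair)
      then have C: "C \<subseteq> flat X" "W = intersection L C" using z S by auto
      then obtain Y where "Y \<in> comps C" "X \<subseteq> Y" using component_above[OF Xc] by blast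
      then show "z \<in> F ` elts ?K"
        using C CW K by (intro image_eqI[of _ _ "(C, Y)"]) (simp_all add: F_def)
    qed
    show "le ?K x y \<longleftrightarrow> le (arr_scheme L) (F x) (F y)" if "x \<in> elts ?K" "y \<in> elts ?K" for x y
      using that leK[of "fst x" "snd x" "fst y" "snd y"] leL[of "fst x" "snd x" "fst y" "snd y"]
      by simp
    show "x = y" if "le ?K x y" "le ?K y x" for x y
      using that le_M_antisym by (simp add: mlocalization_def lower_def)
    show "le (arr_scheme L) z z" for z by (cases z) (simp add: arr_scheme_def)
  qed
  moreover have "rho (arr_scheme L) (F x) = rho ?K x" if x: "x \<in> elts ?K" for x
  proof -
    obtain C Y where CY: "x = (C, Y)" by (metis surj_pair)
    then have C: "C \<subseteq> flat X" "Y \<in> comps C" using x K by auto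
    then have CI: "C \<subseteq> I" by blast
    have "rho (arr_scheme L) (F x) = l.mr C"
      using l.rho_M[of C "intersection L C"] C compL by (simp add: CY F_def idx_L)
    also have "\<dots> = mr C" by (simp add: l.mr_def mr_def)
    also have "\<dots> = rho ?K x"
      using rho_M[OF CI C(2)] by (simp add: CY mlocalization_def lower_def)
    finally show ?thesis .
  qed
  ultimately have "?K \<cong>\<^sub>M arr_scheme L"
    unfolding mscheme_isomorphic_def by blast
  then show ?thesis by (rule mscheme_isomorphic_sym)
qed

end

context abelian_arr
begin

text \<open>The given direction may be imprimitive, for over a torsion-free group such a member is
  still connected. Being connected, the member is the coset belonging to the saturation of its
  direction, which is generated by one element \<open>h\<close> and splits off.\<close>

lemma hyperplane_primitive:
  assumes "i \<in> I"
  shows "\<exists>\<alpha>\<in>\<Gamma>. \<exists>t \<Gamma>'. mem \<A> i = hyp \<Gamma> (\<alpha>, t) \<and> direct_summands \<Gamma> (zmod.span {\<alpha>}) \<Gamma>'"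
proof -
  obtain h where h: "h \<in> \<Gamma>" "sat \<Gamma> {dir i} = zmod.span {h}"
    using sat_singleton[OF free_\<Gamma> dir_\<Gamma>[OF assms]] by metis
  then have "free_ext (zmod.span {h}) \<Gamma>" using free_Sg[of "{i}"] assms by simp
  then obtain \<Gamma>' where \<Gamma>': "direct_summands \<Gamma> (zmod.span {h}) \<Gamma>'" using free_ext_complement by blast
  have "mem \<A> i \<in> comps {i}" using comps_single[OF assms] by simp
  also have "comps {i} = agree \<Gamma> (Sg {i}) ` intersection \<A> {i}"
    using assms by (intro comps_\<A>) simp
  finally obtain \<phi> where \<phi>: "\<phi> \<in> intersection \<A> {i}" "mem \<A> i = agree \<Gamma> (zmod.span {h}) \<phi>"
    using h(2) by auto
  have H: "\<phi> \<in> Hom \<Gamma>" using \<phi>(1) assms by (simp add: intersection_\<A>)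
  have "\<psi> x = \<phi> x" if "\<psi> \<in> Hom \<Gamma>" "\<psi> h = \<phi> h" "x \<in> zmod.span {h}" for \<psi> x
    using Hom_eq_on_span[OF that(1) H sub_\<Gamma> _ _ that(3)] that(2) h(1) by simp
  then have "mem \<A> i = hyp \<Gamma> (h, \<phi> h)"
    using zmod.span_base[of h "{h}"] unfolding \<phi>(2) by (auto simp: agree_def hyp_def)
  then show ?thesis using h(1) \<Gamma>' by blast
qed

end

locale abelian_restriction = abelian_arr ty \<Gamma> \<X> \<A>
  for ty :: "'g::{topological_ab_group_add, t2_space} itself"
    and \<Gamma> :: "'a::ab_group_add set" and \<X> :: "'i \<Rightarrow> 'a \<times> 'g" and \<A> :: "('i, 'a \<Rightarrow> 'g) arrangement" +
  fixes i0 :: 'i and \<Gamma>' :: "'a set"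
  assumes i0_idx: "i0 \<in> idx \<A>" and summands: "direct_summands \<Gamma> (zmod.span {fst (\<X> i0)}) \<Gamma>'"
begin

abbreviation "\<alpha> \<equiv> dir i0"

text \<open>An arbitrary origin of \<open>H0\<close>. All points of \<open>H0\<close> agree on the
  multiples of \<alpha>, so \<open>base_hom\<close> supplies the part of a lift that
  \<open>\<Gamma>'\<close> does not see.\<close>

definition base_hom :: "'a \<Rightarrow> 'g" where "base_hom = (SOME \<phi>. \<phi> \<in> mem \<A> i0)"
definition pr :: "'a \<Rightarrow> 'a" where "pr x = (THE y. y \<in> \<Gamma>' \<and> x - y \<in> zmod.span {\<alpha>})"
definition lft :: "('a \<Rightarrow> 'g) \<Rightarrow> 'a \<Rightarrow> 'g" where
  "lft \<psi> = (\<lambda>x\<in>\<Gamma>. base_hom (x - pr x) + \<psi> (pr x))"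

section \<open>Splitting off the direction of the distinguished member\<close>

lemma sub': "zmod.subspace \<Gamma>'" and disj: "zmod.span {\<alpha>} \<inter> \<Gamma>' = {0}"
  and \<Gamma>_eq: "\<Gamma> = {x + y | x y. x \<in> zmod.span {\<alpha>} \<and> y \<in> \<Gamma>'}"
  using summands by (auto simp: direct_summands_def)

lemma \<Gamma>'_subset: "\<Gamma>' \<subseteq> \<Gamma>"
proof
  fix y assume "y \<in> \<Gamma>'"
  then have "0 + y \<in> \<Gamma>" unfolding \<Gamma>_eq using zmod.span_zero by blast
  then show "y \<in> \<Gamma>" by simp
qed

lemma \<alpha>_\<Gamma>: "\<alpha> \<in> \<Gamma>"
  using dir_\<Gamma>[OF i0_idx] .

lemma span_\<alpha>: "zmod.span {\<alpha>} \<subseteq> \<Gamma>"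
  using \<alpha>_\<Gamma> sub_\<Gamma> by (intro zmod.span_minimal) auto

lemma pr_eqI:
  assumes "y \<in> \<Gamma>'" "x - y \<in> zmod.span {\<alpha>}"
  shows "pr x = y"
  unfolding pr_def
proof (rule the_equality)
  fix z assume z: "z \<in> \<Gamma>' \<and> x - z \<in> zmod.span {\<alpha>}"
  then have "z - y \<in> \<Gamma>'" using assms sub' zmod.subspace_diff by blast
  moreover have "(x - y) - (x - z) \<in> zmod.span {\<alpha>}" using assms z zmod.span_diff by blast
  ultimately have "z - y \<in> zmod.span {\<alpha>} \<inter> \<Gamma>'" by simp
  then show "z = y" unfolding disj by simp
qed (use assms in simp)

lemma pr:
  assumes "x \<in> \<Gamma>"
  shows "pr x \<in> \<Gamma>'" "x - pr x \<in> zmod.span {\<alpha>}"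
proof -
  obtain a y where ay: "a \<in> zmod.span {\<alpha>}" "y \<in> \<Gamma>'" "x = a + y" using assms \<Gamma>_eq by blast
  then have "pr x = y" by (intro pr_eqI) auto
  then show "pr x \<in> \<Gamma>'" "x - pr x \<in> zmod.span {\<alpha>}" using ay by auto
qed

lemma pr_add:
  assumes "x \<in> \<Gamma>" "y \<in> \<Gamma>"
  shows "pr (x + y) = pr x + pr y"
proof (rule pr_eqI)
  show "pr x + pr y \<in> \<Gamma>'" using pr(1) assms sub' zmod.subspace_add by blast
  have "(x - pr x) + (y - pr y) \<in> zmod.span {\<alpha>}" using pr(2) assms zmod.span_add by blast
  then show "x + y - (pr x + pr y) \<in> zmod.span {\<alpha>}" by (simp add: algebra_simps)
qed

lemma pr_zmult:
  assumes "x \<in> \<Gamma>"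
  shows "pr (zmult k x) = zmult k (pr x)"
proof (rule pr_eqI)
  show "zmult k (pr x) \<in> \<Gamma>'" using pr(1) assms sub' zmod.subspace_scale by blast
  have "zmult k (x - pr x) \<in> zmod.span {\<alpha>}" using pr(2) assms zmod.span_scale by blast
  then show "zmult k x - zmult k (pr x) \<in> zmod.span {\<alpha>}"
    by (simp add: zmod.scale_right_diff_distrib)
qed

lemma pr_id: "x \<in> \<Gamma>' \<Longrightarrow> pr x = x"
  by (rule pr_eqI) (auto simp: zmod.span_zero)

lemma pr_span: "x \<in> zmod.span {\<alpha>} \<Longrightarrow> pr x = 0"
  using zmod.subspace_0[OF sub'] by (intro pr_eqI) auto

lemma subspace_pr_vimage: "zmod.subspace W \<Longrightarrow> zmod.subspace {x \<in> \<Gamma>. pr x \<in> W}"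
  using pr_span[OF zmod.span_zero] sub_\<Gamma>
  by (intro zmod.subspaceI)
    (auto simp: pr_add pr_zmult zmod.subspace_0 zmod.subspace_add zmod.subspace_scale)

text \<open>Projection commutes with multiples, so \<open>k\<close> times the component of
  \<open>x\<close> along \<alpha> vanishes, and \<Gamma> has no torsion.\<close>

lemma \<Gamma>'_pure:
  assumes "x \<in> \<Gamma>" "k \<noteq> 0" "zmult k x \<in> \<Gamma>'"
  shows "x \<in> \<Gamma>'"
proof -
  have "zmult k x = zmult k (pr x)" using pr_id[OF assms(3)] pr_zmult[OF assms(1)] by simp
  then have "zmult k (x - pr x) = 0" by (simp add: zmod.scale_right_diff_distrib)
  moreover have "x - pr x \<in> \<Gamma>" using pr(2)[OF assms(1)] span_\<alpha> by blast
  ultimately have "x - pr x = 0" using free_ext_pure[OF free_\<Gamma>, of "x - pr x" k] assms(2) by simp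
  then show ?thesis using pr(1)[OF assms(1)] by simp
qed

text \<open>The projections of generators of \<Gamma> generate \<open>\<Gamma>'\<close>. By purity
  \<open>\<Gamma>'\<close> is its own saturation, and saturations of finite sets are free.\<close>

lemma free_\<Gamma>': "free_ext {0} \<Gamma>'"
proof -
  obtain F where F: "finite F" "\<Gamma> = zmod.span F" using free_ext_finite_span[OF free_\<Gamma>] by metis
  then have F\<Gamma>: "F \<subseteq> \<Gamma>" using zmod.span_superset by blast
  have prF: "pr ` F \<subseteq> \<Gamma>'" using F\<Gamma> pr(1) by blast
  have "zmod.span F \<subseteq> {x \<in> \<Gamma>. pr x \<in> zmod.span (pr ` F)}"
    using F\<Gamma> by (intro zmod.span_minimal subspace_pr_vimage) (auto intro: zmod.span_base)
  then have "\<Gamma>' \<subseteq> zmod.span (pr ` F)" using \<Gamma>'_subset F(2) pr_id by force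
  moreover have "zmod.span (pr ` F) \<subseteq> \<Gamma>'" using prF sub' by (rule zmod.span_minimal)
  ultimately have sp: "zmod.span (pr ` F) = \<Gamma>'" by blast
  have "sat \<Gamma> (pr ` F) = \<Gamma>'"
  proof
    show "sat \<Gamma> (pr ` F) \<subseteq> \<Gamma>'" using \<Gamma>'_pure by (auto simp: sat_def sp)
    show "\<Gamma>' \<subseteq> sat \<Gamma> (pr ` F)" using \<Gamma>'_subset by (auto simp: sat_def sp intro!: exI[of _ 1])
  qed
  then show ?thesis
    using free_ext_sat[OF free_\<Gamma>, of "pr ` F"] F(1) prF \<Gamma>'_subset by auto
qed

lemma H0_eq: "mem \<A> i0 = {\<phi> \<in> Hom \<Gamma>. \<phi> \<alpha> = snd (\<X> i0)}"
  using mem_\<A>[OF i0_idx] .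

lemma base_hom: "base_hom \<in> mem \<A> i0"
  unfolding base_hom_def using mem_nonempty[OF i0_idx] some_in_eq by blast

lemma H0_agree:
  assumes "\<phi> \<in> mem \<A> i0" "x \<in> zmod.span {\<alpha>}"
  shows "\<phi> x = base_hom x"
  by (rule Hom_eq_on_span[OF _ _ sub_\<Gamma> _ _ assms(2)])
    (use assms(1) base_hom \<alpha>_\<Gamma> in \<open>auto simp: H0_eq\<close>)

lemma lft_in:
  assumes "\<psi> \<in> Hom \<Gamma>'"
  shows "lft \<psi> \<in> mem \<A> i0"
proof -
  have bH: "base_hom \<in> Hom \<Gamma>" "base_hom \<alpha> = snd (\<X> i0)" using base_hom H0_eq by auto
  have "lft \<psi> (x + y) = lft \<psi> x + lft \<psi> y" if xy: "x \<in> \<Gamma>" "y \<in> \<Gamma>" for x y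
  proof -
    have "x + y \<in> \<Gamma>" using xy sub_\<Gamma> zmod.subspace_add by blast
    moreover have "x - pr x \<in> \<Gamma>" "y - pr y \<in> \<Gamma>" using pr(2) xy span_\<alpha> by blast+
    then have "base_hom ((x - pr x) + (y - pr y)) = base_hom (x - pr x) + base_hom (y - pr y)"
      by (rule Hom_add[OF bH(1)])
    then have "base_hom (x + y - (pr x + pr y)) = base_hom (x - pr x) + base_hom (y - pr y)"
      by (simp only: add_diff_add)
    moreover have "\<psi> (pr x + pr y) = \<psi> (pr x) + \<psi> (pr y)"
      using Hom_add[OF assms] pr(1) xy by blast
    ultimately show ?thesis using xy by (simp add: lft_def pr_add[OF xy] add.assoc add.left_commute)
  qed
  then have "lft \<psi> \<in> Hom \<Gamma>" by (simp add: Hom_def) (simp add: lft_def)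
  moreover have "lft \<psi> \<alpha> = snd (\<X> i0)"
    using pr_span[OF zmod.span_base[of \<alpha> "{\<alpha>}"]] \<alpha>_\<Gamma> bH(2) Hom_zero[OF assms sub'] by (simp add: lft_def)
  ultimately show ?thesis by (simp add: H0_eq)
qed

lemma restrict_lft:
  assumes "\<psi> \<in> Hom \<Gamma>'"
  shows "restrict (lft \<psi>) \<Gamma>' = \<psi>"
proof (rule extensionalityI[of _ \<Gamma>'])
  show "\<psi> \<in> extensional \<Gamma>'" using assms by (simp add: Hom_def)
  have "base_hom 0 = 0" using base_hom Hom_zero[OF _ sub_\<Gamma>, of base_hom] by (simp add: H0_eq)
  then show "restrict (lft \<psi>) \<Gamma>' x = \<psi> x" if "x \<in> \<Gamma>'" for x
    using that \<Gamma>'_subset by (auto simp: lft_def pr_id)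
qed simp

lemma lft_apply:
  assumes "\<phi> \<in> mem \<A> i0" "x \<in> \<Gamma>"
  shows "\<phi> x = base_hom (x - pr x) + \<phi> (pr x)"
proof -
  have "\<phi> ((x - pr x) + pr x) = \<phi> (x - pr x) + \<phi> (pr x)"
    using assms pr(2)[OF assms(2)] span_\<alpha> pr(1)[OF assms(2)] \<Gamma>'_subset
    by (intro Hom_add[of \<phi> \<Gamma>]) (auto simp: H0_eq)
  then show ?thesis using H0_agree[OF assms(1) pr(2)[OF assms(2)]] by simp
qed

lemma lft_restrict:
  assumes "\<phi> \<in> mem \<A> i0"
  shows "lft (restrict \<phi> \<Gamma>') = \<phi>"
proof (rule extensionalityI[of _ \<Gamma>])
  show "\<phi> \<in> extensional \<Gamma>" using assms by (simp add: H0_eq Hom_def)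
  show "lft (restrict \<phi> \<Gamma>') x = \<phi> x" if "x \<in> \<Gamma>" for x
    using lft_apply[OF assms that] that pr(1)[OF that] by (simp add: lft_def)
qed (simp add: lft_def)

lemma restrict_H0: "\<phi> \<in> mem \<A> i0 \<Longrightarrow> restrict \<phi> \<Gamma>' \<in> Hom \<Gamma>'"
  using Hom_restrict[OF _ \<Gamma>'_subset sub', of \<phi>] by (simp add: H0_eq)

lemma restriction_homeomorphism:
  "homeomorphism (mem \<A> i0) (Hom \<Gamma>') (\<lambda>\<phi>. restrict \<phi> \<Gamma>') lft"
  unfolding homeomorphism_def
proof (intro conjI ballI)
  show "(\<lambda>\<phi>. restrict \<phi> \<Gamma>') ` mem \<A> i0 = Hom \<Gamma>'"
  proof (intro equalityI subsetI)
    fix \<psi> :: "'a \<Rightarrow> 'g" assume "\<psi> \<in> Hom \<Gamma>'"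
    then show "\<psi> \<in> (\<lambda>\<phi>. restrict \<phi> \<Gamma>') ` mem \<A> i0"
      using lft_in restrict_lft by (metis imageI)
  qed (use restrict_H0 in blast)
  show "lft ` Hom \<Gamma>' = mem \<A> i0"
  proof (intro equalityI subsetI)
    fix \<phi> assume "\<phi> \<in> mem \<A> i0"
    then show "\<phi> \<in> lft ` Hom \<Gamma>'" using lft_restrict restrict_H0 by (metis imageI)
  qed (use lft_in in blast)
  show "continuous_on (mem \<A> i0) (\<lambda>\<phi>. restrict \<phi> \<Gamma>')"
  proof (rule continuous_on_coordinatewise_then_product)
    fix x
    show "continuous_on (mem \<A> i0) (\<lambda>\<phi>. restrict \<phi> \<Gamma>' x)"
      by (cases "x \<in> \<Gamma>'") (simp_all add: continuous_on_eval)
  qed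
  show "continuous_on (Hom \<Gamma>') lft"
  proof (rule continuous_on_coordinatewise_then_product)
    fix x
    show "continuous_on (Hom \<Gamma>') (\<lambda>\<psi>. lft \<psi> x)"
      by (cases "x \<in> \<Gamma>") (auto simp: lft_def intro!: continuous_intros continuous_on_eval)
  qed
qed (simp_all add: lft_restrict restrict_lft)

sublocale restricted_arrangement \<A> mr i0 "Hom \<Gamma>'" "\<lambda>\<phi>. restrict \<phi> \<Gamma>'" lft
  by unfold_locales (rule i0_idx, rule restriction_homeomorphism)

lemma R_eq: "arr_restriction \<Gamma>' \<A> i0 = R"
  by (simp add: arr_restriction_def R_def)

text \<open>The saturation of \<open>{\<alpha>, \<beta>}\<close> meets \<open>\<Gamma>'\<close> in the saturation of the projection of \<open>\<beta>\<close>, which is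
  cyclic with generator \<open>h\<close>.\<close>

lemma trace_hyp:
  assumes i: "i \<in> I" and C: "C \<in> components (mem \<A> i0 \<inter> mem \<A> i)"
  shows "\<exists>h\<in>\<Gamma>'. \<exists>s. (\<lambda>\<phi>. restrict \<phi> \<Gamma>') ` C = hyp \<Gamma>' (h, s)"
proof -
  let ?B = "{i0, i}" and ?\<beta> = "dir i"
  have BI: "?B \<subseteq> I" using i i0_idx by simp
  have \<beta>\<Gamma>: "?\<beta> \<in> \<Gamma>" using dir_\<Gamma>[OF i] .
  have "mem \<A> i0 \<inter> mem \<A> i = intersection \<A> ?B"
    using mem_space[OF i0_idx] by (auto simp: intersection_def)
  then obtain \<phi> where \<phi>: "\<phi> \<in> mem \<A> i0 \<inter> mem \<A> i" "C = agree \<Gamma> (Sg ?B) \<phi>"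
    using C comps_\<A>[OF BI] by auto
  then have \<phi>H0: "\<phi> \<in> mem \<A> i0" and \<phi>H: "\<phi> \<in> Hom \<Gamma>" by (auto simp: H0_eq)
  obtain h where h: "h \<in> \<Gamma>'" "sat \<Gamma>' {pr ?\<beta>} = zmod.span {h}"
    using sat_singleton[OF free_\<Gamma>' pr(1)[OF \<beta>\<Gamma>]] by metis
  have \<alpha>Sg: "\<alpha> \<in> Sg ?B" using sat_superset[OF dirs(2)[OF BI]] by simp
  have "h \<in> sat \<Gamma>' {pr ?\<beta>}" unfolding h(2) by (rule zmod.span_base) simp
  then obtain k where k: "k \<noteq> 0" "zmult k h \<in> zmod.span {pr ?\<beta>}" by (auto simp: sat_def)
  have "?\<beta> - (?\<beta> - pr ?\<beta>) \<in> zmod.span (dir ` ?B)"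
  proof (rule zmod.span_diff)
    show "?\<beta> \<in> zmod.span (dir ` ?B)" by (rule zmod.span_base) simp
    have "zmod.span {\<alpha>} \<subseteq> zmod.span (dir ` ?B)" by (rule zmod.span_mono) simp
    then show "?\<beta> - pr ?\<beta> \<in> zmod.span (dir ` ?B)" using pr(2)[OF \<beta>\<Gamma>] by blast
  qed
  then have "zmod.span {pr ?\<beta>} \<subseteq> zmod.span (dir ` ?B)"
    by (intro zmod.span_minimal) auto
  then have hSg: "h \<in> Sg ?B" using k h(1) \<Gamma>'_subset unfolding sat_def by blast
  have "zmod.subspace {x \<in> \<Gamma>. pr x \<in> zmod.span {pr ?\<beta>}}"
    by (rule subspace_pr_vimage) simp
  moreover have "dir ` ?B \<subseteq> {x \<in> \<Gamma>. pr x \<in> zmod.span {pr ?\<beta>}}"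
    using \<alpha>_\<Gamma> \<beta>\<Gamma> pr_span[OF zmod.span_base[of \<alpha> "{\<alpha>}"]]
    by (auto simp: zmod.span_zero intro: zmod.span_base)
  ultimately have "zmod.span (dir ` ?B) \<subseteq> {x \<in> \<Gamma>. pr x \<in> zmod.span {pr ?\<beta>}}"
    by (intro zmod.span_minimal)
  then have prSg: "pr x \<in> zmod.span {h}" if x: "x \<in> Sg ?B" for x
  proof -
    obtain l where l: "l \<noteq> 0" "zmult l x \<in> zmod.span (dir ` ?B)" and x\<Gamma>: "x \<in> \<Gamma>"
      using x by (auto simp: sat_def)
    then have "zmult l (pr x) \<in> zmod.span {pr ?\<beta>}"
      using \<open>zmod.span (dir ` ?B) \<subseteq> _\<close> pr_zmult[OF x\<Gamma>, of l] by auto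
    then have "pr x \<in> sat \<Gamma>' {pr ?\<beta>}" using l(1) pr(1)[OF x\<Gamma>] by (auto simp: sat_def)
    then show ?thesis using h(2) by simp
  qed
  have "(\<lambda>\<phi>. restrict \<phi> \<Gamma>') ` C = hyp \<Gamma>' (h, \<phi> h)"
  proof (intro equalityI subsetI)
    fix \<psi> assume "\<psi> \<in> (\<lambda>\<phi>. restrict \<phi> \<Gamma>') ` C"
    then obtain \<eta> where \<eta>: "\<eta> \<in> C" "\<psi> = restrict \<eta> \<Gamma>'" by blast
    then have "\<eta> \<in> Hom \<Gamma>" "\<eta> h = \<phi> h" using \<phi>(2) hSg by (auto simp: agree_def)
    then show "\<psi> \<in> hyp \<Gamma>' (h, \<phi> h)"
      using \<eta>(2) h(1) Hom_restrict[OF _ \<Gamma>'_subset sub', of \<eta>] by (simp add: hyp_def)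
  next
    fix \<psi> assume \<psi>: "\<psi> \<in> hyp \<Gamma>' (h, \<phi> h)"
    then have \<psi>H: "\<psi> \<in> Hom \<Gamma>'" "\<psi> h = \<phi> h" by (auto simp: hyp_def)
    \<comment> \<open>Both homomorphisms lie in \<open>H0\<close>, so only the projection of
      \<open>x\<close> matters; it is a multiple of \<open>h\<close>, where \<psi> and \<phi>
      agree.\<close>
    have "lft \<psi> x = \<phi> x" if x: "x \<in> Sg ?B" for x
    proof -
      have x\<Gamma>: "x \<in> \<Gamma>" using x sat_subset by blast
      have "\<psi> (pr x) = restrict \<phi> \<Gamma>' (pr x)"
        by (rule Hom_eq_on_span[OF \<psi>H(1) restrict_H0[OF \<phi>H0] sub' _ _ prSg[OF x]])
          (use h(1) \<psi>H(2) in auto)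
      then show ?thesis
        using lft_apply[OF \<phi>H0 x\<Gamma>] pr(1)[OF x\<Gamma>] x\<Gamma> by (simp add: lft_def)
    qed
    then have "lft \<psi> \<in> C"
      using \<phi>(2) lft_in[OF \<psi>H(1)] by (simp add: agree_def H0_eq)
    then show "\<psi> \<in> (\<lambda>\<phi>. restrict \<phi> \<Gamma>') ` C"
      using restrict_lft[OF \<psi>H(1)] by (metis imageI)
  qed
  then show ?thesis using h(1) by blast
qed

lemma restriction_arrangement: "\<exists>\<X>'. abelian_arrangement \<Gamma>' \<X>' (arr_restriction \<Gamma>' \<A> i0)"
proof -
  have "\<forall>z\<in>idx R. \<exists>w. fst w \<in> \<Gamma>' \<and> mem R z = hyp \<Gamma>' w"
  proof
    fix z assume z: "z \<in> idx R"
    obtain i C where iC: "z = (i, C)" by (metis surj_pair)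
    then have "i \<in> I" "C \<in> components (mem \<A> i0 \<inter> mem \<A> i)" using z idx_R by auto
    then obtain h s where "h \<in> \<Gamma>'" "(\<lambda>\<phi>. restrict \<phi> \<Gamma>') ` C = hyp \<Gamma>' (h, s)"
      using trace_hyp by blast
    then show "\<exists>w. fst w \<in> \<Gamma>' \<and> mem R z = hyp \<Gamma>' w"
      by (intro exI[of _ "(h, s)"]) (simp add: iC R_def)
  qed
  then obtain \<X>' where \<X>': "\<And>z. z \<in> idx R \<Longrightarrow> fst (\<X>' z) \<in> \<Gamma>' \<and> mem R z = hyp \<Gamma>' (\<X>' z)"
    by metis
  have "finite (idx R)"
  proof (rule finite_subset)
    show "idx R \<subseteq> (SIGMA i:I. components (mem \<A> i0 \<inter> mem \<A> i))" by (auto simp: R_def)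
    have "finite (components (mem \<A> i0 \<inter> mem \<A> i))" if "i \<in> I" for i
    proof -
      have "mem \<A> i0 \<inter> mem \<A> i = intersection \<A> {i0, i}"
        using mem_space[OF i0_idx] by (auto simp: intersection_def)
      then show ?thesis using finite_components[of "{i0, i}"] that i0_idx by simp
    qed
    then show "finite (SIGMA i:I. components (mem \<A> i0 \<inter> mem \<A> i))"
      using finite_idx by (rule finite_SigmaI[rotated])
  qed
  moreover have "connected (mem R z) \<and> mem R z \<noteq> {}" if z: "z \<in> idx R" for z
  proof -
    obtain i C where iC: "z = (i, C)" by (metis surj_pair)
    then have C: "C \<in> components (mem \<A> i0 \<inter> mem \<A> i)" using z idx_R by auto
    have "C \<subseteq> mem \<A> i0" using in_components_subset[OF C] by blast
    moreover have "continuous_on (mem \<A> i0) (\<lambda>\<phi>. restrict \<phi> \<Gamma>')"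
      using restriction_homeomorphism by (simp add: homeomorphism_def)
    ultimately have "continuous_on C (\<lambda>\<phi>. restrict \<phi> \<Gamma>')"
      using continuous_on_subset by metis
    then have "connected ((\<lambda>\<phi>. restrict \<phi> \<Gamma>') ` C)"
      using in_components_connected[OF C] by (rule connected_continuous_image)
    then show ?thesis using in_components_nonempty[OF C] by (simp add: iC R_def)
  qed
  moreover have "space R = Hom \<Gamma>'"
    using restriction_homeomorphism by (simp add: R_def homeomorphism_def)
  moreover have "free_abelian_finite_rank \<Gamma>'" using free_\<Gamma>' by (simp add: free_abelian_iff)
  ultimately have "abelian_arrangement \<Gamma>' \<X>' R"
    using \<X>' by (simp add: abelian_arrangement_def)
  then show ?thesis unfolding R_eq by blast
qed

end

text \<open>The contraction argument needs \<open>k\<close> at least 2; for \<open>k = 1\<close>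
  both claims are trivial.\<close>

lemma abelian_lie_group_divisible:
  fixes \<U> :: "('g::{topological_ab_group_add, t2_space, second_countable_topology} set
                 \<times> ('g \<Rightarrow> 'e::euclidean_space)) set"
  assumes "abelian_lie_group \<U>" "connected (UNIV :: 'g set)"
  shows "divisible_group TYPE('g)"
proof -
  obtain U and \<phi> :: "'g \<Rightarrow> 'e" where "chart_at_zero U \<phi>"
    using abelian_lie_group_chart[OF assms(1)] by metis
  then interpret c: chart_at_zero U \<phi> .
  have sd: "\<exists>K V :: 'g set. self_divisible_compact K V k" if k: "k \<ge> 2" for k
  proof -
    obtain K V :: "'g set" where "compact K" "V \<subseteq> K" "open V" "0 \<in> V" "K \<subseteq> nmult k ` K"
      "\<forall>x\<in>V. nmult k x = 0 \<longrightarrow> x = 0"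
      using c.divisible_neighbourhood[OF k] by metis
    then have "self_divisible_compact K V k"
      using assms(2) by unfold_locales auto
    then show ?thesis by blast
  qed
  show ?thesis
  proof
    fix k :: nat and x :: 'g assume k: "k > 0"
    show "\<exists>y::'g. nmult k y = x"
    proof (cases "k \<ge> 2")
      case True
      then show ?thesis using sd[OF True] self_divisible_compact.divisible by blast
    next
      case False
      then have "k = Suc 0" using k by simp
      then show ?thesis by simp
    qed
  next
    fix k :: nat assume k: "k > 0"
    show "finite {x::'g. nmult k x = 0}"
    proof (cases "k \<ge> 2")
      case True
      then show ?thesis using sd[OF True] self_divisible_compact.finite_torsion by blast
    next
      case False
      then have "k = Suc 0" using k by simp
      then show ?thesis by simp
    qed
  qed (rule assms(2), rule c.nontrivial)
qed

theorem theorem13p10: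
  fixes \<U> :: "('g::{topological_ab_group_add, t2_space, second_countable_topology} set
                 \<times> ('g \<Rightarrow> real ^ 'n)) set"
    and \<Gamma> :: "'a::ab_group_add set"
    and \<X> :: "'i \<Rightarrow> 'a \<times> 'g"
    and \<A> :: "('i, 'a \<Rightarrow> 'g) arrangement"
  assumes "abelian_lie_group \<U>"
    and "connected (UNIV :: 'g set)"
    and "abelian_arrangement \<Gamma> \<X> \<A>"
  shows
    "matroid_scheme (arr_scheme \<A>) \<and>
     poset_iso (layers \<A>) (flats (arr_scheme \<A>)) (layer_flat \<A>) \<and>
     (\<forall>i\<^sub>0\<in>idx \<A>.
        mem \<A> i\<^sub>0 \<in> elts (layers \<A>) \<and>
        atom (arr_scheme \<A>) (arr_atom \<A> i\<^sub>0) \<and>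
        (inj_on (mem \<A>) (idx \<A>) \<and> (\<forall>i\<in>idx \<A>. mem \<A> i \<noteq> Hom \<Gamma>) \<longrightarrow>
           layer_flat \<A> (mem \<A> i\<^sub>0) = arr_atom \<A> i\<^sub>0) \<and>
        arr_scheme (arr_deletion \<A> i\<^sub>0) \<cong>\<^sub>M mdeletion (arr_scheme \<A>) (arr_atom \<A> i\<^sub>0) \<and>
        (\<exists>\<alpha>\<in>\<Gamma>. \<exists>t \<Gamma>'. mem \<A> i\<^sub>0 = hyp \<Gamma> (\<alpha>, t) \<and> direct_summands \<Gamma> (zmod.span {\<alpha>}) \<Gamma>') \<and>
        (\<forall>\<alpha>\<in>\<Gamma>. \<forall>t \<Gamma>'. mem \<A> i\<^sub>0 = hyp \<Gamma> (\<alpha>, t) \<and> direct_summands \<Gamma> (zmod.span {\<alpha>}) \<Gamma>' \<longrightarrow>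
           (\<exists>\<X>'. abelian_arrangement \<Gamma>' \<X>' (arr_restriction \<Gamma>' \<A> i\<^sub>0)) \<and>
           arr_scheme (arr_restriction \<Gamma>' \<A> i\<^sub>0)
             \<cong>\<^sub>M mcontraction (arr_scheme \<A>) (arr_atom \<A> i\<^sub>0))) \<and>
     (\<forall>X\<in>elts (layers \<A>).
        abelian_arrangement \<Gamma> (\<lambda>i. (fst (\<X> i), 0))
          (arr_localization \<Gamma> \<X> \<A> X :: ('i, 'a \<Rightarrow> real ^ 'n) arrangement) \<and>
        arr_scheme (arr_localization \<Gamma> \<X> \<A> X :: ('i, 'a \<Rightarrow> real ^ 'n) arrangement)
          \<cong>\<^sub>M mlocalization (arr_scheme \<A>) (layer_flat \<A> X))"
proof -
  have G: "divisible_group TYPE('g)" using abelian_lie_group_divisible[OF assms(1,2)] .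
  interpret abelian_arr "TYPE('g)" \<Gamma> \<X> \<A>
    using G assms(3) by (intro abelian_arr.intro abelian_arr_axioms.intro)
  have restriction: "(\<exists>\<X>'. abelian_arrangement \<Gamma>' \<X>' (arr_restriction \<Gamma>' \<A> i)) \<and>
      arr_scheme (arr_restriction \<Gamma>' \<A> i) \<cong>\<^sub>M mcontraction (arr_scheme \<A>) (arr_atom \<A> i)"
    if i: "i \<in> idx \<A>" "\<alpha> \<in> \<Gamma>" "mem \<A> i = hyp \<Gamma> (\<alpha>, t)" "direct_summands \<Gamma> (zmod.span {\<alpha>}) \<Gamma>'"
    for i \<alpha> t \<Gamma>'
  proof -
    \<comment> \<open>The presentation of the member is exchanged for the given one, so that its
      direction is the one split off. The members as sets, and hence the scheme, stay the
      same.\<close>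
    let ?\<X> = "\<X>(i := (\<alpha>, t))"
    have "abelian_arrangement \<Gamma> ?\<X> \<A>"
      using assms(3) i(2,3) unfolding abelian_arrangement_def by auto
    then interpret r: abelian_restriction "TYPE('g)" \<Gamma> ?\<X> \<A> i \<Gamma>'
      using G i(1,4)
      by (intro abelian_restriction.intro abelian_restriction_axioms.intro abelian_arr.intro
          abelian_arr_axioms.intro) simp_all
    show ?thesis using r.restriction_arrangement r.restriction_iso by (simp add: r.R_eq)
  qed
  have flat: "layer_flat \<A> (mem \<A> i) = arr_atom \<A> i"
    if "i \<in> idx \<A>" "inj_on (mem \<A>) (idx \<A>) \<and> (\<forall>i\<in>idx \<A>. mem \<A> i \<noteq> Hom \<Gamma>)" for i
    using that by (intro layer_flat_mem) (auto simp: space_\<A>)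
  show ?thesis
  proof (intro conjI ballI allI impI)
    show "matroid_scheme (arr_scheme \<A>)" by (rule matroid_scheme_M)
    show "poset_iso (layers \<A>) (flats (arr_scheme \<A>)) (layer_flat \<A>)" by (rule layers_iso)
  next
    fix i assume i: "i \<in> idx \<A>"
    show "mem \<A> i \<in> elts (layers \<A>)" using i by (rule mem_layer)
    show "atom (arr_scheme \<A>) (arr_atom \<A> i)" using i atom_M by blast
    show "arr_scheme (arr_deletion \<A> i) \<cong>\<^sub>M mdeletion (arr_scheme \<A>) (arr_atom \<A> i)"
      by (rule deletion_iso)
    show "\<exists>\<alpha>\<in>\<Gamma>. \<exists>t \<Gamma>'. mem \<A> i = hyp \<Gamma> (\<alpha>, t) \<and> direct_summands \<Gamma> (zmod.span {\<alpha>}) \<Gamma>'"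
      using i by (rule hyperplane_primitive)
    show "layer_flat \<A> (mem \<A> i) = arr_atom \<A> i"
      if "inj_on (mem \<A>) (idx \<A>) \<and> (\<forall>i\<in>idx \<A>. mem \<A> i \<noteq> Hom \<Gamma>)"
      using flat[OF i that] .
    fix \<alpha> t \<Gamma>'
    assume "\<alpha> \<in> \<Gamma>" "mem \<A> i = hyp \<Gamma> (\<alpha>, t) \<and> direct_summands \<Gamma> (zmod.span {\<alpha>}) \<Gamma>'"
    then have "(\<exists>\<X>'. abelian_arrangement \<Gamma>' \<X>' (arr_restriction \<Gamma>' \<A> i)) \<and>
      arr_scheme (arr_restriction \<Gamma>' \<A> i) \<cong>\<^sub>M mcontraction (arr_scheme \<A>) (arr_atom \<A> i)"
      using restriction i by blast
    then show "\<exists>\<X>'. abelian_arrangement \<Gamma>' \<X>' (arr_restriction \<Gamma>' \<A> i)"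
      "arr_scheme (arr_restriction \<Gamma>' \<A> i) \<cong>\<^sub>M mcontraction (arr_scheme \<A>) (arr_atom \<A> i)"
      by auto
  next
    fix X assume X: "X \<in> elts (layers \<A>)"
    show "abelian_arrangement \<Gamma> (\<lambda>i. (fst (\<X> i), 0))
        (arr_localization \<Gamma> \<X> \<A> X :: ('i, 'a \<Rightarrow> real ^ 'n) arrangement)"
      by (rule localization_arrangement)
    show "arr_scheme (arr_localization \<Gamma> \<X> \<A> X :: ('i, 'a \<Rightarrow> real ^ 'n) arrangement)
        \<cong>\<^sub>M mlocalization (arr_scheme \<A>) (layer_flat \<A> X)"
      using X by (rule localization_iso)
  qed
qed

end
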